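(* For a variable-radius family $\{\Phi_a\}_{a\in I}$ in $\mathbb{M}^{n+1}_\kappa$ with radius function $r$, write $|\Sigma_a|$ for the $n$-dimensional volume of $\Sigma_a$ and $|\partial\Sigma_a|$ for the $(n-1)$-dimensional volume of its boundary. Then $$\frac{d}{da}\,|\Sigma_a|=r'(a)\,|\partial\Sigma_a| .$$ Since $|\partial\Sigma_a|>0$, the critical points of $a\mapsto|\Sigma_a|$ are exactly the critical points of $r$.
   Context: For $\kappa\in\{-1,0,1\}$, $\mathbb{M}^{n+1}_\kappa$ is the complete simply connected space form of constant sectional curvature $\kappa$. Fix $p_0$, let $\rho=\operatorname{dist}(p_0,\cdot)$, $B(r)$ the closed geodesic ball of radius $r>0$ centred at $p_0$ ($r<\pi$ if $\kappa=1$), $S(r)=\partial B(r)$. A free boundary minimal immersion in $B(r)$ is a two-sided minimal immersion $\Phi:\Sigma^n\to B(r)$ of a compact manifold with nonempty boundary, with $\Phi(\partial\Sigma)\subset S(r)$ and outward unit conormal $\eta$ of $\partial\Sigma$ in $\Sigma$ equal to $\partial_\rho$ along $\partial\Sigma$. A variable-radius family is a smooth map $\Phi:I\times\Sigma\to\mathbb{M}^{n+1}_\kappa$, $I\subset\mathbb{R}$ an interval, $\Sigma$ a compact $n$-manifold with boundary each of whose connected components has nonempty boundary, such that every $\Phi_a=\Phi(a,\cdot)$ is a free boundary minimal immersion in $B(r(a))$ (all balls centred at $p_0$), with $r:I\to(0,\infty)$ smooth and $r<\pi$ if $\kappa=1$. $\Sigma_a$ denotes $\Sigma$ with the immersion $\Phi_a$;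 volumes are those of the induced metrics. *)

theory Defs
  imports "HOL-Analysis.Analysis"
begin

section \<open>Smooth maps\<close>

primrec Ck_on :: "nat \<Rightarrow> 'a::real_normed_vector set \<Rightarrow> ('a \<Rightarrow> 'b::real_normed_vector) \<Rightarrow> bool" where
  "Ck_on 0 U f \<longleftrightarrow> continuous_on U f"
| "Ck_on (Suc m) U f \<longleftrightarrow>
     (\<forall>x\<in>U. f differentiable (at x)) \<and> (\<forall>v. Ck_on m U (\<lambda>x. frechet_derivative f (at x) v))"

text \<open>Only meant for open \<open>U\<close> and finite-dimensional domains. On an arbitrary subset (relatively open
  subsets of a half-space, intervals, their products), smooth means locally extendable to a smooth
  map on an open set.\<close>

definition smooth_on :: "'a::real_normed_vector set \<Rightarrow> ('a \<Rightarrow> 'b::real_normed_vector) \<Rightarrow> bool" where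
  "smooth_on S f \<longleftrightarrow>
     (\<forall>x\<in>S. \<exists>U g. open U \<and> x \<in> U \<and> (\<forall>m. Ck_on m U g) \<and> (\<forall>y\<in>U \<inter> S. g y = f y))"


section \<open>Compact manifolds with boundary\<close>

definition halfspace :: "'n::finite \<Rightarrow> (real ^ 'n) set" where
  "halfspace k = {x. 0 \<le> x $ k}"

text \<open>A chart is a pair of its domain and its coordinate map.\<close>

type_synonym ('m, 'n) chart = "'m set \<times> ('m \<Rightarrow> real ^ 'n)"

text \<open>A smooth atlas on the Hausdorff space \<open>M\<close> (with the subspace topology) modelled on
  the half-space of \<open>\<real>\<^sup>n\<close>, where \<open>n = CARD('n)\<close>. The manifold is compact, so that second
  countability is automatic.\<close>

definition compact_manifold ::
  "'n::finite \<Rightarrow> 'm::t2_space set \<Rightarrow> ('m, 'n) chart set \<Rightarrow> bool" where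
  "compact_manifold k M A \<longleftrightarrow>
     compact M \<and> (\<Union>(U, \<phi>)\<in>A. U) = M \<and>
     (\<forall>(U, \<phi>)\<in>A. openin (top_of_set M) U \<and> openin (top_of_set (halfspace k)) (\<phi> ` U) \<and>
        homeomorphism U (\<phi> ` U) \<phi> (inv_into U \<phi>)) \<and>
     (\<forall>(U, \<phi>)\<in>A. \<forall>(V, \<psi>)\<in>A. smooth_on (\<phi> ` (U \<inter> V)) (\<psi> \<circ> inv_into U \<phi>))"

definition boundary :: "'n::finite \<Rightarrow> ('m, 'n) chart set \<Rightarrow> 'm set" where
  "boundary k A = {p. \<exists>(U, \<phi>)\<in>A. p \<in> U \<and> \<phi> p $ k = 0}"

definition local_rep :: "('m, 'n::finite) chart \<Rightarrow> ('m \<Rightarrow> 'b) \<Rightarrow> real ^ 'n \<Rightarrow> 'b" where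
  "local_rep c F = (\<lambda>x. F (inv_into (fst c) (snd c) x))"

definition smooth_map :: "('m, 'n::finite) chart set \<Rightarrow> ('m \<Rightarrow> 'b::real_normed_vector) \<Rightarrow> bool" where
  "smooth_map A F \<longleftrightarrow> (\<forall>c\<in>A. smooth_on (snd c ` fst c) (local_rep c F))"

text \<open>The \<open>i\<close>-th partial derivative on the half-space; on the boundary hyperplane,
  \<open>\<partial>\<^sub>k\<close> is one-sided.\<close>

definition partial ::
  "'n::finite \<Rightarrow> 'n \<Rightarrow> (real ^ 'n \<Rightarrow> 'b::real_normed_vector) \<Rightarrow> real ^ 'n \<Rightarrow> 'b" where
  "partial k i f x =
     vector_derivative (\<lambda>t. f (x + t *\<^sub>R axis i 1)) (at 0 within {t. x + t *\<^sub>R axis i 1 \<in> halfspace k})"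


section \<open>Space forms\<close>

text \<open>The space form of curvature \<open>\<kappa> \<in> {-1, 0, 1}\<close> and dimension \<open>DIM('v)\<close> as a hypersurface of
  \<open>\<real> \<times> 'v\<close>: the hyperboloid \<open>t\<^sup>2 - |x|\<^sup>2 = 1, t > 0\<close>, the affine hyperplane \<open>t = 1\<close>, or the
  unit sphere. Its Riemannian metric is the restriction of \<open>form \<kappa>\<close> to the tangent spaces; this
  form is the Minkowski product for \<open>\<kappa> = -1\<close> and is degenerate for \<open>\<kappa> = 0\<close>, but positive
  definite on each tangent space in all three cases.\<close>

definition form :: "real \<Rightarrow> real \<times> 'v::euclidean_space \<Rightarrow> real \<times> 'v \<Rightarrow> real" where
  "form \<kappa> p q = \<kappa> * (fst p * fst q) + snd p \<bullet> snd q"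

definition space_form :: "real \<Rightarrow> (real \<times> 'v::euclidean_space) set" where
  "space_form \<kappa> = {(t, x). t\<^sup>2 + \<kappa> * (x \<bullet> x) = 1 \<and> (\<kappa> \<le> 0 \<longrightarrow> 0 < t)}"

definition tangent_space :: "real \<Rightarrow> real \<times> 'v::euclidean_space \<Rightarrow> (real \<times> 'v) set" where
  "tangent_space \<kappa> q = {v. fst q * fst v + \<kappa> * (snd q \<bullet> snd v) = 0}"

text \<open>The geodesic distance of each model. The form \<open>\<langle>p, q\<rangle>\<close> is \<open>cos\<close> of the
  distance on the sphere and \<open>- cosh\<close> of it on the hyperboloid.\<close>

definition space_dist :: "real \<Rightarrow> real \<times> 'v::euclidean_space \<Rightarrow> real \<times> 'v \<Rightarrow> real" where
  "space_dist \<kappa> p q =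
     (if \<kappa> = 1 then arccos (form \<kappa> p q)
      else if \<kappa> = -1 then arcosh (- form \<kappa> p q)
      else dist (snd p) (snd q))"

definition geo_ball :: "real \<Rightarrow> real \<times> 'v::euclidean_space \<Rightarrow> real \<Rightarrow> (real \<times> 'v) set" where
  "geo_ball \<kappa> p\<^sub>0 r = {q \<in> space_form \<kappa>. space_dist \<kappa> p\<^sub>0 q \<le> r}"

definition geo_sphere :: "real \<Rightarrow> real \<times> 'v::euclidean_space \<Rightarrow> real \<Rightarrow> (real \<times> 'v) set" where
  "geo_sphere \<kappa> p\<^sub>0 r = top_of_set (space_form \<kappa>) frontier_of geo_ball \<kappa> p\<^sub>0 r"

text \<open>\<open>X\<close> is the Riemannian gradient at \<open>q\<close> of the function \<open>h\<close> on the space form.\<close>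

definition is_gradient ::
  "real \<Rightarrow> (real \<times> 'v::euclidean_space \<Rightarrow> real) \<Rightarrow> real \<times> 'v \<Rightarrow> real \<times> 'v \<Rightarrow> bool" where
  "is_gradient \<kappa> h q X \<longleftrightarrow> X \<in> tangent_space \<kappa> q \<and>
     (\<forall>\<gamma> v. (\<forall>t. \<gamma> t \<in> space_form \<kappa>) \<and> \<gamma> 0 = q \<and> (\<gamma> has_vector_derivative v) (at 0) \<longrightarrow>
        ((\<lambda>t. h (\<gamma> t)) has_real_derivative form \<kappa> X v) (at 0))"


section \<open>Immersed hypersurfaces\<close>

text \<open>Below, \<open>F\<close> maps the manifold with atlas \<open>A\<close> into the space form of curvature \<open>\<kappa>\<close>.\<close>

definition coord_vec ::
  "'n::finite \<Rightarrow> ('m, 'n) chart \<Rightarrow> ('m \<Rightarrow> 'b::real_normed_vector) \<Rightarrow> real ^ 'n \<Rightarrow> 'n \<Rightarrow> 'b" where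
  "coord_vec k c F x i = partial k i (local_rep c F) x"

definition immersion ::
  "'n::finite \<Rightarrow> ('m, 'n) chart set \<Rightarrow> ('m \<Rightarrow> 'b::real_normed_vector) \<Rightarrow> bool" where
  "immersion k A F \<longleftrightarrow> smooth_map A F \<and>
     (\<forall>c\<in>A. \<forall>x\<in>snd c ` fst c. inj (\<lambda>v::real ^ 'n. \<Sum>i\<in>UNIV. v $ i *\<^sub>R coord_vec k c F x i))"

definition gram ::
  "real \<Rightarrow> 'n::finite \<Rightarrow> ('m, 'n) chart \<Rightarrow> ('m \<Rightarrow> real \<times> 'v::euclidean_space) \<Rightarrow> real ^ 'n \<Rightarrow> real ^ 'n ^ 'n" where
  "gram \<kappa> k c F x = (\<chi> i j. form \<kappa> (coord_vec k c F x i) (coord_vec k c F x j))"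

definition unit_normal ::
  "real \<Rightarrow> 'n::finite \<Rightarrow> ('m, 'n) chart set \<Rightarrow> ('m \<Rightarrow> real \<times> 'v::euclidean_space) \<Rightarrow> 'm \<Rightarrow> real \<times> 'v \<Rightarrow> bool" where
  "unit_normal \<kappa> k A F p \<nu> \<longleftrightarrow> \<nu> \<in> tangent_space \<kappa> (F p) \<and> form \<kappa> \<nu> \<nu> = 1 \<and>
     (\<forall>c\<in>A. p \<in> fst c \<longrightarrow> (\<forall>i. form \<kappa> \<nu> (coord_vec k c F (snd c p) i) = 0))"

definition two_sided ::
  "real \<Rightarrow> 'n::finite \<Rightarrow> 'm::topological_space set \<Rightarrow> ('m, 'n) chart set \<Rightarrow>
    ('m \<Rightarrow> real \<times> 'v::euclidean_space) \<Rightarrow> bool" where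
  "two_sided \<kappa> k M A F \<longleftrightarrow> (\<exists>N. continuous_on M N \<and> (\<forall>p\<in>M. unit_normal \<kappa> k A F p (N p)))"

text \<open>The Levi-Civita connection of the space form is the tangential part of the flat connection
  of \<open>\<real> \<times> 'v\<close>, so that for \<open>\<nu>\<close> normal to \<open>F\<close> and tangent to the space form, the
  second fundamental form is \<open>h\<^sub>i\<^sub>j = \<langle>\<partial>\<^sub>i \<partial>\<^sub>j F, \<nu>\<rangle>\<close>.\<close>

definition second_ff ::
  "real \<Rightarrow> 'n::finite \<Rightarrow> ('m, 'n) chart \<Rightarrow> ('m \<Rightarrow> real \<times> 'v::euclidean_space) \<Rightarrow>
    real ^ 'n \<Rightarrow> real \<times> 'v \<Rightarrow> real ^ 'n ^ 'n" where
  "second_ff \<kappa> k c F x \<nu> = (\<chi> i j. form \<kappa> (partial k i (partial k j (local_rep c F)) x) \<nu>)"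

definition mean_curvature ::
  "real \<Rightarrow> 'n::finite \<Rightarrow> ('m, 'n) chart \<Rightarrow> ('m \<Rightarrow> real \<times> 'v::euclidean_space) \<Rightarrow>
    real ^ 'n \<Rightarrow> real \<times> 'v \<Rightarrow> real" where
  "mean_curvature \<kappa> k c F x \<nu> = trace (matrix_inv (gram \<kappa> k c F x) ** second_ff \<kappa> k c F x \<nu>)"

definition minimal ::
  "real \<Rightarrow> 'n::finite \<Rightarrow> ('m, 'n) chart set \<Rightarrow> ('m \<Rightarrow> real \<times> 'v::euclidean_space) \<Rightarrow> bool" where
  "minimal \<kappa> k A F \<longleftrightarrow>
     (\<forall>c\<in>A. \<forall>p\<in>fst c. \<forall>\<nu>. unit_normal \<kappa> k A F p \<nu> \<longrightarrow> mean_curvature \<kappa> k c F (snd c p) \<nu> = 0)"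

text \<open>\<open>\<eta>\<close> is (the image under \<open>dF\<close> of) the outward unit conormal of the boundary at \<open>p\<close>. Interior
  points have positive \<open>k\<close>-th coordinate, hence outward vectors have negative \<open>k\<close>-th component.\<close>

definition outward_conormal ::
  "real \<Rightarrow> 'n::finite \<Rightarrow> ('m, 'n) chart set \<Rightarrow> ('m \<Rightarrow> real \<times> 'v::euclidean_space) \<Rightarrow> 'm \<Rightarrow> real \<times> 'v \<Rightarrow> bool" where
  "outward_conormal \<kappa> k A F p \<eta> \<longleftrightarrow> form \<kappa> \<eta> \<eta> = 1 \<and>
     (\<forall>c\<in>A. p \<in> fst c \<longrightarrow>
        (\<exists>v::real ^ 'n. v $ k < 0 \<and> \<eta> = (\<Sum>i\<in>UNIV. v $ i *\<^sub>R coord_vec k c F (snd c p) i)) \<and>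
        (\<forall>i. i \<noteq> k \<longrightarrow> form \<kappa> \<eta> (coord_vec k c F (snd c p) i) = 0))"

definition free_boundary_minimal_immersion ::
  "real \<Rightarrow> 'n::finite \<Rightarrow> 'm::t2_space set \<Rightarrow> ('m, 'n) chart set \<Rightarrow> real \<times> 'v::euclidean_space \<Rightarrow> real \<Rightarrow>
    ('m \<Rightarrow> real \<times> 'v) \<Rightarrow> bool" where
  "free_boundary_minimal_immersion \<kappa> k M A p\<^sub>0 r F \<longleftrightarrow>
     compact_manifold k M A \<and> boundary k A \<noteq> {} \<and>
     F ` M \<subseteq> geo_ball \<kappa> p\<^sub>0 r \<and>
     immersion k A F \<and> two_sided \<kappa> k M A F \<and> minimal \<kappa> k A F \<and>
     F ` boundary k A \<subseteq> geo_sphere \<kappa> p\<^sub>0 r \<and>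
     (\<forall>p\<in>boundary k A. \<exists>\<eta>. outward_conormal \<kappa> k A F p \<eta> \<and> is_gradient \<kappa> (space_dist \<kappa> p\<^sub>0) (F p) \<eta>)"

text \<open>Smoothness of \<open>\<Phi>\<close> is joint smoothness on \<open>I \<times> M\<close>, in the product charts.\<close>

definition variable_radius_family ::
  "real \<Rightarrow> 'n::finite \<Rightarrow> 'm::t2_space set \<Rightarrow> ('m, 'n) chart set \<Rightarrow> real \<times> 'v::euclidean_space \<Rightarrow>
    real set \<Rightarrow> (real \<Rightarrow> real) \<Rightarrow> (real \<Rightarrow> 'm \<Rightarrow> real \<times> 'v) \<Rightarrow> bool" where
  "variable_radius_family \<kappa> k M A p\<^sub>0 I r \<Phi> \<longleftrightarrow>
     is_interval I \<and> compact_manifold k M A \<and>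
     (\<forall>C\<in>components M. C \<inter> boundary k A \<noteq> {}) \<and>
     smooth_on I r \<and> (\<forall>a\<in>I. 0 < r a \<and> (\<kappa> = 1 \<longrightarrow> r a < pi)) \<and>
     (\<forall>c\<in>A. smooth_on (I \<times> snd c ` fst c) (\<lambda>(a, x). local_rep c (\<Phi> a) x)) \<and>
     (\<forall>a\<in>I. free_boundary_minimal_immersion \<kappa> k M A p\<^sub>0 (r a) (\<Phi> a))"


section \<open>Induced volumes\<close>

text \<open>The Riemannian measure of the induced metric \<open>g\<close> is the Borel measure on \<open>M\<close> that has
  density \<open>sqrt (det g)\<close> with respect to Lebesgue measure in every chart.\<close>

definition volume_measure ::
  "real \<Rightarrow> 'n::finite \<Rightarrow> 'm::t2_space set \<Rightarrow> ('m, 'n) chart set \<Rightarrow> ('m \<Rightarrow> real \<times> 'v::euclidean_space) \<Rightarrow>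
    'm measure" where
  "volume_measure \<kappa> k M A F = (THE \<mu>. sets \<mu> = sets (restrict_space borel M) \<and>
     (\<forall>c\<in>A. \<forall>B\<in>sets \<mu>. B \<subseteq> fst c \<longrightarrow>
        emeasure \<mu> B = (\<integral>\<^sup>+x\<in>snd c ` B. ennreal (sqrt (det (gram \<kappa> k c F x))) \<partial>lborel)))"

text \<open>Lebesgue measure of dimension \<open>CARD('n) - 1\<close> on the hyperplane \<open>{x. x $ k = 0}\<close>. If
  \<open>CARD('n) = 1\<close>, the product is empty and this is the unit point mass at \<open>0\<close>, so that the
  boundary volume below is the number of boundary points.\<close>

definition hyperplane_lborel :: "'n::finite \<Rightarrow> (real ^ 'n) measure" where
  "hyperplane_lborel k =
     distr (\<Pi>\<^sub>M i\<in>UNIV - {k}. lborel) borel (\<lambda>f. \<chi> i. if i = k then 0 else f i)"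

text \<open>Row and column \<open>k\<close> are replaced by those of the identity matrix: the determinant is that of
  the Gram matrix of the coordinate vectors tangent to the boundary.\<close>

definition boundary_gram ::
  "real \<Rightarrow> 'n::finite \<Rightarrow> ('m, 'n) chart \<Rightarrow> ('m \<Rightarrow> real \<times> 'v::euclidean_space) \<Rightarrow> real ^ 'n \<Rightarrow> real ^ 'n ^ 'n" where
  "boundary_gram \<kappa> k c F x =
     (\<chi> i j. if i = k \<or> j = k then (if i = j then 1 else 0) else gram \<kappa> k c F x $ i $ j)"

definition boundary_volume_measure ::
  "real \<Rightarrow> 'n::finite \<Rightarrow> ('m::t2_space, 'n) chart set \<Rightarrow> ('m \<Rightarrow> real \<times> 'v::euclidean_space) \<Rightarrow> 'm measure" where
  "boundary_volume_measure \<kappa> k A F = (THE \<mu>. sets \<mu> = sets (restrict_space borel (boundary k A)) \<and>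
     (\<forall>c\<in>A. \<forall>B\<in>sets \<mu>. B \<subseteq> fst c \<longrightarrow>
        emeasure \<mu> B =
          (\<integral>\<^sup>+x\<in>snd c ` B. ennreal (sqrt (det (boundary_gram \<kappa> k c F x))) \<partial>hyperplane_lborel k)))"

definition induced_volume ::
  "real \<Rightarrow> 'n::finite \<Rightarrow> 'm::t2_space set \<Rightarrow> ('m, 'n) chart set \<Rightarrow> ('m \<Rightarrow> real \<times> 'v::euclidean_space) \<Rightarrow> real" where
  "induced_volume \<kappa> k M A F = measure (volume_measure \<kappa> k M A F) M"

definition induced_boundary_volume ::
  "real \<Rightarrow> 'n::finite \<Rightarrow> ('m::t2_space, 'n) chart set \<Rightarrow> ('m \<Rightarrow> real \<times> 'v::euclidean_space) \<Rightarrow> real" where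
  "induced_boundary_volume \<kappa> k A F = measure (boundary_volume_measure \<kappa> k A F) (boundary k A)"

definition critical_points :: "real set \<Rightarrow> (real \<Rightarrow> real) \<Rightarrow> real set" where
  "critical_points I f = {a\<in>I. (f has_real_derivative 0) (at a within I)}"

end

theory Submission
  imports Defs
begin

text \<open>In a chart, let \<open>g\<close> be the Gram matrix of the coordinate vectors, \<open>V\<close> the velocity of the family and \<open>X\<close> its
  tangential part. Since the mean curvature vanishes, the normal part of \<open>V\<close> does not contribute to the rate of
  change of the area density \<open>sqrt (det g)\<close>, which is therefore the divergence of \<open>sqrt (det g) X\<close>.
  A partition of unity and the divergence theorem on the half-space turn its integral into the flux through the
  boundary, with density \<open>\<langle>V, \<eta>\<rangle>\<close> with respect to the boundary volume. By the free boundary condition, \<open>\<eta>\<close> is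
  the gradient of the distance \<open>\<rho>\<close> from \<open>p\<^sub>0\<close>, and differentiating \<open>\<rho> (\<Phi> a q) = r a\<close> along the boundary
  gives \<open>\<langle>V, \<eta>\<rangle> = r' a\<close>.\<close>

section \<open>Determinants and inverse matrices\<close>

text \<open>Both volume measures are definite descriptions, so no volume can be computed before
  existence and uniqueness are known. The change of variables in the half-space and on its boundary
  hyperplane makes the chart densities compatible, and a partition of unity glues them. The same
  partition writes each volume as a finite sum of weighted chart integrals, which are differentiated
  in the parameter under the integral sign. The weights do not depend on the parameter and are
  differentiated in space only once, in the integration by parts, so C1 weights suffice; the terms
  with their derivatives cancel in the sum. In a chart, the tangential part of the velocity is found
  by inverting the Gram matrix rather than by subtracting a normal component: the unit normal is
  only known to be continuous, while the coefficients obtained in this way are C1 up to the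
  boundary. Derivatives are taken within the half-space, since charts do not extend beyond
  it.\<close>

lemma continuous_on_det:
  fixes A :: "'a::topological_space \<Rightarrow> real^'n^'n"
  assumes "\<And>i j. continuous_on S (\<lambda>x. A x $ i $ j)"
  shows "continuous_on S (\<lambda>x. det (A x))"
  unfolding det_def by (intro continuous_intros assms)

lemma matrix_inv_mult:
  fixes A :: "real^'n^'n"
  assumes "det A \<noteq> 0"
  shows "A ** matrix_inv A = mat 1" "matrix_inv A ** A = mat 1"
proof -
  have "\<exists>A'. A ** A' = mat 1 \<and> A' ** A = mat 1"
    using assms invertible_det_nz[of A] unfolding invertible_def by simp
  from someI_ex[OF this] show "A ** matrix_inv A = mat 1" "matrix_inv A ** A = mat 1"
    unfolding matrix_inv_def by auto
qed

text \<open>All matrices on the segment from the identity to \<open>A\<close> are positive definite,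
  hence injective. The determinant therefore has no zero on the segment and keeps the sign it has at
  the identity.\<close>

lemma det_pos_of_pos_def:
  fixes A :: "real^'n^'n"
  assumes A: "\<And>v. v \<noteq> 0 \<Longrightarrow> 0 < v \<bullet> (A *v v)"
  shows "0 < det A"
proof (rule ccontr)
  let ?B = "\<lambda>t::real. (1 - t) *\<^sub>R mat 1 + t *\<^sub>R A"
  assume neg: "\<not> 0 < det A"
  have "continuous_on {0..1} (\<lambda>t. det (?B t))"
    by (intro continuous_on_det) (auto intro!: continuous_intros)
  then obtain t where t: "0 \<le> t" "t \<le> 1" "det (?B t) = 0"
    using IVT2'[of "\<lambda>t. det (?B t)" 1 0 0] neg by auto
  then obtain v where v: "v \<noteq> 0" "?B t *v v = 0"
    using invertible_det_nz[of "?B t"] invertible_left_inverse[of "?B t"]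
      matrix_left_invertible_ker[of "?B t"] by auto
  have "0 = v \<bullet> (?B t *v v)"
    using v by simp
  also have "\<dots> = (1 - t) * (v \<bullet> v) + t * (v \<bullet> (A *v v))"
    by (simp add: matrix_vector_mult_add_rdistrib scaleR_matrix_vector_assoc[symmetric] inner_add_right)
  also have "\<dots> > 0"
  proof (cases "t = 0")
    case False
    then have "0 < t * (v \<bullet> (A *v v))"
      using A[OF v(1)] t by simp
    then show ?thesis using t by (simp add: add_nonneg_pos)
  qed (use v in simp)
  finally show False by simp
qed

text \<open>In the derivative of the Leibniz formula at the identity only the identity permutation
  survives: any other permutation moves at least two points, so after one factor has been
  differentiated, an off-diagonal entry of the identity matrix is left in the product.\<close>

lemma has_derivative_det_mat_1:
  fixes B :: "'a::real_normed_vector \<Rightarrow> real^'n^'n"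
  assumes B: "\<And>i j. ((\<lambda>y. B y $ i $ j) has_derivative (\<lambda>h. B' h $ i $ j)) (at x within S)"
    and 1: "B x = mat 1"
  shows "((\<lambda>y. det (B y)) has_derivative (\<lambda>h. trace (B' h))) (at x within S)"
proof -
  have "((\<lambda>y. det (B y)) has_derivative (\<lambda>h. \<Sum>p | p permutes UNIV.
      of_int (sign p) * (\<Sum>i\<in>UNIV. B' h $ i $ p i * (\<Prod>j\<in>UNIV - {i}. B x $ j $ p j)))) (at x within S)"
    unfolding det_def
    by (intro has_derivative_sum has_derivative_mult_right has_derivative_prod B)
  moreover have "(\<Sum>p | p permutes UNIV. of_int (sign p) *
      (\<Sum>i\<in>UNIV. B' h $ i $ p i * (\<Prod>j\<in>UNIV - {i}. B x $ j $ p j))) = trace (B' h)" for h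
  proof -
    have *: "(\<Prod>j\<in>UNIV - {i}. B x $ j $ p j) = 0" if p: "p permutes UNIV" "p \<noteq> id" for p and i :: 'n
    proof -
      have "\<exists>j\<in>UNIV - {i}. p j \<noteq> j"
      proof (rule ccontr)
        assume "\<not> ?thesis"
        then have j: "p j = j" if "j \<noteq> i" for j using that by (metis DiffI UNIV_I singletonD)
        then have "p i = i"
          using permutes_inj[OF p(1)] by (metis injD)
        with j have "p = id" by (metis eq_id_iff)
        with p show False by simp
      qed
      then obtain j where "j \<in> UNIV - {i}" "j \<noteq> p j" by metis
      then show ?thesis
        unfolding 1 by (intro prod_zero) (auto simp: mat_def intro!: bexI[of _ j])
    qed
    have "(\<Sum>p | p permutes UNIV. of_int (sign p) *
        (\<Sum>i\<in>UNIV. B' h $ i $ p i * (\<Prod>j\<in>UNIV - {i}. B x $ j $ p j))) =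
      (\<Sum>p\<in>{id}. of_int (sign p) *
        (\<Sum>i\<in>UNIV. B' h $ i $ p i * (\<Prod>j\<in>UNIV - {i}. B x $ j $ p j)))"
      by (rule sum.mono_neutral_right) (auto simp: permutes_id * simp del: prod_zero_iff)
    also have "\<dots> = trace (B' h)"
      unfolding 1 by (simp add: mat_def trace_def)
    finally show ?thesis .
  qed
  ultimately show ?thesis by simp
qed

text \<open>Jacobi's formula. Multiplication by the constant matrix \<open>matrix_inv (A x)\<close>
  moves the base point to the identity.\<close>

lemma has_derivative_det:
  fixes A :: "'a::real_normed_vector \<Rightarrow> real^'n^'n"
  assumes A: "\<And>i j. ((\<lambda>y. A y $ i $ j) has_derivative (\<lambda>h. A' h $ i $ j)) (at x within S)"
    and nz: "det (A x) \<noteq> 0"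
  shows "((\<lambda>y. det (A y)) has_derivative (\<lambda>h. det (A x) * trace (matrix_inv (A x) ** A' h))) (at x within S)"
proof -
  let ?I = "matrix_inv (A x)"
  have "((\<lambda>y. det (?I ** A y)) has_derivative (\<lambda>h. trace (?I ** A' h))) (at x within S)"
    by (rule has_derivative_det_mat_1)
      (auto simp: matrix_matrix_mult_def matrix_inv_mult(2)[OF nz, unfolded matrix_matrix_mult_def]
        intro!: has_derivative_sum has_derivative_mult_right A)
  then have "((\<lambda>y. det (A x) * det (?I ** A y)) has_derivative (\<lambda>h. det (A x) * trace (?I ** A' h)))
      (at x within S)"
    by (rule has_derivative_mult_right)
  moreover have "det (A x) * det (?I ** A y) = det (A y)" for y
    by (simp add: det_mul[symmetric] matrix_mul_assoc matrix_inv_mult[OF nz])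
  ultimately show ?thesis by simp
qed

text \<open>Encodes the principal minor without a smaller index type: the determinant of this matrix
  is that of the block without row and column \<open>k\<close>.\<close>

definition delete_rc :: "'n::finite \<Rightarrow> real^'n^'n \<Rightarrow> real^'n^'n" where
  "delete_rc k A = (\<chi> i j. if i = k \<or> j = k then (if i = j then 1 else 0) else A $ i $ j)"

text \<open>Cramer's rule for column \<open>k\<close> of the inverse. It later determines the
  \<open>k\<close>-th coordinate of the outward conormal.\<close>

lemma matrix_inv_diag:
  fixes A :: "real^'n^'n"
  assumes nz: "det A \<noteq> 0"
  shows "matrix_inv A $ k $ k = det (delete_rc k A) / det A"
proof -
  let ?x = "matrix_inv A *v axis k 1"
  have "A *v ?x = axis k 1"
    by (simp add: matrix_vector_mul_assoc matrix_inv_mult[OF nz])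
  then have "?x $ k * det A = det (\<chi> i j. if j = k then axis k 1 $ i else A $ i $ j)"
    using cramer_lemma[of k A ?x] by (simp only:)
  \<comment> \<open>The two matrices have the same column \<open>k\<close> and differ only in row
    \<open>k\<close>. A permutation fixing \<open>k\<close> meets only common entries, and any other
    one picks a zero from column \<open>k\<close> on both sides.\<close>
  also have "\<dots> = det (delete_rc k A)"
    unfolding det_def
  proof (intro sum.cong refl arg_cong2[where f="(*)"])
    fix p :: "'n \<Rightarrow> 'n" assume "p \<in> {p. p permutes UNIV}"
    then have p: "p permutes UNIV" by simp
    show "(\<Prod>i\<in>UNIV. (\<chi> i j. if j = k then axis k 1 $ i else A $ i $ j) $ i $ p i) =
      (\<Prod>i\<in>UNIV. delete_rc k A $ i $ p i)"
    proof (cases "p k = k")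
      case True
      then have "p i \<noteq> k" if "i \<noteq> k" for i
        using that permutes_inj[OF p] by (metis injD)
      then show ?thesis
        using True by (intro prod.cong) (auto simp: delete_rc_def axis_def)
    next
      case False
      obtain i where i: "p i = k" using permutes_surj[OF p] by (metis surjD)
      with False have "i \<noteq> k" by auto
      with i have "(\<Prod>i\<in>UNIV. (\<chi> i j. if j = k then axis k 1 $ i else A $ i $ j) $ i $ p i) = 0"
        "(\<Prod>i\<in>UNIV. delete_rc k A $ i $ p i) = 0"
        by (auto intro!: prod_zero bexI[of _ i] simp: delete_rc_def axis_def)
      then show ?thesis by metis
    qed
  qed
  also have "?x $ k = matrix_inv A $ k $ k"
    by (simp add: matrix_vector_mul_component inner_axis)
  finally show ?thesis using nz by (simp add: field_simps)
qed

text \<open>Determinants do not depend on the names of the indices. This carries Jacobian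
  determinants over to the well-ordered index type used for the change of variables.\<close>

lemma det_reindex:
  fixes A :: "real^'n^'n" and e :: "'m::finite \<Rightarrow> 'n::finite"
  assumes e: "bij e"
  shows "det (\<chi> i j. A $ e i $ e j) = det A"
proof -
  let ?c = "\<lambda>p x. e (p (inv e x))"
  \<comment> \<open>Conjugation with a bijection maps permutations of one index type to permutations
    of the other and preserves signs.\<close>
  have conj: "(\<lambda>x. f (p (inv f x))) permutes UNIV" "sign (\<lambda>x. f (p (inv f x))) = sign p"
    if "bij f" "p permutes UNIV" for f :: "'c::finite \<Rightarrow> 'd::finite" and p
  proof -
    interpret permutes_bij_finite p UNIV UNIV f "inv f" "\<lambda>x. if x \<in> UNIV then f (p (inv f x)) else x"
      by unfold_locales (use that in \<open>auto simp: bij_def\<close>)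
    show "(\<lambda>x. f (p (inv f x))) permutes UNIV" "sign (\<lambda>x. f (p (inv f x))) = sign p"
      using permutes_p' sign_p' by simp_all
  qed
  have bij: "bij_betw ?c {p. p permutes UNIV} {p. p permutes UNIV}"
  proof (rule bij_betwI)
    show "?c \<in> {p. p permutes UNIV} \<rightarrow> {p. p permutes UNIV}"
      by (intro funcsetI CollectI conj(1)[OF e]) simp
    show "(\<lambda>q x. inv e (q (e x))) \<in> {p. p permutes UNIV} \<rightarrow> {p. p permutes UNIV}"
      by (intro funcsetI CollectI conj(1)[OF bij_imp_bij_inv[OF e], unfolded inv_inv_eq[OF e]]) simp
  qed (simp_all add: bij_is_inj[OF e] surj_f_inv_f[OF bij_is_surj[OF e]])
  have sign: "sign (?c p) = sign p" if "p permutes UNIV" for p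
    using conj(2)[OF e that] .
  have "det A = (\<Sum>p | p permutes UNIV. of_int (sign (?c p)) * (\<Prod>i\<in>UNIV. A $ i $ ?c p i))"
    unfolding det_def by (rule sum.reindex_bij_betw[OF bij, symmetric])
  also have "\<dots> = (\<Sum>p | p permutes UNIV. of_int (sign p) * (\<Prod>i\<in>UNIV. A $ e i $ e (p i)))"
  proof (intro sum.cong refl arg_cong2[where f="(*)"])
    fix p
    show "(\<Prod>i\<in>UNIV. A $ i $ ?c p i) = (\<Prod>i\<in>UNIV. A $ e i $ e (p i))"
      using prod.reindex_bij_betw[OF e, of "\<lambda>i. A $ i $ ?c p i"] e
      by (simp add: inv_f_f bij_is_inj)
  qed (use sign in auto)
  finally show ?thesis by (simp add: det_def)
qed

section \<open>Differentiable functions on the half-space\<close>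

lemma mixed_difference_mean_value:
  fixes f :: "'a::real_normed_vector \<Rightarrow> real"
  assumes h: "0 < h"
    and mem: "\<And>s t. 0 \<le> s \<Longrightarrow> s \<le> h \<Longrightarrow> 0 \<le> t \<Longrightarrow> t \<le> h \<Longrightarrow> z + s *\<^sub>R v + t *\<^sub>R w \<in> U"
    and D: "\<And>y. y \<in> U \<Longrightarrow> (f has_derivative D y) (at y)"
    and Dv: "\<And>y. y \<in> U \<Longrightarrow> ((\<lambda>y. D y v) has_derivative Dv y) (at y)"
  obtains s t where "0 < s" "s < h" "0 < t" "t < h"
    "f (z + h *\<^sub>R v + h *\<^sub>R w) - f (z + h *\<^sub>R v) - f (z + h *\<^sub>R w) + f z
      = h * h * Dv (z + s *\<^sub>R v + t *\<^sub>R w) w"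
proof -
  \<comment> \<open>The increment in direction \<open>w\<close> as a function of the step in
    direction \<open>v\<close>. The mean value theorem is applied to it in \<open>s\<close>, and
    then in \<open>t\<close> to the derivative obtained.\<close>
  let ?\<phi> = "\<lambda>s. f (z + s *\<^sub>R v + h *\<^sub>R w) - f (z + s *\<^sub>R v)"
  have "(?\<phi> has_real_derivative (D (z + s *\<^sub>R v + h *\<^sub>R w) v - D (z + s *\<^sub>R v) v)) (at s)"
    if s: "0 \<le> s" "s \<le> h" for s
  proof -
    have 1: "((\<lambda>s. f (z + s *\<^sub>R v + t *\<^sub>R w)) has_real_derivative D (z + s *\<^sub>R v + t *\<^sub>R w) v) (at s)"
      if t: "0 \<le> t" "t \<le> h" for t
    proof -
      have d: "(f has_derivative D (z + s *\<^sub>R v + t *\<^sub>R w)) (at (z + s *\<^sub>R v + t *\<^sub>R w))"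
        using D mem s t by auto
      then interpret bounded_linear "D (z + s *\<^sub>R v + t *\<^sub>R w)" by (rule has_derivative_bounded_linear)
      have "((\<lambda>s. f (z + s *\<^sub>R v + t *\<^sub>R w)) has_derivative
          (\<lambda>r. D (z + s *\<^sub>R v + t *\<^sub>R w) (r *\<^sub>R v))) (at s)"
        by (rule has_derivative_compose[where g = f and f = "\<lambda>s. z + s *\<^sub>R v + t *\<^sub>R w", OF _ d]) (auto intro!: derivative_eq_intros)
      then show ?thesis by (simp add: has_field_derivative_def scaleR mult_commute_abs)
    qed
    show ?thesis
      using DERIV_diff[OF 1[of h] 1[of 0]] h by simp
  qed
  from MVT2[OF h this] obtain s where s: "0 < s" "s < h"
    and 1: "?\<phi> h - ?\<phi> 0 = h * (D (z + s *\<^sub>R v + h *\<^sub>R w) v - D (z + s *\<^sub>R v) v)"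
    by auto
  let ?\<psi> = "\<lambda>t. D (z + s *\<^sub>R v + t *\<^sub>R w) v"
  have "(?\<psi> has_real_derivative Dv (z + s *\<^sub>R v + t *\<^sub>R w) w) (at t)"
    if t: "0 \<le> t" "t \<le> h" for t
  proof -
    have d: "((\<lambda>y. D y v) has_derivative Dv (z + s *\<^sub>R v + t *\<^sub>R w)) (at (z + s *\<^sub>R v + t *\<^sub>R w))"
      using Dv mem s t by auto
    then interpret bounded_linear "Dv (z + s *\<^sub>R v + t *\<^sub>R w)" by (rule has_derivative_bounded_linear)
    have "(?\<psi> has_derivative (\<lambda>r. Dv (z + s *\<^sub>R v + t *\<^sub>R w) (r *\<^sub>R w))) (at t)"
      by (rule has_derivative_compose[where g = "\<lambda>y. D y v" and f = "\<lambda>t. z + s *\<^sub>R v + t *\<^sub>R w", OF _ d]) (auto intro!: derivative_eq_intros)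
    then show ?thesis by (simp add: has_field_derivative_def scaleR mult_commute_abs)
  qed
  from MVT2[OF h this] obtain t where t: "0 < t" "t < h"
    and 2: "?\<psi> h - ?\<psi> 0 = h * Dv (z + s *\<^sub>R v + t *\<^sub>R w) w"
    by auto
  show thesis
    by (rule that[OF s t]) (use 1 2 in \<open>simp add: algebra_simps\<close>)
qed

text \<open>The mixed second difference is symmetric in \<open>v\<close> and \<open>w\<close>.
  Evaluating it in both orders gives values of the two mixed derivatives at points arbitrarily close
  to \<open>z\<close>, and continuity takes them to \<open>z\<close>.\<close>

lemma second_derivative_symmetric_real:
  fixes f :: "'a::real_normed_vector \<Rightarrow> real"
  assumes U: "open U" "z \<in> U"
    and D: "\<And>y. y \<in> U \<Longrightarrow> (f has_derivative D y) (at y)"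
    and Dv: "\<And>y. y \<in> U \<Longrightarrow> ((\<lambda>y. D y v) has_derivative Dv y) (at y)"
    and Dw: "\<And>y. y \<in> U \<Longrightarrow> ((\<lambda>y. D y w) has_derivative Dw y) (at y)"
    and cont: "continuous_on U (\<lambda>y. Dv y w)" "continuous_on U (\<lambda>y. Dw y v)"
  shows "Dv z w = Dw z v"
proof -
  have "\<bar>Dv z w - Dw z v\<bar> \<le> e" if e: "0 < e" for e
  proof -
    have "isCont (\<lambda>y. Dv y w) z" "isCont (\<lambda>y. Dw y v) z"
      using cont U by (auto simp: continuous_on_eq_continuous_at)
    then obtain d1 d2 where d: "0 < d1" "0 < d2"
      "\<And>y. dist y z < d1 \<Longrightarrow> dist (Dv y w) (Dv z w) < e / 2"
      "\<And>y. dist y z < d2 \<Longrightarrow> dist (Dw y v) (Dw z v) < e / 2"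
      using e unfolding continuous_at_eps_delta by (metis half_gt_zero)
    obtain d3 where d3: "0 < d3" "ball z d3 \<subseteq> U" using U openE by blast
    define d where "d = min d1 (min d2 d3)"
    have "0 < d" using d d3 by (simp add: d_def)
    \<comment> \<open>The factor 2 keeps the whole parallelogram strictly within distance
      \<open>d\<close> of \<open>z\<close>; the summand 1 makes \<open>l\<close> positive even if
      both vectors vanish.\<close>
    define l where "l = 1 + norm v + norm w"
    define h where "h = d / (2 * l)"
    have pos: "0 < l" by (simp add: l_def add_pos_nonneg)
    then have h: "0 < h" using \<open>0 < d\<close> by (simp add: h_def)
    have "h * (norm v + norm w) < d"
    proof -
      have "h * (norm v + norm w) \<le> h * l" using h by (simp add: l_def algebra_simps)
      also have "\<dots> = d / 2" using pos by (simp add: h_def)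
      finally show ?thesis using \<open>0 < d\<close> by simp
    qed
    then have mem: "dist (z + s *\<^sub>R v + t *\<^sub>R w) z < d" if "0 \<le> s" "s \<le> h" "0 \<le> t" "t \<le> h" for s t
    proof -
      have "norm (s *\<^sub>R v + t *\<^sub>R w) \<le> s * norm v + t * norm w"
        using norm_triangle_ineq[of "s *\<^sub>R v" "t *\<^sub>R w"] that by simp
      also have "\<dots> \<le> h * norm v + h * norm w"
        using that by (intro add_mono mult_right_mono) auto
      finally show ?thesis
        using \<open>h * (norm v + norm w) < d\<close> by (simp add: dist_norm algebra_simps)
    qed
    then have U: "z + s *\<^sub>R v + t *\<^sub>R w \<in> U" "z + t *\<^sub>R w + s *\<^sub>R v \<in> U"
      if "0 \<le> s" "s \<le> h" "0 \<le> t" "t \<le> h" for s t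
      using that d3 by (force simp: d_def dist_commute add_ac subset_iff)+
    obtain s t where st: "0 < s" "s < h" "0 < t" "t < h"
      "f (z + h *\<^sub>R v + h *\<^sub>R w) - f (z + h *\<^sub>R v) - f (z + h *\<^sub>R w) + f z
        = h * h * Dv (z + s *\<^sub>R v + t *\<^sub>R w) w"
      using mixed_difference_mean_value[OF h U(1) D Dv] by blast
    obtain s' t' where st': "0 < s'" "s' < h" "0 < t'" "t' < h"
      "f (z + h *\<^sub>R w + h *\<^sub>R v) - f (z + h *\<^sub>R w) - f (z + h *\<^sub>R v) + f z
        = h * h * Dw (z + s' *\<^sub>R w + t' *\<^sub>R v) v"
      using mixed_difference_mean_value[OF h U(2) D Dw] by blast
    have "h * h * Dv (z + s *\<^sub>R v + t *\<^sub>R w) w = h * h * Dw (z + s' *\<^sub>R w + t' *\<^sub>R v) v"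
      using st(5) st'(5) by (simp add: add_ac diff_diff_eq)
    then have eq: "Dv (z + s *\<^sub>R v + t *\<^sub>R w) w = Dw (z + t' *\<^sub>R v + s' *\<^sub>R w) v"
      using h by (simp add: add_ac)
    have "dist (Dv (z + s *\<^sub>R v + t *\<^sub>R w) w) (Dv z w) < e / 2"
      using d(3) mem[of s t] st by (simp add: d_def)
    moreover have "dist (Dw (z + t' *\<^sub>R v + s' *\<^sub>R w) v) (Dw z v) < e / 2"
      using d(4) mem[of t' s'] st' by (simp add: d_def)
    ultimately show ?thesis unfolding eq dist_real_def by linarith
  qed
  from field_le_epsilon[of "\<bar>Dv z w - Dw z v\<bar>" 0] this show ?thesis by simp
qed

lemma second_derivative_symmetric:
  fixes f :: "'a::real_normed_vector \<Rightarrow> 'b::euclidean_space"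
  assumes U: "open U" "z \<in> U"
    and D: "\<And>y. y \<in> U \<Longrightarrow> (f has_derivative D y) (at y)"
    and Dv: "\<And>y. y \<in> U \<Longrightarrow> ((\<lambda>y. D y v) has_derivative Dv y) (at y)"
    and Dw: "\<And>y. y \<in> U \<Longrightarrow> ((\<lambda>y. D y w) has_derivative Dw y) (at y)"
    and cont: "continuous_on U (\<lambda>y. Dv y w)" "continuous_on U (\<lambda>y. Dw y v)"
  shows "Dv z w = Dw z v"
proof (rule euclidean_eqI)
  fix b :: 'b assume "b \<in> Basis"
  show "Dv z w \<bullet> b = Dw z v \<bullet> b"
  proof (rule second_derivative_symmetric_real[OF U])
    show "((\<lambda>y. f y \<bullet> b) has_derivative (\<lambda>v. D y v \<bullet> b)) (at y)" if "y \<in> U" for y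
      by (rule has_derivative_inner_left[OF D[OF that]])
    show "((\<lambda>y. D y v \<bullet> b) has_derivative (\<lambda>w. Dv y w \<bullet> b)) (at y)" if "y \<in> U" for y
      by (rule has_derivative_inner_left[OF Dv[OF that]])
    show "((\<lambda>y. D y w \<bullet> b) has_derivative (\<lambda>v. Dw y v \<bullet> b)) (at y)" if "y \<in> U" for y
      by (rule has_derivative_inner_left[OF Dw[OF that]])
  qed (intro continuous_on_inner continuous_on_const cont)+
qed

text \<open>Smoothness enters the proof through this C2 extension. It lives on an open set, so the
  symmetry of second derivatives is available at boundary points of \<open>S\<close> too.\<close>

lemma smooth_on_local_C2:
  fixes f :: "'a::real_normed_vector \<Rightarrow> 'b::euclidean_space"
  assumes "smooth_on S f" "x \<in> S"
  obtains U G G1 G2 where "open U" "x \<in> U" "\<And>y. y \<in> U \<Longrightarrow> y \<in> S \<Longrightarrow> G y = f y"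
    "\<And>y. y \<in> U \<Longrightarrow> (G has_derivative G1 y) (at y)"
    "\<And>y v. y \<in> U \<Longrightarrow> ((\<lambda>y. G1 y v) has_derivative G2 y v) (at y)"
    "\<And>v. continuous_on U (\<lambda>y. G1 y v)" "\<And>v w. continuous_on U (\<lambda>y. G2 y v w)"
    "\<And>y v w. y \<in> U \<Longrightarrow> G2 y v w = G2 y w v"
proof -
  obtain U G where G: "open U \<and> x \<in> U \<and> (\<forall>m. Ck_on m U G) \<and> (\<forall>y\<in>U \<inter> S. G y = f y)"
    using bspec[OF assms(1)[unfolded smooth_on_def] assms(2)] by (elim exE)
  then have U: "open U" "x \<in> U" "\<And>m. Ck_on m U G" "\<And>y. y \<in> U \<inter> S \<Longrightarrow> G y = f y"
    by (simp_all del: Ck_on.simps)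
  let ?G1 = "\<lambda>y. frechet_derivative G (at y)"
  let ?G2 = "\<lambda>y v. frechet_derivative (\<lambda>y. ?G1 y v) (at y)"
  have C: "Ck_on (Suc (Suc 0)) U G" by (rule U(3))
  have 1: "(G has_derivative ?G1 y) (at y)" if "y \<in> U" for y
    using C that by (simp add: frechet_derivative_works)
  have 2: "((\<lambda>y. ?G1 y v) has_derivative ?G2 y v) (at y)" if "y \<in> U" for y v
    using C that by (simp add: frechet_derivative_works)
  have 3: "continuous_on U (\<lambda>y. ?G2 y v w)" for v w
    using C by simp
  show thesis
  proof (rule that[OF U(1,2) _ 1 2 _ 3])
    show "continuous_on U (\<lambda>y. ?G1 y v)" for v
      by (intro continuous_at_imp_continuous_on ballI) (rule has_derivative_continuous[OF 2])
    show "?G2 y v w = ?G2 y w v" if "y \<in> U" for y v w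
      by (rule second_derivative_symmetric[OF U(1) that 1 2 2 3 3])
  qed (use U(4) in auto)
qed

section \<open>One-sided derivatives on the half-space and their calculus\<close>

lemma halfspace_add_axis:
  "x \<in> halfspace k \<Longrightarrow> 0 \<le> t \<Longrightarrow> x + t *\<^sub>R axis i 1 \<in> halfspace k"
  by (simp add: halfspace_def axis_def)

lemma closed_halfspace: "closed (halfspace k)"
  unfolding halfspace_def by (rule closed_halfspace_component_ge_cart)

lemma halfspace_borel [measurable]: "halfspace k \<in> sets borel"
  using closed_halfspace by (rule borel_closed)

lemma at_within_openin:
  assumes "openin (top_of_set S) W" "x \<in> W"
  shows "at x within W = at x within S"
proof -
  obtain T where T: "open T" "W = S \<inter> T" using assms(1) by (auto simp: openin_open)
  show ?thesis
    by (rule at_within_nhd[of x T]) (use T assms in auto)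
qed

text \<open>The step \<open>t\<close> need not range over a neighbourhood of 0, but it always ranges
  at least over all \<open>t\<close> \<ge> 0. The filter in \<open>partial\<close> is thus
  nontrivial even on the boundary hyperplane, and the derivative is unique.\<close>

lemma partial_eq:
  assumes x: "x \<in> halfspace k" and f: "(f has_derivative f') (at x within halfspace k)"
  shows "partial k i f x = f' (axis i 1)"
proof -
  let ?T = "{t. x + t *\<^sub>R axis i 1 \<in> halfspace k}"
  interpret bounded_linear f' by (rule has_derivative_bounded_linear[OF f])
  have "((\<lambda>t. x + t *\<^sub>R axis i 1) has_derivative (\<lambda>t. t *\<^sub>R axis i 1)) (at 0 within ?T)"
    by (auto intro!: derivative_eq_intros)
  moreover have "(f has_derivative f') (at (x + 0 *\<^sub>R axis i 1) within (\<lambda>t. x + t *\<^sub>R axis i 1) ` ?T)"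
    using f by (auto intro: has_derivative_subset)
  ultimately have "((\<lambda>t. f (x + t *\<^sub>R axis i 1)) has_derivative (\<lambda>t. f' (t *\<^sub>R axis i 1))) (at 0 within ?T)"
    by (rule has_derivative_in_compose)
  then have 1: "((\<lambda>t. f (x + t *\<^sub>R axis i 1)) has_vector_derivative f' (axis i 1)) (at 0 within ?T)"
    by (simp add: has_vector_derivative_def scaleR)
  have "{0::real..} \<subseteq> ?T" using halfspace_add_axis[OF x] by auto
  moreover have "at (0::real) within {0..} \<noteq> bot"
    by (simp add: at_within_Ici_at_right)
  ultimately have "at 0 within ?T \<noteq> bot"
    by (metis at_le bot.extremum_unique)
  then show ?thesis
    unfolding partial_def using 1 by (rule vector_derivative_within)
qed

lemma vec_expand: "(v :: real^'n) = (\<Sum>i\<in>UNIV. v $ i *\<^sub>R axis i 1)"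
  by (simp add: vec_eq_iff axis_def if_distrib sum.delta cong: if_cong)

lemma has_derivative_partial:
  assumes x: "x \<in> halfspace k" and f: "f differentiable (at x within halfspace k)"
  shows "(f has_derivative (\<lambda>v. \<Sum>i\<in>UNIV. v $ i *\<^sub>R partial k i f x)) (at x within halfspace k)"
proof -
  obtain f' where f': "(f has_derivative f') (at x within halfspace k)"
    using f by (auto simp: differentiable_def)
  interpret bounded_linear f' by (rule has_derivative_bounded_linear[OF f'])
  have "f' v = (\<Sum>i\<in>UNIV. v $ i *\<^sub>R partial k i f x)" for v
    by (subst vec_expand) (simp add: sum scaleR partial_eq[OF x f'])
  then have "f' = (\<lambda>v. \<Sum>i\<in>UNIV. v $ i *\<^sub>R partial k i f x)" by auto
  with f' show ?thesis by simp
qed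

text \<open>Derivatives are taken within the whole half-space, so that they are one-sided at its boundary; in the
  applications \<open>W\<close> is relatively open in it.\<close>

definition C1 :: "'n::finite \<Rightarrow> (real^'n) set \<Rightarrow> (real^'n \<Rightarrow> 'b::real_normed_vector) \<Rightarrow> bool" where
  "C1 k W f \<longleftrightarrow> W \<subseteq> halfspace k \<and> (\<forall>x\<in>W. f differentiable (at x within halfspace k)) \<and>
     (\<forall>i. continuous_on W (partial k i f))"

lemma C1I:
  assumes "W \<subseteq> halfspace k" "\<And>x. x \<in> W \<Longrightarrow> (f has_derivative f' x) (at x within halfspace k)"
    and "\<And>i. continuous_on W (\<lambda>x. f' x (axis i 1))"
  shows "C1 k W f"
proof -
  have "continuous_on W (partial k i f)" for i
    using assms by (subst continuous_on_cong[OF refl partial_eq]) auto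
  with assms show ?thesis by (auto simp: C1_def differentiable_def)
qed

lemma C1D:
  assumes "C1 k W f"
  shows "W \<subseteq> halfspace k"
    and "x \<in> W \<Longrightarrow> (f has_derivative (\<lambda>v. \<Sum>i\<in>UNIV. v $ i *\<^sub>R partial k i f x)) (at x within halfspace k)"
    and "continuous_on W (partial k i f)"
  using assms has_derivative_partial[of x k f] by (auto simp: C1_def)

lemma C1_subset: "C1 k W f \<Longrightarrow> W' \<subseteq> W \<Longrightarrow> C1 k W' f"
  by (auto simp: C1_def intro: continuous_on_subset)

lemma C1_continuous_on:
  assumes "C1 k W f" shows "continuous_on W f"
  using C1D[OF assms]
  by (meson continuous_on_eq_continuous_within continuous_within_subset has_derivative_continuous)

lemma partial_sum_axis: "(\<Sum>j\<in>UNIV. axis i 1 $ j *\<^sub>R f j) = f i" for f :: "'n::finite \<Rightarrow> 'b::real_vector"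
proof -
  have "(\<Sum>j\<in>UNIV. axis i (1::real) $ j *\<^sub>R f j) = (\<Sum>j\<in>UNIV. if j = i then f j else 0)"
    by (intro sum.cong) (auto simp: axis_def)
  then show ?thesis by simp
qed

lemma partial_bilinear:
  assumes b: "bounded_bilinear b" and x: "x \<in> halfspace k"
    and fg: "f differentiable (at x within halfspace k)" "g differentiable (at x within halfspace k)"
  shows "((\<lambda>x. b (f x) (g x)) has_derivative
      (\<lambda>v. b (f x) (\<Sum>i\<in>UNIV. v $ i *\<^sub>R partial k i g x) + b (\<Sum>i\<in>UNIV. v $ i *\<^sub>R partial k i f x) (g x)))
      (at x within halfspace k)"
    and "partial k i (\<lambda>x. b (f x) (g x)) x = b (f x) (partial k i g x) + b (partial k i f x) (g x)"
proof -
  show 1: "((\<lambda>x. b (f x) (g x)) has_derivative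
      (\<lambda>v. b (f x) (\<Sum>i\<in>UNIV. v $ i *\<^sub>R partial k i g x) + b (\<Sum>i\<in>UNIV. v $ i *\<^sub>R partial k i f x) (g x)))
      (at x within halfspace k)"
    by (rule bounded_bilinear.FDERIV[OF b has_derivative_partial[OF x fg(1)] has_derivative_partial[OF x fg(2)]])
  show "partial k i (\<lambda>x. b (f x) (g x)) x = b (f x) (partial k i g x) + b (partial k i f x) (g x)"
    by (simp only: partial_eq[OF x 1] partial_sum_axis)
qed

lemma C1_bilinear:
  assumes b: "bounded_bilinear b" and "C1 k W f" "C1 k W g"
  shows "C1 k W (\<lambda>x. b (f x) (g x))"
proof (rule C1I)
  show "W \<subseteq> halfspace k" using C1D(1)[OF assms(2)] .
  show "((\<lambda>x. b (f x) (g x)) has_derivative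
      (\<lambda>v. b (f x) (\<Sum>i\<in>UNIV. v $ i *\<^sub>R partial k i g x) + b (\<Sum>i\<in>UNIV. v $ i *\<^sub>R partial k i f x) (g x)))
      (at x within halfspace k)" if "x \<in> W" for x
    using assms that by (intro partial_bilinear) (auto simp: C1_def)
  show "continuous_on W (\<lambda>x. b (f x) (\<Sum>j\<in>UNIV. axis i 1 $ j *\<^sub>R partial k j g x) +
      b (\<Sum>j\<in>UNIV. axis i 1 $ j *\<^sub>R partial k j f x) (g x))" for i
    unfolding partial_sum_axis
    using C1_continuous_on[OF assms(2)] C1_continuous_on[OF assms(3)] C1D(3)[OF assms(2)] C1D(3)[OF assms(3)]
    by (intro continuous_on_add bounded_bilinear.continuous_on[OF b])
qed

lemmas C1_mult = C1_bilinear[OF bounded_bilinear_mult]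

lemma partial_mult:
  fixes f g :: "real^'n \<Rightarrow> real"
  assumes x: "x \<in> halfspace k"
    and fg: "f differentiable (at x within halfspace k)" "g differentiable (at x within halfspace k)"
  shows "partial k i (\<lambda>x. f x * g x) x = f x * partial k i g x + partial k i f x * g x"
  by (rule partial_bilinear(2)[OF bounded_bilinear_mult assms])

lemma C1_const: "W \<subseteq> halfspace k \<Longrightarrow> C1 k W (\<lambda>x. c)"
  by (rule C1I[where f' = "\<lambda>x v. 0"]) auto

lemma C1_sum:
  assumes "W \<subseteq> halfspace k" "\<And>s. s \<in> T \<Longrightarrow> C1 k W (f s)"
  shows "C1 k W (\<lambda>x. \<Sum>s\<in>T. f s x)"
proof (rule C1I)
  show "((\<lambda>x. \<Sum>s\<in>T. f s x) has_derivative (\<lambda>v. \<Sum>s\<in>T. \<Sum>i\<in>UNIV. v $ i *\<^sub>R partial k i (f s) x))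
      (at x within halfspace k)" if "x \<in> W" for x
    using assms that by (intro has_derivative_sum C1D)
qed (auto simp: partial_sum_axis intro!: continuous_intros C1D assms)

lemma C1_prod:
  fixes f :: "'s \<Rightarrow> real^'n \<Rightarrow> real"
  assumes "finite T" "W \<subseteq> halfspace k" "\<And>s. s \<in> T \<Longrightarrow> C1 k W (f s)"
  shows "C1 k W (\<lambda>x. \<Prod>s\<in>T. f s x)"
  using assms by (induction T rule: finite_induct) (auto intro!: C1_const C1_mult)

lemma C1_det:
  fixes A :: "real^'m \<Rightarrow> real^'n^'n"
  assumes "W \<subseteq> halfspace k" "\<And>i j. C1 k W (\<lambda>x. A x $ i $ j)"
  shows "C1 k W (\<lambda>x. det (A x))"
  unfolding det_def
proof (rule C1_sum[OF assms(1)])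
  show "C1 k W (\<lambda>x. of_int (sign p) * (\<Prod>i\<in>UNIV. A x $ i $ p i))" for p
    by (rule C1_mult[OF C1_const C1_prod]) (use assms in auto)
qed

lemma C1_real_compose:
  fixes f :: "real^'n \<Rightarrow> real"
  assumes f: "C1 k W f" and h: "\<And>x. x \<in> W \<Longrightarrow> (h has_real_derivative h' (f x)) (at (f x))"
    and h': "continuous_on (f ` W) h'"
  shows "C1 k W (\<lambda>x. h (f x))"
proof (rule C1I)
  show "W \<subseteq> halfspace k" by (rule C1D[OF f])
  show "((\<lambda>x. h (f x)) has_derivative (\<lambda>v. h' (f x) * (\<Sum>i\<in>UNIV. v $ i *\<^sub>R partial k i f x)))
      (at x within halfspace k)" if "x \<in> W" for x
    using has_derivative_compose[OF C1D(2)[OF f that] h[OF that, unfolded has_field_derivative_def]] .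
  show "continuous_on W (\<lambda>x. h' (f x) * (\<Sum>j\<in>UNIV. axis i 1 $ j *\<^sub>R partial k j f x))" for i
    unfolding partial_sum_axis
    by (intro continuous_intros C1D[OF f] continuous_on_compose2[OF h' C1_continuous_on[OF f]]) auto
qed

lemma C1_sqrt: "C1 k W f \<Longrightarrow> (\<And>x. x \<in> W \<Longrightarrow> 0 < f x) \<Longrightarrow> C1 k W (\<lambda>x. sqrt (f x))"
  by (rule C1_real_compose[where h = sqrt and h' = "\<lambda>y. inverse (sqrt y) / 2"])
    (force intro!: DERIV_real_sqrt continuous_intros)+

lemma C1_inverse: "C1 k W f \<Longrightarrow> (\<And>x. x \<in> W \<Longrightarrow> f x \<noteq> 0) \<Longrightarrow> C1 k W (\<lambda>x. inverse (f x) :: real)"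
  by (rule C1_real_compose[where h = inverse and h' = "\<lambda>y. - (inverse y * inverse y)"])
    (force intro!: derivative_eq_intros continuous_intros)+

lemma C1_transform:
  assumes f: "C1 k W f" and U: "\<And>x. x \<in> W \<Longrightarrow> \<exists>U. open U \<and> x \<in> U \<and> (\<forall>y\<in>U \<inter> halfspace k. g y = f y)"
  shows "C1 k W g"
proof (rule C1I)
  show "W \<subseteq> halfspace k" by (rule C1D[OF f])
  show "(g has_derivative (\<lambda>v. \<Sum>i\<in>UNIV. v $ i *\<^sub>R partial k i f x)) (at x within halfspace k)"
    if x: "x \<in> W" for x
  proof -
    obtain U where U: "open U" "x \<in> U" "\<And>y. y\<in>U \<inter> halfspace k \<Longrightarrow> g y = f y" using U[OF x] by blast
    obtain d where d: "0 < d" "ball x d \<subseteq> U" using U openE by blast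
    show ?thesis
      by (rule has_derivative_transform_within[OF C1D(2)[OF f x] d(1)])
        (use U d x C1D(1)[OF f] in \<open>auto simp: dist_commute subset_iff\<close>)
  qed
  show "continuous_on W (\<lambda>x. \<Sum>j\<in>UNIV. axis i 1 $ j *\<^sub>R partial k j f x)" for i
    unfolding partial_sum_axis by (rule C1D[OF f])
qed

lemma has_derivative_agree:
  assumes "(g has_derivative g') (at x within S)" "open U" "x \<in> U" "x \<in> S"
    and "\<And>y. y \<in> U \<Longrightarrow> y \<in> S \<Longrightarrow> f y = g y"
  shows "(f has_derivative g') (at x within S)"
proof -
  obtain d where d: "0 < d" "ball x d \<subseteq> U" using assms openE by blast
  show ?thesis
    by (rule has_derivative_transform_within[OF assms(1) d(1) assms(4)])
      (use assms(5) d in \<open>auto simp: dist_commute subset_iff\<close>)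
qed

lemma continuous_agree:
  fixes f :: "'a::metric_space \<Rightarrow> 'b::topological_space"
  assumes "continuous_on U g" "open U" "x \<in> U" "x \<in> S"
    and "\<And>y. y \<in> U \<Longrightarrow> y \<in> S \<Longrightarrow> f y = g y"
  shows "continuous (at x within S) f"
proof -
  obtain d where d: "0 < d" "ball x d \<subseteq> U" using assms openE by blast
  have "continuous (at x within S) g"
    using assms by (metis continuous_at_imp_continuous_at_within continuous_on_eq_continuous_at)
  then show ?thesis
    by (rule continuous_transform_within[OF _ d(1) assms(4)])
      (use assms(5) d in \<open>auto simp: dist_commute subset_iff\<close>)
qed

lemma C1_local:
  assumes "W \<subseteq> halfspace k"
    and loc: "\<And>x. x \<in> W \<Longrightarrow> \<exists>U g. open U \<and> x \<in> U \<and> C1 k (U \<inter> halfspace k) g \<and> (\<forall>y\<in>U \<inter> halfspace k. f y = g y)"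
  shows "C1 k W f"
proof -
  have "f differentiable (at x within halfspace k) \<and> continuous (at x within W) (partial k i f)"
    if x: "x \<in> W" for x i
  proof -
    obtain U g where U: "open U" "x \<in> U" "C1 k (U \<inter> halfspace k) g"
        "\<And>y. y \<in> U \<inter> halfspace k \<Longrightarrow> f y = g y"
      using loc[OF x] by blast
    then have f: "C1 k (U \<inter> halfspace k) f"
      by (intro C1_transform[OF U(3)]) blast
    have "continuous (at x within U \<inter> halfspace k) (partial k i f)"
      using C1D(3)[OF f] x U assms by (auto simp: continuous_on_eq_continuous_within)
    moreover have "openin (top_of_set (halfspace k)) (U \<inter> halfspace k)"
      using U(1) by (auto simp: openin_open)
    ultimately have "continuous (at x within halfspace k) (partial k i f)"
      using at_within_openin[of "halfspace k" "U \<inter> halfspace k" x] x U assms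
      by (auto simp: openin_open)
    then show ?thesis
      using f x U assms by (auto simp: C1_def intro: continuous_within_subset)
  qed
  then show ?thesis
    using assms(1) by (auto simp: C1_def continuous_on_eq_continuous_within)
qed

text \<open>Made for functions multiplied by a weight with compact support. A point outside
  \<open>W\<close> has the complement of \<open>K\<close> as a neighbourhood, and the extension
  vanishes there.\<close>

lemma C1_extend_zero:
  assumes W: "openin (top_of_set (halfspace k)) W" and K: "closed K" "K \<subseteq> W"
    and f: "C1 k W f" and 0: "\<And>x. x \<in> W \<Longrightarrow> x \<notin> K \<Longrightarrow> f x = 0"
  shows "C1 k (halfspace k) (\<lambda>x. if x \<in> W then f x else 0)"
proof (rule C1_local)
  obtain T where T: "open T" "W = halfspace k \<inter> T" using W by (auto simp: openin_open)
  fix x assume x: "x \<in> halfspace k"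
  show "\<exists>U g. open U \<and> x \<in> U \<and> C1 k (U \<inter> halfspace k) g \<and>
      (\<forall>y\<in>U \<inter> halfspace k. (if y \<in> W then f y else 0) = g y)"
  proof (cases "x \<in> W")
    case True
    then show ?thesis
      using T f by (intro exI[of _ T] exI[of _ f]) (auto simp: Int_commute)
  next
    case False
    then show ?thesis
      using K 0 by (intro exI[of _ "- K"] exI[of _ "\<lambda>x. 0"]) (auto intro: C1_const)
  qed
qed simp

lemma partial_cong:
  assumes W: "openin (top_of_set (halfspace k)) W" "x \<in> W"
    and f: "f differentiable (at x within halfspace k)"
    and eq: "\<And>y. y \<in> W \<Longrightarrow> g y = f y"
  shows "partial k i g x = partial k i f x"
proof -
  obtain T where T: "open T" "W = halfspace k \<inter> T" using W by (auto simp: openin_open)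
  have x: "x \<in> halfspace k" using T W by auto
  have "(g has_derivative (\<lambda>v. \<Sum>i\<in>UNIV. v $ i *\<^sub>R partial k i f x)) (at x within halfspace k)"
    by (rule has_derivative_agree[OF has_derivative_partial[OF x f] T(1)]) (use T W eq in auto)
  from partial_eq[OF x this, of i] show ?thesis by (simp add: partial_sum_axis)
qed

text \<open>The inner derivative is taken within \<open>W\<close>, whose image lies in the
  half-space, so that the one-sided derivative of \<open>f\<close> applies. Relative openness of
  \<open>W\<close> then replaces \<open>W\<close> by the half-space.\<close>

lemma C1_compose:
  fixes \<tau> :: "real^'n \<Rightarrow> real^'n"
  assumes W: "openin (top_of_set (halfspace k)) W" and \<tau>: "C1 k W \<tau>" "\<tau> ` W \<subseteq> W'" and f: "C1 k W' f"
  shows "C1 k W (\<lambda>x. f (\<tau> x))"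
    and "x \<in> W \<Longrightarrow> partial k i (\<lambda>x. f (\<tau> x)) x = (\<Sum>j\<in>UNIV. partial k i \<tau> x $ j *\<^sub>R partial k j f (\<tau> x))"
proof -
  have der: "((\<lambda>x. f (\<tau> x)) has_derivative
      (\<lambda>v. \<Sum>j\<in>UNIV. (\<Sum>i\<in>UNIV. v $ i *\<^sub>R partial k i \<tau> x) $ j *\<^sub>R partial k j f (\<tau> x))) (at x within halfspace k)"
    if x: "x \<in> W" for x
  proof -
    have "(\<tau> has_derivative (\<lambda>v. \<Sum>i\<in>UNIV. v $ i *\<^sub>R partial k i \<tau> x)) (at x within W)"
      using C1D(2)[OF \<tau>(1) x] at_within_openin[OF W x] by simp
    moreover have "(f has_derivative (\<lambda>v. \<Sum>i\<in>UNIV. v $ i *\<^sub>R partial k i f (\<tau> x))) (at (\<tau> x) within \<tau> ` W)"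
      using C1D(1)[OF f] \<tau>(2) x by (intro has_derivative_subset[OF C1D(2)[OF f]]) auto
    ultimately have "((\<lambda>x. f (\<tau> x)) has_derivative
        (\<lambda>v. \<Sum>j\<in>UNIV. (\<Sum>i\<in>UNIV. v $ i *\<^sub>R partial k i \<tau> x) $ j *\<^sub>R partial k j f (\<tau> x))) (at x within W)"
      by (rule has_derivative_in_compose)
    then show ?thesis using at_within_openin[OF W x] by simp
  qed
  show "partial k i (\<lambda>x. f (\<tau> x)) x = (\<Sum>j\<in>UNIV. partial k i \<tau> x $ j *\<^sub>R partial k j f (\<tau> x))" if "x \<in> W"
    using partial_eq[OF _ der[OF that]] that C1D(1)[OF \<tau>(1)] by (auto simp: partial_sum_axis)
  show "C1 k W (\<lambda>x. f (\<tau> x))"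
  proof (rule C1I[OF C1D(1)[OF \<tau>(1)] der])
    show "continuous_on W (\<lambda>x. \<Sum>j\<in>UNIV. (\<Sum>i'\<in>UNIV. axis i 1 $ i' *\<^sub>R partial k i' \<tau> x) $ j *\<^sub>R partial k j f (\<tau> x))" for i
      unfolding partial_sum_axis
      using \<tau>(2) by (intro continuous_intros C1D(3)[OF \<tau>(1)] continuous_on_compose2[OF C1D(3)[OF f] C1_continuous_on[OF \<tau>(1)]])
  qed
qed

lemma smooth_on_C2:
  fixes f :: "real^'n \<Rightarrow> 'b::euclidean_space"
  assumes W: "openin (top_of_set (halfspace k)) W" and f: "smooth_on W f"
  shows "C1 k W f" and "C1 k W (partial k i f)"
    and "x \<in> W \<Longrightarrow> partial k i (partial k j f) x = partial k j (partial k i f) x"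
proof -
  obtain T where T: "open T" "W = halfspace k \<inter> T" using W by (auto simp: openin_open)
  have WH: "W \<subseteq> halfspace k" using T by auto
  have "\<exists>U f1 f2. open U \<and> x \<in> U \<and> (\<forall>v. continuous_on U (\<lambda>y. f1 y v)) \<and> (\<forall>v w. continuous_on U (\<lambda>y. f2 y v w)) \<and>
      (\<forall>y\<in>U \<inter> W. (f has_derivative f1 y) (at y within halfspace k)) \<and>
      (\<forall>y\<in>U \<inter> W. \<forall>i. (partial k i f has_derivative f2 y (axis i 1)) (at y within halfspace k)) \<and>
      (\<forall>y\<in>U \<inter> W. \<forall>v w. f2 y v w = f2 y w v)" if x: "x \<in> W" for x
  proof -
    obtain U G G1 G2 where U: "open U" "x \<in> U" "\<And>y. y \<in> U \<Longrightarrow> y \<in> W \<Longrightarrow> G y = f y"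
      "\<And>y. y \<in> U \<Longrightarrow> (G has_derivative G1 y) (at y)"
      "\<And>y v. y \<in> U \<Longrightarrow> ((\<lambda>y. G1 y v) has_derivative G2 y v) (at y)"
      "\<And>v. continuous_on U (\<lambda>y. G1 y v)" "\<And>v w. continuous_on U (\<lambda>y. G2 y v w)"
      "\<And>y v w. y \<in> U \<Longrightarrow> G2 y v w = G2 y w v"
      by (rule smooth_on_local_C2[OF f x]) (rule that; assumption)
    \<comment> \<open>On \<open>U\<close> alone the extension agrees with \<open>f\<close> only
      inside \<open>W\<close>. Intersecting with \<open>T\<close>, which cuts \<open>W\<close> out
      of the half-space, gives agreement on a relatively open subset of the half-space.\<close>
    let ?U = "U \<inter> T"
    have 1: "(f has_derivative G1 y) (at y within halfspace k)" if "y \<in> U \<inter> W" for y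
      by (rule has_derivative_agree[OF has_derivative_at_withinI[OF U(4)], where U = ?U]) (use U that T in auto)
    then have p: "partial k i f y = G1 y (axis i 1)" if "y \<in> U \<inter> W" for y i
      using that WH by (intro partial_eq) auto
    have 2: "(partial k i f has_derivative G2 y (axis i 1)) (at y within halfspace k)" if "y \<in> U \<inter> W" for y i
      by (rule has_derivative_agree[OF has_derivative_at_withinI[OF U(5)], where U = ?U]) (use U that T p in auto)
    show ?thesis
      by (rule exI[of _ U], rule exI[of _ G1], rule exI[of _ G2]) (use U 1 2 in auto)
  qed
  note loc = this
  have "f differentiable (at x within halfspace k) \<and> continuous (at x within W) (partial k i f) \<and>
    partial k i f differentiable (at x within halfspace k) \<and> continuous (at x within W) (partial k j (partial k i f)) \<and>
    partial k i (partial k j f) x = partial k j (partial k i f) x" if x: "x \<in> W" for x i j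
  proof -
    obtain U f1 f2 where U: "open U" "x \<in> U" "\<And>v. continuous_on U (\<lambda>y. f1 y v)"
      "\<And>v w. continuous_on U (\<lambda>y. f2 y v w)"
      "\<And>y. y \<in> U \<Longrightarrow> y \<in> W \<Longrightarrow> (f has_derivative f1 y) (at y within halfspace k)"
      "\<And>y i. y \<in> U \<Longrightarrow> y \<in> W \<Longrightarrow> (partial k i f has_derivative f2 y (axis i 1)) (at y within halfspace k)"
      "\<And>y v w. y \<in> U \<Longrightarrow> y \<in> W \<Longrightarrow> f2 y v w = f2 y w v"
      using loc[OF x] unfolding Int_iff ball_simps by (elim exE conjE) (metis (no_types) IntI)
    have "continuous (at x within W) (partial k i f)"
      by (rule continuous_agree[OF U(3) U(1,2) x]) (use U(5) WH in \<open>auto intro: partial_eq\<close>)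
    moreover have "continuous (at x within W) (partial k j (partial k i f))"
      by (rule continuous_agree[OF U(4) U(1,2) x]) (use U(6) WH in \<open>auto intro: partial_eq\<close>)
    moreover have "partial k i (partial k j f) x = partial k j (partial k i f) x"
      using x WH U(2,7) partial_eq[OF _ U(6)[OF U(2) x]] by auto
    ultimately show ?thesis
      using U(5,6)[OF U(2) x] by (auto simp: differentiable_def)
  qed
  then show "C1 k W f" "C1 k W (partial k i f)"
    "x \<in> W \<Longrightarrow> partial k i (partial k j f) x = partial k j (partial k i f) x"
    using WH by (auto simp: C1_def continuous_on_eq_continuous_within)
qed

text \<open>Derivatives in the parameter and in space commute: this is the symmetry of the second
  derivative of a local extension in the directions (1, 0) and (0, \<open>axis i 1\<close>). The
  nontrivial filters identify \<open>V\<close> with the derivative of the extension in the direction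
  (1, 0).\<close>

lemma smooth_family:
  fixes F :: "real \<Rightarrow> real^'n \<Rightarrow> 'b::euclidean_space"
  assumes I: "\<And>a. a \<in> I \<Longrightarrow> at a within I \<noteq> bot"
    and W: "openin (top_of_set (halfspace k)) W" and F: "smooth_on (I \<times> W) (\<lambda>(a, x). F a x)"
  defines "V \<equiv> \<lambda>a x. vector_derivative (\<lambda>b. F b x) (at a within I)"
  shows "a \<in> I \<Longrightarrow> x \<in> W \<Longrightarrow> ((\<lambda>b. F b x) has_vector_derivative V a x) (at a within I)"
    and "a \<in> I \<Longrightarrow> C1 k W (V a)"
    and "a \<in> I \<Longrightarrow> x \<in> W \<Longrightarrow>
      ((\<lambda>b. partial k i (F b) x) has_vector_derivative partial k i (V a) x) (at a within I)"
    and "continuous_on (I \<times> W) (\<lambda>(a, x). partial k i (F a) x)"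
    and "continuous_on (I \<times> W) (\<lambda>(a, x). partial k i (V a) x)"
proof -
  obtain T where T: "open T" "W = halfspace k \<inter> T" using W by (auto simp: openin_open)
  have WH: "W \<subseteq> halfspace k" using T by auto
  have main: "((\<lambda>b. F b x) has_vector_derivative V a x) (at a within I) \<and>
      V a differentiable (at x within halfspace k) \<and>
      ((\<lambda>b. partial k i (F b) x) has_vector_derivative partial k i (V a) x) (at a within I) \<and>
      continuous (at (a, x) within I \<times> W) (\<lambda>(a, x). partial k i (F a) x) \<and>
      continuous (at (a, x) within I \<times> W) (\<lambda>(a, x). partial k i (V a) x)"
    if ax: "a \<in> I" "x \<in> W" for a x i
  proof -
    obtain U G G1 G2 where U: "open U" "(a, x) \<in> U" "\<And>y. y \<in> U \<Longrightarrow> y \<in> I \<times> W \<Longrightarrow> G y = (\<lambda>(a, x). F a x) y"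
      "\<And>y. y \<in> U \<Longrightarrow> (G has_derivative G1 y) (at y)"
      "\<And>y v. y \<in> U \<Longrightarrow> ((\<lambda>y. G1 y v) has_derivative G2 y v) (at y)"
      "\<And>v. continuous_on U (\<lambda>y. G1 y v)" "\<And>v w. continuous_on U (\<lambda>y. G2 y v w)"
      "\<And>y v w. y \<in> U \<Longrightarrow> G2 y v w = G2 y w v"
      by (rule smooth_on_local_C2[OF F SigmaI[OF ax]]) (rule that; assumption)
    have GF: "G (b, y) = F b y" if "(b, y) \<in> U" "b \<in> I" "y \<in> W" for b y
      using U(3)[of "(b, y)"] that by simp
    have slice1: "open {s. (s, y) \<in> U}" for y
      using open_vimage[OF U(1), of "\<lambda>s. (s, y)"] by (simp add: vimage_def continuous_on_Pair)
    have slice2: "open ({y. (b, y) \<in> U} \<inter> T)" for b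
      using open_vimage[OF U(1), of "\<lambda>y. (b, y)"] T(1) by (simp add: vimage_def continuous_on_Pair open_Int)
    have comp1: "((\<lambda>s. g (s, y)) has_vector_derivative g' (1, 0)) (at b within I)"
      if g: "(g has_derivative g') (at (b, y))" for g' b y and g :: "_ \<Rightarrow> 'b"
    proof -
      have "((\<lambda>s. g (s, y)) has_derivative (\<lambda>h. g' (h, 0))) (at b within I)"
        by (rule has_derivative_compose[where f = "\<lambda>s. (s, y)", OF _ g]) (auto intro!: derivative_eq_intros)
      moreover have "(\<lambda>h. g' (h, 0)) = (\<lambda>h. h *\<^sub>R g' (1, 0))"
      proof
        show "g' (h, 0) = h *\<^sub>R g' (1, 0)" for h
          using linear_scale[OF has_derivative_linear[OF g], of h "(1, 0)"] by simp
      qed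
      ultimately show ?thesis unfolding has_vector_derivative_def by simp
    qed
    have comp2: "((\<lambda>y. g (b, y)) has_derivative (\<lambda>v. g' (0, v))) (at y within halfspace k)"
      if g: "(g has_derivative g') (at (b, y))" for g' b y and g :: "_ \<Rightarrow> 'b"
      by (rule has_derivative_compose[where f = "\<lambda>y. (b, y)", OF _ g]) (auto intro!: derivative_eq_intros)
    have tF: "((\<lambda>b. F b y) has_vector_derivative G1 (b, y) (1, 0)) (at b within I)"
      if "(b, y) \<in> U" "b \<in> I" "y \<in> W" for b y
      unfolding has_vector_derivative_def
      by (rule has_derivative_agree[OF comp1[OF U(4)[OF that(1)], unfolded has_vector_derivative_def] slice1])
        (use that GF in auto)
    then have V: "V b y = G1 (b, y) (1, 0)" if "(b, y) \<in> U" "b \<in> I" "y \<in> W" for b y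
      unfolding V_def using that I by (intro vector_derivative_within) auto
    have xF: "(F b has_derivative (\<lambda>v. G1 (b, y) (0, v))) (at y within halfspace k)"
      if "(b, y) \<in> U" "b \<in> I" "y \<in> W" for b y
      by (rule has_derivative_agree[OF comp2[OF U(4)[OF that(1)]] slice2])
        (use that GF T in auto)
    then have pF: "partial k i (F b) y = G1 (b, y) (0, axis i 1)" if "(b, y) \<in> U" "b \<in> I" "y \<in> W" for b y
      using that WH by (intro partial_eq) auto
    have xV: "(V b has_derivative (\<lambda>v. G2 (b, y) (1, 0) (0, v))) (at y within halfspace k)"
      if "(b, y) \<in> U" "b \<in> I" "y \<in> W" for b y
      by (rule has_derivative_agree[OF comp2[OF U(5)[OF that(1)]] slice2])
        (use that V T in auto)
    then have pV: "partial k i (V b) y = G2 (b, y) (1, 0) (0, axis i 1)" if "(b, y) \<in> U" "b \<in> I" "y \<in> W" for b y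
      using that WH by (intro partial_eq) auto
    have "((\<lambda>b. partial k i (F b) x) has_vector_derivative G2 (a, x) (0, axis i 1) (1, 0)) (at a within I)"
      unfolding has_vector_derivative_def
      by (rule has_derivative_agree[OF comp1[OF U(5)[OF U(2)], unfolded has_vector_derivative_def] slice1])
        (use ax pF U(2) in auto)
    moreover have "continuous (at (a, x) within I \<times> W) (\<lambda>(a, x). partial k i (F a) x)"
      by (rule continuous_agree[OF U(6) U(1,2)]) (use ax pF in auto)
    moreover have "continuous (at (a, x) within I \<times> W) (\<lambda>(a, x). partial k i (V a) x)"
      by (rule continuous_agree[OF U(7) U(1,2)]) (use ax pV in auto)
    moreover have "V a differentiable (at x within halfspace k)"
      using xV[OF U(2) ax] by (rule differentiableI)
    ultimately show ?thesis
      using tF V pV U(2,8) ax by auto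
  qed
  show cV: "continuous_on (I \<times> W) (\<lambda>(a, x). partial k i (V a) x)" for i
    using main by (auto simp: continuous_on_eq_continuous_within)
  show "a \<in> I \<Longrightarrow> x \<in> W \<Longrightarrow> ((\<lambda>b. F b x) has_vector_derivative V a x) (at a within I)"
    "a \<in> I \<Longrightarrow> x \<in> W \<Longrightarrow>
      ((\<lambda>b. partial k i (F b) x) has_vector_derivative partial k i (V a) x) (at a within I)"
    using main by auto
  show "continuous_on (I \<times> W) (\<lambda>(a, x). partial k i (F a) x)"
    using main by (auto simp: continuous_on_eq_continuous_within)
  show "C1 k W (V a)" if "a \<in> I"
    unfolding C1_def
  proof (intro conjI ballI allI)
    show "continuous_on W (partial k i (V a))" for i
      using continuous_on_compose2[OF cV, of W "\<lambda>x. (a, x)" i] that by (simp add: continuous_on_Pair image_subset_iff)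
  qed (use main that WH in auto)
qed

section \<open>Lebesgue measure on the half-space and on its boundary\<close>

lemma prod_Basis_vec:
  fixes f :: "real^'n \<Rightarrow> 'a::comm_monoid_mult"
  shows "(\<Prod>b\<in>Basis. f b) = (\<Prod>i\<in>UNIV. f (axis i 1))"
proof -
  have *: "(Basis :: (real^'n) set) = range (\<lambda>i. axis i 1)"
    by (auto simp: Basis_vec_def)
  show ?thesis
    unfolding * by (subst prod.reindex) (auto simp: inj_on_def axis_eq_axis)
qed

lemma measurable_vec_lambda:
  fixes f :: "'a \<Rightarrow> 'n::finite \<Rightarrow> real"
  assumes "\<And>i. (\<lambda>x. f x i) \<in> borel_measurable M"
  shows "(\<lambda>x. \<chi> i. f x i) \<in> borel_measurable M"
proof (subst borel_measurable_euclidean_space, intro ballI)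
  fix b :: "real^'n" assume "b \<in> Basis"
  then obtain i where "b = axis i 1" by (auto simp: Basis_vec_def)
  then show "(\<lambda>x. (\<chi> i. f x i) \<bullet> b) \<in> borel_measurable M"
    using assms by (simp add: inner_axis)
qed

lemma lborel_eq_distr_PiM:
  "(lborel :: (real^'n) measure) = distr (\<Pi>\<^sub>M i\<in>UNIV. lborel) borel (\<lambda>f. \<chi> i. f i)"
proof (rule lborel_eqI)
  interpret product_sigma_finite "\<lambda>i::'n. lborel :: real measure" ..
  have meas: "(\<lambda>f. \<chi> i. f i) \<in> measurable (\<Pi>\<^sub>M i\<in>UNIV. lborel) (borel :: (real^'n) measure)"
    by (rule measurable_vec_lambda) measurable
  fix l u :: "real^'n" assume le: "\<And>b. b \<in> Basis \<Longrightarrow> l \<bullet> b \<le> u \<bullet> b"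
  have le': "l $ i \<le> u $ i" for i using le[of "axis i 1"] by (simp add: inner_axis axis_in_Basis_iff)
  have "(\<lambda>f. \<chi> i. f i) -` box l u \<inter> space (\<Pi>\<^sub>M i\<in>UNIV. lborel) = (\<Pi>\<^sub>E i\<in>UNIV. {l $ i<..<u $ i})"
    by (auto simp: space_PiM mem_box_cart PiE_iff)
  then show "emeasure (distr (\<Pi>\<^sub>M i\<in>UNIV. lborel) borel (\<lambda>f. \<chi> i. f i)) (box l u) = (\<Prod>b\<in>Basis. (u - l) \<bullet> b)"
    using meas by (simp add: emeasure_distr emeasure_PiM le' prod_Basis_vec inner_axis prod_ennreal)
qed simp

definition flat :: "'n::finite \<Rightarrow> real^'n \<Rightarrow> real^'n" where
  "flat k x = (\<chi> i. if i = k then 0 else x $ i)"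

lemma flat_nth: "flat k x $ i = (if i = k then 0 else x $ i)"
  by (simp add: flat_def)

lemma flat_measurable [measurable]: "flat k \<in> borel_measurable borel"
  unfolding flat_def[abs_def]
proof (rule measurable_vec_lambda)
  show "(\<lambda>x. if i = k then 0 else x $ i) \<in> borel_measurable borel" for i
    by (cases "i = k") (auto intro!: borel_measurable_continuous_onI continuous_intros)
qed

lemma flat_axis: "flat k x + x $ k *\<^sub>R axis k 1 = x"
  by (simp add: vec_eq_iff flat_nth axis_def)

lemma sets_hyperplane_lborel [simp, measurable_cong]: "sets (hyperplane_lborel k) = sets borel"
  by (simp add: hyperplane_lborel_def)

lemma space_hyperplane_lborel [simp]: "space (hyperplane_lborel k) = UNIV"
  by (simp add: hyperplane_lborel_def)

lemma hyperplane_measurable [measurable]: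
  "(\<lambda>f. \<chi> i. if i = k then 0 else f i) \<in>
    measurable (\<Pi>\<^sub>M i\<in>UNIV - {k}. lborel) (borel :: (real^'n) measure)"
proof (rule measurable_vec_lambda)
  fix i
  show "(\<lambda>f. if i = k then 0 else f i) \<in> borel_measurable (\<Pi>\<^sub>M i\<in>UNIV - {k}. lborel)"
    by (cases "i = k") (auto intro: measurable_component_singleton)
qed

lemma hyperplane_lborel_line_update:
  "(\<chi> i. if i = k then 0 else f i) + t *\<^sub>R axis k 1 = ((\<chi> i. (f(k := t)) i) :: real^'n)"
  by (simp add: vec_eq_iff axis_def)

text \<open>Lebesgue measure and \<open>hyperplane_lborel\<close> are both images of finite product
  measures, and their index sets differ by \<open>k\<close>; the statement is the insertion of one
  index into a product.\<close>

lemma nn_integral_lborel_slice: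
  fixes f :: "real^'n \<Rightarrow> ennreal"
  assumes [measurable]: "f \<in> borel_measurable borel"
  shows "(\<integral>\<^sup>+x. f x \<partial>lborel) = (\<integral>\<^sup>+y. (\<integral>\<^sup>+t. f (y + t *\<^sub>R axis k 1) \<partial>lborel) \<partial>hyperplane_lborel k)"
proof -
  interpret product_sigma_finite "\<lambda>i::'n. lborel :: real measure" ..
  have ins: "insert k (UNIV - {k}) = UNIV" by auto
  have m: "(\<lambda>y. \<integral>\<^sup>+t. f (y + t *\<^sub>R axis k 1) \<partial>lborel) \<in> borel_measurable borel"
    by measurable
  have [measurable]: "(\<lambda>g. \<chi> i. g i) \<in> measurable (\<Pi>\<^sub>M i\<in>UNIV. lborel) (borel :: (real^'n) measure)"
    by (rule measurable_vec_lambda) measurable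
  have "(\<integral>\<^sup>+x. f x \<partial>lborel) = (\<integral>\<^sup>+g. f (\<chi> i. g i) \<partial>(\<Pi>\<^sub>M i\<in>UNIV. lborel))"
    by (subst lborel_eq_distr_PiM) (simp add: nn_integral_distr)
  also have "\<dots> = (\<integral>\<^sup>+g. (\<integral>\<^sup>+t. f (\<chi> i. (g(k := t)) i) \<partial>lborel) \<partial>(\<Pi>\<^sub>M i\<in>UNIV - {k}. lborel))"
    using product_nn_integral_insert[of "UNIV - {k}" k "\<lambda>g. f (\<chi> i. g i)"] unfolding ins by simp
  also have "\<dots> = (\<integral>\<^sup>+y. (\<integral>\<^sup>+t. f (y + t *\<^sub>R axis k 1) \<partial>lborel) \<partial>hyperplane_lborel k)"
    unfolding hyperplane_lborel_def
    using hyperplane_measurable m by (subst nn_integral_distr) (simp_all add: hyperplane_lborel_line_update fun_upd_def)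
  finally show ?thesis .
qed

lemma integral_lborel_slice:
  fixes f :: "real^'n \<Rightarrow> real"
  assumes f: "integrable lborel f"
  shows "(\<integral>x. f x \<partial>lborel) = (\<integral>y. (\<integral>t. f (y + t *\<^sub>R axis k 1) \<partial>lborel) \<partial>hyperplane_lborel k)"
proof -
  interpret product_sigma_finite "\<lambda>i::'n. lborel :: real measure" ..
  have [measurable]: "f \<in> borel_measurable borel" using f by auto
  have ins: "insert k (UNIV - {k}) = UNIV" by auto
  have m: "(\<lambda>y. \<integral>t. f (y + t *\<^sub>R axis k 1) \<partial>lborel) \<in> borel_measurable borel"
    by measurable
  have [measurable]: "(\<lambda>g. \<chi> i. g i) \<in> measurable (\<Pi>\<^sub>M i\<in>UNIV. lborel) (borel :: (real^'n) measure)"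
    by (rule measurable_vec_lambda) measurable
  have "integrable (distr (\<Pi>\<^sub>M i\<in>UNIV. lborel) borel (\<lambda>f. \<chi> i. f i)) f"
    using f by (subst (asm) lborel_eq_distr_PiM)
  then have int: "integrable (\<Pi>\<^sub>M i\<in>UNIV. lborel) (\<lambda>g. f (\<chi> i. g i))"
    by (simp add: integrable_distr_eq)
  have "(\<integral>x. f x \<partial>lborel) = (\<integral>g. f (\<chi> i. g i) \<partial>(\<Pi>\<^sub>M i\<in>UNIV. lborel))"
    by (subst lborel_eq_distr_PiM) (simp add: integral_distr)
  also have "\<dots> = (\<integral>g. (\<integral>t. f (\<chi> i. (g(k := t)) i) \<partial>lborel) \<partial>(\<Pi>\<^sub>M i\<in>UNIV - {k}. lborel))"
    using product_integral_insert[of "UNIV - {k}" k "\<lambda>g. f (\<chi> i. g i)"] int unfolding ins by simp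
  also have "\<dots> = (\<integral>y. (\<integral>t. f (y + t *\<^sub>R axis k 1) \<partial>lborel) \<partial>hyperplane_lborel k)"
    unfolding hyperplane_lborel_def
    using hyperplane_measurable m by (subst integral_distr) (simp_all add: hyperplane_lborel_line_update fun_upd_def)
  finally show ?thesis .
qed

lemma AE_hyperplane_lborel: "AE y in hyperplane_lborel k. y $ k = 0"
  unfolding hyperplane_lborel_def by (subst AE_distr_iff) auto

text \<open>Thickening by the unit interval expresses the measure on the hyperplane through the
  \<open>n\<close>-dimensional one, and so transfers the change of variables.\<close>

lemma nn_integral_hyperplane_thicken:
  fixes g :: "real^'n \<Rightarrow> ennreal"
  assumes [measurable]: "g \<in> borel_measurable borel"
  shows "(\<integral>\<^sup>+y. g y \<partial>hyperplane_lborel k) =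
    (\<integral>\<^sup>+x. g (flat k x) * indicator {x. x $ k \<in> {0..1}} x \<partial>lborel)"
proof -
  have "(\<integral>\<^sup>+x. g (flat k x) * indicator {x. x $ k \<in> {0..1}} x \<partial>lborel) =
    (\<integral>\<^sup>+y. (\<integral>\<^sup>+t. g (flat k (y + t *\<^sub>R axis k 1)) * indicator {x. x $ k \<in> {0..1}} (y + t *\<^sub>R axis k 1) \<partial>lborel)
      \<partial>hyperplane_lborel k)"
    by (intro nn_integral_lborel_slice) measurable
  also have "\<dots> = (\<integral>\<^sup>+y. g y \<partial>hyperplane_lborel k)"
  proof (rule nn_integral_cong_AE, use AE_hyperplane_lborel[of k] in eventually_elim)
    fix y :: "real^'n" assume y: "y $ k = 0"
    then have "flat k (y + t *\<^sub>R axis k 1) = y" "(y + t *\<^sub>R axis k 1) $ k = t" for t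
      by (simp_all add: vec_eq_iff flat_nth axis_def)
    then have "(\<integral>\<^sup>+t. g (flat k (y + t *\<^sub>R axis k 1)) * indicator {x. x $ k \<in> {0..1}} (y + t *\<^sub>R axis k 1) \<partial>lborel)
      = (\<integral>\<^sup>+t. g y * indicator {0..1::real} t \<partial>lborel)"
      by (intro nn_integral_cong) (simp split: split_indicator)
    also have "\<dots> = g y"
      by (simp add: nn_integral_cmult)
    finally show "(\<integral>\<^sup>+t. g (flat k (y + t *\<^sub>R axis k 1)) * indicator {x. x $ k \<in> {0..1}} (y + t *\<^sub>R axis k 1) \<partial>lborel)
      = g y" .
  qed
  finally show ?thesis ..
qed

section \<open>Change of variables for nonnegative integrands\<close>

text \<open>The library states the change of variables for well-ordered index types only; \<open>'n ix\<close> is a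
  well-ordered copy of an arbitrary finite index type.\<close>

typedef 'n ix = "{..<CARD('n::finite)}"
  by (rule exI[of _ 0]) simp

instantiation ix :: (finite) linorder begin
definition "a < b \<longleftrightarrow> Rep_ix a < Rep_ix b"
definition "a \<le> b \<longleftrightarrow> Rep_ix a \<le> Rep_ix b"
instance
  by standard (auto simp: less_ix_def less_eq_ix_def Rep_ix_inject)
end

instance ix :: (finite) finite
proof
  show "finite (UNIV :: 'a ix set)"
    unfolding type_definition.univ[OF type_definition_ix] by simp
qed

instance ix :: (finite) wellorder
proof
  fix P :: "'a ix \<Rightarrow> bool" and a
  assume *: "\<And>x. (\<And>y. y < x \<Longrightarrow> P y) \<Longrightarrow> P x"
  show "P a"
    by (induction a rule: measure_induct_rule[of Rep_ix]) (rule *, simp add: less_ix_def)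
qed

lemma ex_bij_ix: "\<exists>e :: 'n::finite ix \<Rightarrow> 'n. bij e"
proof -
  have "CARD('n ix) = CARD('n)"
    using type_definition.card[OF type_definition_ix] by simp
  then show ?thesis
    using finite_same_card_bij[of "UNIV :: 'n ix set" "UNIV :: 'n set"] by auto
qed

text \<open>The library gives an equivalence of absolute integrability together with equal
  integrals. For nonnegative functions this is a full equality: if one side is not integrable,
  neither is the other, and both integrals are infinite.\<close>

lemma nn_integral_change_of_variables_wellorder:
  fixes f :: "real^'m::{finite,wellorder} \<Rightarrow> real" and g :: "real^'m::_ \<Rightarrow> real^'m::_"
  assumes S: "S \<in> sets borel" and gS: "g ` S \<in> sets borel"
    and der: "\<And>x. x \<in> S \<Longrightarrow> (g has_derivative g' x) (at x within S)"
    and inj: "inj_on g S"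
    and f: "(\<lambda>y. indicator (g ` S) y * f y) \<in> borel_measurable borel" "\<And>y. y \<in> g ` S \<Longrightarrow> 0 \<le> f y"
    and fg: "(\<lambda>x. indicator S x * (\<bar>det (matrix (g' x))\<bar> * f (g x))) \<in> borel_measurable borel"
  shows "(\<integral>\<^sup>+y. ennreal (indicator (g ` S) y * f y) \<partial>lborel) =
    (\<integral>\<^sup>+x. ennreal (indicator S x * (\<bar>det (matrix (g' x))\<bar> * f (g x))) \<partial>lborel)"
proof -
  let ?D = "\<lambda>x. \<bar>det (matrix (g' x))\<bar> * f (g x)"
  have S': "S \<in> sets lebesgue" using S by simp
  \<comment> \<open>The library statement is about vector-valued functions; \<open>real^1\<close>
    serves as the scalars.\<close>
  have *: "(?D absolutely_integrable_on S \<and> integral S ?D = b) \<longleftrightarrow>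
      (f absolutely_integrable_on g ` S \<and> integral (g ` S) f = b)" for b
    using has_absolute_integral_change_of_variables[OF S' der inj, of "\<lambda>y. vec (f y) :: real^1" "vec b"]
    by (simp add: absolutely_integrable_on_1_iff integral_on_1_eq vec_eq_iff)
  have conv: "(h absolutely_integrable_on T \<longleftrightarrow> integrable lborel (\<lambda>x. indicator T x * h x)) \<and>
      (h absolutely_integrable_on T \<longrightarrow> (\<integral>x. indicator T x * h x \<partial>lborel) = integral T h)"
    if "(\<lambda>x. indicator T x * h x) \<in> borel_measurable borel" for h :: "real^'m::_ \<Rightarrow> real" and T
    using that set_lebesgue_integral_eq_integral(2)[of T h]
    by (auto simp: set_integrable_def set_lebesgue_integral_def integrable_completion integral_completion)
  have nonneg: "0 \<le> indicator (g ` S) y * f y" "0 \<le> indicator S x * ?D x" for x y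
    using f(2) by (auto split: split_indicator)
  have inf: "(\<integral>\<^sup>+x. ennreal (h x) \<partial>lborel) = \<infinity>"
    if "h \<in> borel_measurable borel" "\<And>x. 0 \<le> h x" "\<not> integrable lborel h" for h :: "real^'m::_ \<Rightarrow> real"
    using integrableI_nonneg[of h lborel] that by (auto simp flip: less_top)
  show ?thesis
  proof (cases "f absolutely_integrable_on g ` S")
    case True
    with *[of "integral (g ` S) f"] have D: "?D absolutely_integrable_on S" "integral S ?D = integral (g ` S) f"
      by auto
    have "(\<integral>\<^sup>+y. ennreal (indicator (g ` S) y * f y) \<partial>lborel) = ennreal (integral (g ` S) f)"
      using conv[OF f(1)] True nonneg by (simp add: nn_integral_eq_integral)
    moreover have "(\<integral>\<^sup>+x. ennreal (indicator S x * ?D x) \<partial>lborel) = ennreal (integral S ?D)"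
      using conv[OF fg] D nonneg by (simp add: nn_integral_eq_integral)
    ultimately show ?thesis using D by simp
  next
    case False
    with *[of "integral S ?D"] have D: "\<not> ?D absolutely_integrable_on S" by auto
    have "(\<integral>\<^sup>+y. ennreal (indicator (g ` S) y * f y) \<partial>lborel) = \<infinity>"
      using conv[OF f(1)] False nonneg(1) f(1) by (intro inf) auto
    moreover have "(\<integral>\<^sup>+x. ennreal (indicator S x * ?D x) \<partial>lborel) = \<infinity>"
      using conv[OF fg] D nonneg(2) fg by (intro inf) auto
    ultimately show ?thesis by simp
  qed
qed

lemma lborel_distr_reindex:
  fixes e :: "'m::finite \<Rightarrow> 'n::finite"
  assumes e: "bij e"
  shows "(lborel :: (real^'n) measure) = distr lborel borel (\<lambda>y :: real^'m. \<chi> i. y $ inv e i)"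
proof (rule lborel_eqI)
  fix l u :: "real^'n" assume le: "\<And>b. b \<in> Basis \<Longrightarrow> l \<bullet> b \<le> u \<bullet> b"
  have le': "l $ i \<le> u $ i" for i using le[of "axis i 1"] by (simp add: inner_axis axis_in_Basis_iff)
  have "(\<lambda>y :: real^'m. \<chi> i. y $ inv e i) -` box l u = box (\<chi> j. l $ e j) (\<chi> j. u $ e j)"
    using e by (auto simp: mem_box_cart) (metis bij_inv_eq_iff)+
  then have "emeasure (distr lborel borel (\<lambda>y :: real^'m. \<chi> i. y $ inv e i)) (box l u) =
      emeasure lborel (box (\<chi> j. l $ e j) (\<chi> j. u $ e j))"
    by (subst emeasure_distr) (auto intro!: measurable_vec_lambda borel_measurable_continuous_onI continuous_intros)
  also have "\<dots> = (\<Prod>j\<in>UNIV. u $ e j - l $ e j)"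
  proof (subst emeasure_lborel_box)
    fix b :: "real^'m" assume "b \<in> Basis"
    then obtain j where "b = axis j 1" by (auto simp: Basis_vec_def)
    then show "(\<chi> j. l $ e j) \<bullet> b \<le> (\<chi> j. u $ e j) \<bullet> b"
      using le' by (simp add: inner_axis)
  qed (simp add: prod_Basis_vec inner_axis)
  also have "\<dots> = (\<Prod>i\<in>UNIV. u $ i - l $ i)"
    using prod.reindex_bij_betw[OF e, of "\<lambda>i. u $ i - l $ i"] by simp
  finally show "emeasure (distr lborel borel (\<lambda>y :: real^'m. \<chi> i. y $ inv e i)) (box l u) = (\<Prod>b\<in>Basis. (u - l) \<bullet> b)"
    by (simp add: prod_Basis_vec inner_axis)
qed simp

text \<open>Conjugation with the coordinate bijections \<open>P\<close> and \<open>Q\<close>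
  transports the statement to the index type \<open>'n ix\<close>. It preserves Lebesgue measure by
  \<open>lborel_distr_reindex\<close> and the Jacobian determinant by
  \<open>det_reindex\<close>.\<close>

lemma nn_integral_change_of_variables:
  fixes f :: "real^'n \<Rightarrow> real" and g :: "real^'n \<Rightarrow> real^'n"
  assumes S: "S \<in> sets borel" and gS: "g ` S \<in> sets borel"
    and der: "\<And>x. x \<in> S \<Longrightarrow> (g has_derivative g' x) (at x within S)"
    and inj: "inj_on g S"
    and f: "(\<lambda>y. indicator (g ` S) y * f y) \<in> borel_measurable borel" "\<And>y. y \<in> g ` S \<Longrightarrow> 0 \<le> f y"
    and fg: "(\<lambda>x. indicator S x * (\<bar>det (matrix (g' x))\<bar> * f (g x))) \<in> borel_measurable borel"
  shows "(\<integral>\<^sup>+y. ennreal (indicator (g ` S) y * f y) \<partial>lborel) =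
    (\<integral>\<^sup>+x. ennreal (indicator S x * (\<bar>det (matrix (g' x))\<bar> * f (g x))) \<partial>lborel)"
proof -
  obtain e :: "'n ix \<Rightarrow> 'n" where e: "bij e" using ex_bij_ix by blast
  define P where "P = (\<lambda>x :: real^'n. \<chi> j. x $ e j)"
  define Q where "Q = (\<lambda>y :: real^'n ix. \<chi> i. y $ inv e i)"
  have QP [simp]: "Q (P x) = x" and PQ [simp]: "P (Q y) = y" for x y
    using e by (simp_all add: P_def Q_def vec_eq_iff inv_f_f bij_is_inj surj_f_inv_f bij_is_surj)
  have lin: "bounded_linear P" "bounded_linear Q"
    unfolding linear_conv_bounded_linear[symmetric] by (auto intro!: linearI simp: P_def Q_def vec_eq_iff)
  have Qm [measurable]: "Q \<in> borel_measurable borel"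
    using lin(2) by (intro borel_measurable_continuous_onI linear_continuous_on)
  have image: "P ` T = Q -` T" for T
    by (auto simp: image_iff) (metis PQ)
  have Q_axis: "Q (axis j 1) = axis (e j) 1" for j
  proof -
    have "inv e i = j \<longleftrightarrow> i = e j" for i using e by (metis bij_inv_eq_iff)
    then show ?thesis by (simp add: Q_def vec_eq_iff axis_def)
  qed
  have lborel_Q: "(\<integral>\<^sup>+x. h x \<partial>lborel) = (\<integral>\<^sup>+y. h (Q y) \<partial>lborel)"
    if [measurable]: "h \<in> borel_measurable borel" for h
    by (subst lborel_distr_reindex[OF e]) (simp add: nn_integral_distr Q_def[symmetric])
  let ?S = "P ` S" and ?g = "\<lambda>y. P (g (Q y))" and ?g' = "\<lambda>y v. P (g' (Q y) (Q v))"
  have gS': "?g ` ?S = P ` (g ` S)" by (auto simp: image_image)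
  have mat: "det (matrix (?g' y)) = det (matrix (g' (Q y)))" for y
  proof -
    have "matrix (?g' y) = (\<chi> i j. matrix (g' (Q y)) $ e i $ e j)"
      by (simp add: matrix_def vec_eq_iff Q_axis P_def)
    then show ?thesis by (simp add: det_reindex[OF e])
  qed
  have ind: "indicator ?S y = (indicator S (Q y) :: real)"
    "indicator (?g ` ?S) y = (indicator (g ` S) (Q y) :: real)" for y
    by (subst image, simp split: split_indicator) (subst gS', subst image, simp split: split_indicator)
  have "(\<integral>\<^sup>+y. ennreal (indicator (?g ` ?S) y * f (Q y)) \<partial>lborel) =
    (\<integral>\<^sup>+x. ennreal (indicator ?S x * (\<bar>det (matrix (?g' x))\<bar> * f (Q (?g x)))) \<partial>lborel)"
  proof (rule nn_integral_change_of_variables_wellorder)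
    show "?S \<in> sets borel"
      using measurable_sets[OF Qm S] by (simp add: image)
    show "?g ` ?S \<in> sets borel"
      unfolding gS' image[of "g ` S"] using measurable_sets[OF Qm gS] by simp
    show "(?g has_derivative ?g' y) (at y within ?S)" if "y \<in> ?S" for y
    proof -
      have "(g has_derivative g' (Q y)) (at (Q y) within Q ` ?S)"
        using der[of "Q y"] that by (auto simp: image_image)
      from has_derivative_in_compose[OF bounded_linear_imp_has_derivative[OF lin(2)] this]
      show ?thesis by (rule bounded_linear.has_derivative[OF lin(1)])
    qed
    show "inj_on ?g ?S"
    proof (rule inj_onI)
      fix x y assume "x \<in> ?S" "y \<in> ?S" "?g x = ?g y"
      then have "g (Q x) = g (Q y)" "Q x \<in> S" "Q y \<in> S" using QP by (metis, auto)
      then have "Q x = Q y" using inj by (auto dest: inj_onD)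
      then show "x = y" by (metis PQ)
    qed
    show "0 \<le> f (Q y)" if "y \<in> ?g ` ?S" for y
      using that f(2) by auto
    show "(\<lambda>y. indicator (?g ` ?S) y * f (Q y)) \<in> borel_measurable borel"
      using measurable_compose[OF Qm f(1)] by (simp add: ind(2))
    show "(\<lambda>x. indicator ?S x * (\<bar>det (matrix (?g' x))\<bar> * f (Q (?g x)))) \<in> borel_measurable borel"
      using measurable_compose[OF Qm fg] by (simp add: ind(1) mat)
  qed
  then show ?thesis
    using f(1) fg by (simp add: ind mat lborel_Q)
qed

text \<open>The linear map is the derivative of a map of the hyperplane after thickening:
  \<open>A\<close> compressed to the hyperplane, and the identity in direction
  \<open>k\<close>.\<close>

lemma matrix_flat:
  fixes A :: "real^'n \<Rightarrow> real^'n"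
  assumes A: "linear A"
  shows "matrix (\<lambda>v. flat k (A (flat k v)) + v $ k *\<^sub>R axis k 1) = delete_rc k (matrix A)"
proof -
  have flat: "flat k (axis k 1) = 0" "j \<noteq> k \<Longrightarrow> flat k (axis j 1) = axis j 1" for j
    by (auto simp: vec_eq_iff flat_nth axis_def)
  have nth: "axis j (1::real) $ i = (if i = j then 1 else 0)" for i j :: 'n
    by (simp add: axis_def)
  have "matrix (\<lambda>v. flat k (A (flat k v)) + v $ k *\<^sub>R axis k 1) $ i $ j = delete_rc k (matrix A) $ i $ j" for i j
    by (cases "j = k") (auto simp: matrix_def delete_rc_def flat flat_nth nth linear_0[OF A])
  then show ?thesis by (simp add: vec_eq_iff)
qed

lemma nn_integral_hyperplane_change_of_variables:
  fixes f :: "real^'n \<Rightarrow> real" and g :: "real^'n \<Rightarrow> real^'n"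
  assumes S: "S \<in> sets borel" "S \<subseteq> {x. x $ k = 0}" and gS: "g ` S \<in> sets borel" "g ` S \<subseteq> {x. x $ k = 0}"
    and der: "\<And>x. x \<in> S \<Longrightarrow> (g has_derivative g' x) (at x within S)"
    and inj: "inj_on g S"
    and f: "(\<lambda>y. indicator (g ` S) y * f y) \<in> borel_measurable borel" "\<And>y. y \<in> g ` S \<Longrightarrow> 0 \<le> f y"
    and fg: "(\<lambda>x. indicator S x * (\<bar>det (delete_rc k (matrix (g' x)))\<bar> * f (g x))) \<in> borel_measurable borel"
  shows "(\<integral>\<^sup>+y. ennreal (indicator (g ` S) y * f y) \<partial>hyperplane_lborel k) =
    (\<integral>\<^sup>+x. ennreal (indicator S x * (\<bar>det (delete_rc k (matrix (g' x)))\<bar> * f (g x))) \<partial>hyperplane_lborel k)"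
proof -
  let ?Z = "{x :: real^'n. x $ k \<in> {0..1}}"
  let ?T = "\<lambda>S. flat k -` S \<inter> ?Z"
  \<comment> \<open>The map \<open>g\<close> acts on the hyperplane part and the \<open>k\<close>-th
    coordinate is kept, so the slab over \<open>S\<close> is mapped bijectively to the slab over its
    image. The values of \<open>g\<close> on \<open>S\<close> are already in the hyperplane; the
    outer \<open>flat k\<close> removes the \<open>k\<close>-component that the derivative within
    \<open>S\<close> may still have.\<close>
  let ?g = "\<lambda>x. flat k (g (flat k x)) + x $ k *\<^sub>R axis k 1"
  let ?g' = "\<lambda>x v. flat k (g' (flat k x) (flat k v)) + v $ k *\<^sub>R axis k 1"
  have lin: "bounded_linear (flat k :: real^'n \<Rightarrow> real^'n)"
    unfolding linear_conv_bounded_linear[symmetric] by (auto intro!: linearI simp: flat_nth vec_eq_iff)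
  have nth: "bounded_linear (\<lambda>x :: real^'n. x $ k)" by (rule bounded_linear_vec_nth)
  have nth_m [measurable]: "(\<lambda>x :: real^'n. x $ k) \<in> borel_measurable borel"
    using nth by (intro borel_measurable_continuous_onI linear_continuous_on)
  have Z: "?Z \<in> sets borel" by measurable
  have flat_id: "flat k y = y" if "y $ k = 0" for y :: "real^'n"
    using that by (auto simp: vec_eq_iff flat_nth)
  have gk: "g x $ k = 0" "x $ k = 0" if "x \<in> S" for x
    using that S gS by auto
  have flat_g: "flat k (?g x) = g (flat k x)" "?g x $ k = x $ k" if "x \<in> ?T S" for x
    using that gk by (auto simp: vec_eq_iff flat_nth axis_def)
  have image: "?g ` ?T S = ?T (g ` S)"
  proof (intro equalityI subsetI)
    fix y assume "y \<in> ?g ` ?T S"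
    then obtain x where x: "x \<in> ?T S" "y = ?g x" by blast
    then show "y \<in> ?T (g ` S)" using flat_g[OF x(1)] by simp
  next
    fix y assume y: "y \<in> ?T (g ` S)"
    then obtain x where x: "x \<in> S" "flat k y = g x" by auto
    let ?x = "x + y $ k *\<^sub>R axis k 1"
    have fx: "flat k ?x = x" "?x $ k = y $ k"
      using gk[OF x(1)] by (auto simp: vec_eq_iff flat_nth axis_def)
    have "flat k (g x) = flat k y" using x gk(1)[OF x(1)] by (simp add: flat_id)
    then have "?g ?x = y"
      unfolding fx using flat_axis[of k y] by simp
    moreover have "?x \<in> ?T S" using x y fx by auto
    ultimately show "y \<in> ?g ` ?T S" by (rule image_eqI[OF sym])
  qed
  have ind: "ennreal (indicator S (flat k x) * h) * indicator ?Z x = ennreal (indicator (?T S) x * h)"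
    for S x h by (auto split: split_indicator)
  have mat: "det (matrix (?g' x)) = det (delete_rc k (matrix (g' (flat k x))))" if "x \<in> ?T S" for x
    using matrix_flat[OF has_derivative_linear[OF der[of "flat k x"]]] that by simp
  have "(\<integral>\<^sup>+y. ennreal (indicator (g ` S) y * f y) \<partial>hyperplane_lborel k) =
      (\<integral>\<^sup>+y. ennreal (indicator (?T (g ` S)) y * f (flat k y)) \<partial>lborel)"
    by (subst nn_integral_hyperplane_thicken[OF measurable_compose[OF f(1) measurable_ennreal]]) (simp only: ind)
  also have "\<dots> = (\<integral>\<^sup>+x. ennreal (indicator (?T S) x * (\<bar>det (matrix (?g' x))\<bar> * f (flat k (?g x)))) \<partial>lborel)"
    unfolding image[symmetric]
  proof (rule nn_integral_change_of_variables)
    show "?T S \<in> sets borel" "?g ` ?T S \<in> sets borel"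
      using measurable_sets[OF flat_measurable[of k] S(1)] measurable_sets[OF flat_measurable[of k] gS(1)] Z
      unfolding image by auto
    show "(?g has_derivative ?g' x) (at x within ?T S)" if x: "x \<in> ?T S" for x
    proof -
      have "(g has_derivative g' (flat k x)) (at (flat k x) within flat k ` ?T S)"
        by (rule has_derivative_subset[OF der]) (use x in auto)
      from has_derivative_in_compose[OF bounded_linear_imp_has_derivative[OF lin] this]
      have "((\<lambda>x. flat k (g (flat k x))) has_derivative (\<lambda>v. flat k (g' (flat k x) (flat k v)))) (at x within ?T S)"
        by (rule bounded_linear.has_derivative[OF lin])
      then show ?thesis
        by (intro has_derivative_add has_derivative_scaleR_left bounded_linear_imp_has_derivative nth)
    qed
    show "inj_on ?g (?T S)"
    proof (rule inj_onI)
      fix x y assume xy: "x \<in> ?T S" "y \<in> ?T S" "?g x = ?g y"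
      have "g (flat k x) = g (flat k y)"
        using flat_g(1)[OF xy(1)] flat_g(1)[OF xy(2)] xy(3) by simp
      have "x $ k = y $ k"
        using flat_g(2)[OF xy(1)] flat_g(2)[OF xy(2)] xy(3) by simp
      have "flat k x = flat k y" by (rule inj_onD[OF inj \<open>g (flat k x) = g (flat k y)\<close>]) (use xy(1,2) in auto)
      then show "x = y" using \<open>x $ k = y $ k\<close> by (metis flat_axis)
    qed
    show "0 \<le> f (flat k y)" if "y \<in> ?g ` ?T S" for y
    proof -
      obtain x where "x \<in> ?T S" "y = ?g x" using \<open>y \<in> ?g ` ?T S\<close> by blast
      then have "flat k y = g (flat k x)" "flat k x \<in> S" using flat_g(1) by simp_all
      then show ?thesis using f(2) by simp
    qed
    have ind': "indicator (?T S) x * h = indicator S (flat k x) * h * indicator ?Z x" for S x and h :: real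
      by (simp split: split_indicator)
    show "(\<lambda>y. indicator (?g ` ?T S) y * f (flat k y)) \<in> borel_measurable borel"
      using measurable_compose[OF flat_measurable[of k] f(1)] Z unfolding image ind' by auto
    have "(\<lambda>x. indicator (?T S) x * (\<bar>det (matrix (?g' x))\<bar> * f (flat k (?g x)))) =
      (\<lambda>x. indicator S (flat k x) * (\<bar>det (delete_rc k (matrix (g' (flat k x))))\<bar> * f (g (flat k x))) * indicator ?Z x)"
      using mat flat_g(1) by (auto simp: fun_eq_iff split: split_indicator)
    then show "(\<lambda>x. indicator (?T S) x * (\<bar>det (matrix (?g' x))\<bar> * f (flat k (?g x)))) \<in> borel_measurable borel"
      using measurable_compose[OF flat_measurable[of k] fg] Z by auto
  qed
  also have "\<dots> = (\<integral>\<^sup>+x. ennreal (indicator (?T S) x *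
      (\<bar>det (delete_rc k (matrix (g' (flat k x))))\<bar> * f (g (flat k x)))) \<partial>lborel)"
    using mat flat_g(1) by (intro nn_integral_cong) (auto split: split_indicator)
  also have "\<dots> = (\<integral>\<^sup>+x. ennreal (indicator S x * (\<bar>det (delete_rc k (matrix (g' x)))\<bar> * f (g x))) \<partial>hyperplane_lborel k)"
    by (subst nn_integral_hyperplane_thicken[OF measurable_compose[OF fg measurable_ennreal]]) (simp only: ind)
  finally show ?thesis .
qed

section \<open>The divergence theorem on the half-space\<close>

lemma partial_zero_outside:
  assumes f: "C1 k (halfspace k) f" and 0: "\<And>x. x \<in> halfspace k \<Longrightarrow> R \<le> norm x \<Longrightarrow> f x = 0"
    and x: "x \<in> halfspace k" "R < norm x"
  shows "partial k i f x = 0"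
proof -
  have "(f has_derivative (\<lambda>v. 0)) (at x within halfspace k)"
  proof (rule has_derivative_agree[OF _ _ _ x(1)])
    show "open {y. R < norm y}" by (intro open_Collect_less continuous_intros)
    show "((\<lambda>x. 0) has_derivative (\<lambda>v. 0)) (at x within halfspace k)" by simp
  qed (use x 0 in auto)
  from partial_eq[OF x(1) this] show ?thesis .
qed

lemma norm_line_ge:
  fixes y :: "real^'n"
  assumes "y $ i = 0" shows "\<bar>t\<bar> \<le> norm (y + t *\<^sub>R axis i 1)"
  using component_le_norm_cart[of "y + t *\<^sub>R axis i 1" i] assms by (simp add: axis_def)

lemma has_vector_derivative_line:
  fixes f :: "real^'n \<Rightarrow> real"
  assumes f: "C1 k (halfspace k) f" and T: "\<And>s. s \<in> T \<Longrightarrow> y + s *\<^sub>R axis i 1 \<in> halfspace k" and t: "t \<in> T"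
  shows "((\<lambda>t. f (y + t *\<^sub>R axis i 1)) has_vector_derivative partial k i f (y + t *\<^sub>R axis i 1)) (at t within T)"
proof -
  let ?l = "\<lambda>t. y + t *\<^sub>R axis i (1::real)"
  have "(f has_derivative (\<lambda>v. \<Sum>j\<in>UNIV. v $ j *\<^sub>R partial k j f (?l t))) (at (?l t) within ?l ` T)"
    by (rule has_derivative_subset[OF C1D(2)[OF f]]) (use T t in auto)
  moreover have "(?l has_derivative (\<lambda>s. s *\<^sub>R axis i 1)) (at t within T)"
    by (auto intro!: derivative_eq_intros)
  ultimately have "((\<lambda>t. f (?l t)) has_derivative
      (\<lambda>s. \<Sum>j\<in>UNIV. (s *\<^sub>R axis i (1::real)) $ j *\<^sub>R partial k j f (?l t))) (at t within T)"
    by (rule has_derivative_in_compose[rotated])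
  moreover have "(\<Sum>j\<in>UNIV. (s *\<^sub>R axis i (1::real)) $ j *\<^sub>R partial k j f (?l t)) = s *\<^sub>R partial k i f (?l t)" for s
    using partial_sum_axis[of i "\<lambda>j. partial k j f (?l t)"] by (simp add: sum_distrib_left[symmetric] mult.assoc)
  ultimately show ?thesis by (simp add: has_vector_derivative_def)
qed

text \<open>The fundamental theorem of calculus on each line in direction \<open>i\<close>, followed
  by Fubini. If \<open>i\<close> differs from \<open>k\<close>, both ends of the line lie outside
  the support; if \<open>i = k\<close>, the lower end lies on the boundary and contributes its value
  with a minus sign.\<close>

lemma integral_partial_halfspace:
  fixes f :: "real^'n \<Rightarrow> real"
  assumes f: "C1 k (halfspace k) f" and R: "0 < R" and 0: "\<And>x. x \<in> halfspace k \<Longrightarrow> R \<le> norm x \<Longrightarrow> f x = 0"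
  shows "integrable lborel (\<lambda>x. indicator (halfspace k) x * partial k i f x)" (is ?A)
    and "(\<integral>x. indicator (halfspace k) x * partial k i f x \<partial>lborel) =
      (if i = k then - (\<integral>y. indicator {y. y $ k = 0} y * f y \<partial>hyperplane_lborel k) else 0)" (is ?B)
proof -
  let ?g = "\<lambda>x. indicator (halfspace k) x * partial k i f x"
  have "integrable lborel (\<lambda>x. indicator (halfspace k \<inter> cball 0 R) x *\<^sub>R partial k i f x)"
    by (intro borel_integrable_compact closed_Int_compact closed_halfspace compact_cball
        continuous_on_subset[OF C1D(3)[OF f]]) auto
  moreover have "(\<lambda>x. indicator (halfspace k \<inter> cball 0 R) x *\<^sub>R partial k i f x) = ?g"
    using partial_zero_outside[OF f 0] by (force simp: fun_eq_iff not_le split: split_indicator)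
  ultimately show A: ?A by simp
  let ?l = "\<lambda>y t. y + t *\<^sub>R axis i (1::real)"
  have line: "(\<integral>t. ?g (?l y t) \<partial>lborel) = - (indicator {y. y $ k = 0} y * f y) * (if i = k then 1 else 0)"
    if y: "y $ i = 0" for y
  proof (cases "y \<in> halfspace k")
    case False
    then have "?l y t \<notin> halfspace k" for t
      using y by (auto simp: halfspace_def axis_def split: if_splits)
    with False show ?thesis by (auto simp: halfspace_def)
  next
    case yH: True
    \<comment> \<open>Since \<open>y\<close> has \<open>i\<close>-th coordinate 0, a line in
      direction \<open>k\<close> enters the half-space at parameter 0. The other lines are cut off
      at \<open>- R\<close>, where \<open>f\<close> vanishes.\<close>
    let ?a = "if i = k then 0 else - R"
    have H: "?l y t \<in> halfspace k \<longleftrightarrow> (i = k \<longrightarrow> 0 \<le> t)" for t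
      using y yH by (auto simp: halfspace_def axis_def)
    have aH: "?l y t \<in> halfspace k" if "t \<in> {?a..R}" for t
      unfolding H using that by (simp split: if_splits)
    have "(\<integral>t. indicator {?a..R} t *\<^sub>R partial k i f (?l y t) \<partial>lborel) = f (?l y R) - f (?l y ?a)"
    proof (rule integral_FTC_Icc)
      show "((\<lambda>t. f (?l y t)) has_vector_derivative partial k i f (?l y t)) (at t within {?a..R})"
        if "?a \<le> t" "t \<le> R" for t
        using that by (intro has_vector_derivative_line[OF f] aH) auto
      show "continuous_on {?a..R} (\<lambda>t. partial k i f (?l y t))"
        by (intro continuous_on_compose2[OF C1D(3)[OF f]] continuous_intros) (use aH in auto)
    qed (use R in auto)
    also have "(\<lambda>t. indicator {?a..R} t *\<^sub>R partial k i f (?l y t)) = (\<lambda>t. ?g (?l y t))"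
    proof
      fix t
      show "indicator {?a..R} t *\<^sub>R partial k i f (?l y t) = ?g (?l y t)"
      proof (cases "\<bar>t\<bar> \<le> R")
        case True then show ?thesis using H[of t] by (auto split: split_indicator)
      next
        case False
        then have "R < norm (?l y t)" using norm_line_ge[OF y, of t] by simp
        then show ?thesis
          using False partial_zero_outside[OF f 0, where x = "?l y t" and i = i] by (auto split: split_indicator)
      qed
    qed
    also have "f (?l y R) = 0"
      using norm_line_ge[OF y, of R] R H[of R] by (intro 0) auto
    also have "f (?l y ?a) = indicator {y. y $ k = 0} y * f y * (if i = k then 1 else 0)"
    proof (cases "i = k")
      case False
      then have "f (?l y ?a) = 0" using norm_line_ge[OF y, of "- R"] R H[of "- R"] by (simp add: 0)
      with False show ?thesis by simp
    qed (use y in simp)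
    finally show ?thesis by simp
  qed
  have [measurable]: "?g \<in> borel_measurable borel" using A by auto
  have "(\<integral>x. ?g x \<partial>lborel) = (\<integral>y. (\<integral>t. ?g (?l y t) \<partial>lborel) \<partial>hyperplane_lborel i)"
    by (rule integral_lborel_slice[OF A])
  also have "\<dots> = (\<integral>y. - (indicator {y. y $ k = 0} y * f y) * (if i = k then 1 else 0) \<partial>hyperplane_lborel i)"
  proof (rule integral_cong_AE)
    show "(\<lambda>y. \<integral>t. ?g (?l y t) \<partial>lborel) \<in> borel_measurable (hyperplane_lborel i)"
      by measurable
    have "continuous_on {y. y $ k = 0} f"
      by (rule continuous_on_subset[OF C1_continuous_on[OF f]]) (auto simp: halfspace_def)
    moreover have "closed {y :: real^'n. y $ k = 0}"
      by (intro closed_Collect_eq continuous_intros)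
    ultimately have "(\<lambda>y. indicator {y. y $ k = 0} y *\<^sub>R f y) \<in> borel_measurable borel"
      by (intro borel_measurable_continuous_on_indicator) auto
    then show "(\<lambda>y. - (indicator {y. y $ k = 0} y * f y) * (if i = k then 1 else 0)) \<in> borel_measurable (hyperplane_lborel i)"
      by simp
    show "AE y in hyperplane_lborel i. (\<integral>t. ?g (?l y t) \<partial>lborel) =
        - (indicator {y. y $ k = 0} y * f y) * (if i = k then 1 else 0)"
      using AE_hyperplane_lborel[of i] by eventually_elim (rule line)
  qed
  finally show ?B by simp
qed

section \<open>Gluing measures\<close>

text \<open>The two measures become equal once they are restricted to \<open>U\<close> by an
  indicator density, and functions vanishing off \<open>U\<close> see no more than these
  restrictions.\<close>

lemma nn_integral_eq_of_agree:
  assumes sets: "sets \<mu> = sets N" "sets \<nu> = sets N" and U: "U \<in> sets N"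
    and eq: "\<And>B. B \<in> sets N \<Longrightarrow> B \<subseteq> U \<Longrightarrow> emeasure \<mu> B = emeasure \<nu> B"
  shows "f \<in> borel_measurable N \<Longrightarrow> (\<And>x. x \<in> space N \<Longrightarrow> x \<notin> U \<Longrightarrow> f x = 0) \<Longrightarrow>
      (\<integral>\<^sup>+x. f x \<partial>\<mu>) = (\<integral>\<^sup>+x. f x \<partial>\<nu>)"
    and "g \<in> borel_measurable N \<Longrightarrow> (\<And>x. x \<in> space N \<Longrightarrow> x \<notin> U \<Longrightarrow> g x = 0) \<Longrightarrow>
      (\<integral>x. g x \<partial>\<mu>) = (\<integral>x. g x \<partial>\<nu> :: real) \<and> integrable \<mu> g = integrable \<nu> g"
proof -
  have space: "space \<mu> = space N" "space \<nu> = space N" using sets_eq_imp_space_eq[OF sets(1)] sets_eq_imp_space_eq[OF sets(2)] by auto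
  have meas: "measurable \<mu> = (measurable N :: 'c measure \<Rightarrow> _)" "measurable \<nu> = (measurable N :: 'c measure \<Rightarrow> _)"
    using sets measurable_cong_sets by blast+
  have D: "density \<mu> (indicator U) = density \<nu> (indicator U)"
  proof (rule measure_eqI)
    fix B assume "B \<in> sets (density \<mu> (indicator U))"
    then have "B \<in> sets N" using sets by simp
    then show "emeasure (density \<mu> (indicator U)) B = emeasure (density \<nu> (indicator U)) B"
      using eq[of "U \<inter> B"] U sets by (simp add: emeasure_density indicator_inter_arith[symmetric] nn_integral_indicator)
  qed (simp add: sets)
  show "(\<integral>\<^sup>+x. f x \<partial>\<mu>) = (\<integral>\<^sup>+x. f x \<partial>\<nu>)"
    if f: "f \<in> borel_measurable N" "\<And>x. x \<in> space N \<Longrightarrow> x \<notin> U \<Longrightarrow> f x = 0"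
  proof -
    have "(\<integral>\<^sup>+x. f x \<partial>\<rho>) = (\<integral>\<^sup>+x. f x \<partial>density \<rho> (indicator U))" if "sets \<rho> = sets N" "space \<rho> = space N" for \<rho>
      using that f U by (subst nn_integral_density)
        (auto simp: measurable_cong_sets[OF that(1) refl] intro!: nn_integral_cong split: split_indicator)
    from this[OF sets(1) space(1)] this[OF sets(2) space(2)] D show ?thesis by simp
  qed
  show "(\<integral>x. g x \<partial>\<mu>) = (\<integral>x. g x \<partial>\<nu> :: real) \<and> integrable \<mu> g = integrable \<nu> g"
    if g: "g \<in> borel_measurable N" "\<And>x. x \<in> space N \<Longrightarrow> x \<notin> U \<Longrightarrow> g x = 0"
  proof -
    have "(\<integral>x. g x \<partial>\<rho>) = (\<integral>x. g x \<partial>density \<rho> (\<lambda>x. ennreal (indicator U x))) \<and>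
        integrable \<rho> g = integrable (density \<rho> (\<lambda>x. ennreal (indicator U x))) g"
      if "sets \<rho> = sets N" "space \<rho> = space N" for \<rho>
    proof -
      have m: "g \<in> borel_measurable \<rho>" "(\<lambda>x. indicator U x :: real) \<in> borel_measurable \<rho>"
        using that g U by (auto simp: measurable_cong_sets[OF that(1) refl])
      have "indicator U x *\<^sub>R g x = g x" if "x \<in> space \<rho>" for x
        using g(2) that \<open>space \<rho> = space N\<close> by (auto split: split_indicator)
      then have "(\<integral>x. g x \<partial>\<rho>) = (\<integral>x. indicator U x *\<^sub>R g x \<partial>\<rho>)"
        "integrable \<rho> g = integrable \<rho> (\<lambda>x. indicator U x *\<^sub>R g x)"
        by (auto intro!: Bochner_Integration.integral_cong Bochner_Integration.integrable_cong simp del: real_scaleR_def)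
      then show ?thesis
        using m by (simp add: integral_density integrable_density)
    qed
    from this[OF sets(1) space(1)] this[OF sets(2) space(2)] D show ?thesis
      by (simp add: ennreal_indicator)
  qed
qed

text \<open>The glued measure is the sum of the measures \<open>w p \<cdot> \<nu> (ch p)\<close>.\<close>

lemma glue_measures:
  fixes N :: "'m measure" and w :: "'p \<Rightarrow> 'm \<Rightarrow> ennreal"
  assumes sets: "\<And>c. c \<in> A \<Longrightarrow> sets (\<nu> c) = sets N" and U: "\<And>c. c \<in> A \<Longrightarrow> U c \<in> sets N"
    and compat: "\<And>c d B. c \<in> A \<Longrightarrow> d \<in> A \<Longrightarrow> B \<in> sets N \<Longrightarrow> B \<subseteq> U c \<Longrightarrow> B \<subseteq> U d \<Longrightarrow> emeasure (\<nu> c) B = emeasure (\<nu> d) B"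
    and P: "finite P" "\<And>p. p \<in> P \<Longrightarrow> ch p \<in> A" "\<And>p. p \<in> P \<Longrightarrow> w p \<in> borel_measurable N"
      "\<And>p x. p \<in> P \<Longrightarrow> x \<in> space N \<Longrightarrow> x \<notin> U (ch p) \<Longrightarrow> w p x = 0"
      "\<And>x. x \<in> space N \<Longrightarrow> (\<Sum>p\<in>P. w p x) = 1"
  shows "\<exists>!\<mu>. sets \<mu> = sets N \<and> (\<forall>c\<in>A. \<forall>B\<in>sets \<mu>. B \<subseteq> U c \<longrightarrow> emeasure \<mu> B = emeasure (\<nu> c) B)"
proof -
  let ?m = "\<lambda>B. \<Sum>p\<in>P. \<integral>\<^sup>+x. w p x * indicator B x \<partial>\<nu> (ch p)"
  have space: "space (\<nu> c) = space N" if "c \<in> A" for c using sets[OF that] sets_eq_imp_space_eq by auto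
  have meas: "f \<in> borel_measurable (\<nu> c)" if "f \<in> borel_measurable N" "c \<in> A" for f :: "'m \<Rightarrow> ennreal" and c
    using that measurable_cong_sets[OF sets refl] by auto
  have total: "emeasure \<rho> B = (\<integral>\<^sup>+x. (\<Sum>p\<in>P. w p x * indicator B x) \<partial>\<rho>)"
    if "space \<rho> = space N" "B \<in> sets \<rho>" for \<rho> B
  proof -
    have "(\<integral>\<^sup>+x. (\<Sum>p\<in>P. w p x * indicator B x) \<partial>\<rho>) = (\<integral>\<^sup>+x. indicator B x \<partial>\<rho>)"
      by (rule nn_integral_cong) (simp add: that P(5) sum_distrib_right[symmetric])
    then show ?thesis using that(2) by simp
  qed
  \<comment> \<open>Splitting 1 into the weights expresses a measure with the required property
    through the local measures alone, which forces its values.\<close>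
  have unique: "emeasure \<mu> B = ?m B"
    if \<mu>: "sets \<mu> = sets N" "\<And>c B. c \<in> A \<Longrightarrow> B \<in> sets N \<Longrightarrow> B \<subseteq> U c \<Longrightarrow> emeasure \<mu> B = emeasure (\<nu> c) B"
      and B: "B \<in> sets N" for \<mu> B
  proof -
    have sp: "space \<mu> = space N" using \<mu>(1) sets_eq_imp_space_eq by auto
    have m\<mu>: "borel_measurable \<mu> = (borel_measurable N :: ('m \<Rightarrow> ennreal) set)"
      by (rule measurable_cong_sets[OF \<mu>(1) refl])
    have "emeasure \<mu> B = (\<integral>\<^sup>+x. (\<Sum>p\<in>P. w p x * indicator B x) \<partial>\<mu>)"
      using B \<mu>(1) sp by (intro total) auto
    also have "\<dots> = (\<Sum>p\<in>P. \<integral>\<^sup>+x. w p x * indicator B x \<partial>\<mu>)"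
      using B P(3) by (intro nn_integral_sum) (auto simp: m\<mu>)
    also have "\<dots> = ?m B"
      using B P(2-4) \<mu> by (intro sum.cong refl nn_integral_eq_of_agree(1)[OF \<mu>(1) sets U]) auto
    finally show ?thesis .
  qed
  have zero: "?m {} = 0" by simp
  let ?\<mu> = "measure_of (space N) (sets N) ?m"
  have em: "emeasure ?\<mu> B = ?m B" if "B \<in> sets N" for B
  proof (rule emeasure_measure_of[OF refl])
    show "positive (sets ?\<mu>) ?m" by (simp add: positive_def)
    show "countably_additive (sets ?\<mu>) ?m"
    proof (rule countably_additiveI)
      fix C :: "nat \<Rightarrow> 'm set" assume C: "range C \<subseteq> sets ?\<mu>" "disjoint_family C"
      then have CN: "C n \<in> sets N" for n by auto
      have "(\<Sum>n. ?m (C n)) = (\<Sum>p\<in>P. \<Sum>n. \<integral>\<^sup>+x. w p x * indicator (C n) x \<partial>\<nu> (ch p))"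
        by (rule suminf_sum) simp
      also have "\<dots> = ?m (\<Union>(range C))"
      proof (intro sum.cong refl)
        fix p assume p: "p \<in> P"
        have "(\<Sum>n. \<integral>\<^sup>+x. w p x * indicator (C n) x \<partial>\<nu> (ch p)) = (\<Sum>n. emeasure (density (\<nu> (ch p)) (w p)) (C n))"
          using p P CN sets by (simp add: emeasure_density meas)
        also have "\<dots> = emeasure (density (\<nu> (ch p)) (w p)) (\<Union>(range C))"
          using p P CN sets C(2) by (intro suminf_emeasure) auto
        also have "\<dots> = (\<integral>\<^sup>+x. w p x * indicator (\<Union>(range C)) x \<partial>\<nu> (ch p))"
          using p P CN sets by (subst emeasure_density) (auto simp: meas)
        finally show "(\<Sum>n. \<integral>\<^sup>+x. w p x * indicator (C n) x \<partial>\<nu> (ch p)) =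
          (\<integral>\<^sup>+x. w p x * indicator (\<Union>(range C)) x \<partial>\<nu> (ch p))" .
      qed
      finally show "(\<Sum>n. ?m (C n)) = ?m (\<Union>(range C))" .
    qed
  qed (use that sets.space_closed[of N] in auto)
  \<comment> \<open>For \<open>B\<close> inside \<open>U c\<close>, the integrand
    \<open>w p * indicator B\<close> lives on an overlap. By \<open>compat\<close>, every local
    measure may there be replaced by \<open>\<nu> c\<close>, after which the weights add up to
    1.\<close>
  have ex: "emeasure ?\<mu> B = emeasure (\<nu> c) B" if c: "c \<in> A" and B: "B \<in> sets N" "B \<subseteq> U c" for c B
  proof -
    have "?m B = (\<Sum>p\<in>P. \<integral>\<^sup>+x. w p x * indicator B x \<partial>\<nu> c)"
    proof (intro sum.cong refl nn_integral_eq_of_agree(1))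
      fix p assume p: "p \<in> P"
      show "sets (\<nu> (ch p)) = sets N" "sets (\<nu> c) = sets N" using p P sets c by auto
      show "U c \<inter> U (ch p) \<in> sets N" using p P U c by auto
      show "emeasure (\<nu> (ch p)) B = emeasure (\<nu> c) B" if "B \<in> sets N" "B \<subseteq> U c \<inter> U (ch p)" for B
        using that p P c by (intro compat) auto
      show "(\<lambda>x. w p x * indicator B x) \<in> borel_measurable N" using p P B by auto
      show "w p x * indicator B x = 0" if "x \<in> space N" "x \<notin> U c \<inter> U (ch p)" for x
        using that p P(4)[OF p] B(2) by (auto split: split_indicator)
    qed
    also have "\<dots> = (\<integral>\<^sup>+x. (\<Sum>p\<in>P. w p x * indicator B x) \<partial>\<nu> c)"
      using P(3) B c by (intro nn_integral_sum[symmetric] meas) auto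
    also have "\<dots> = emeasure (\<nu> c) B"
      using B c sets space by (intro total[symmetric]) auto
    finally show ?thesis using em B by simp
  qed
  show ?thesis
  proof (rule ex1I[of _ ?\<mu>])
    show "sets ?\<mu> = sets N \<and> (\<forall>c\<in>A. \<forall>B\<in>sets ?\<mu>. B \<subseteq> U c \<longrightarrow> emeasure ?\<mu> B = emeasure (\<nu> c) B)"
      using ex by (simp add: sets.sigma_sets_eq sets.space_closed)
    fix \<mu> assume \<mu>: "sets \<mu> = sets N \<and> (\<forall>c\<in>A. \<forall>B\<in>sets \<mu>. B \<subseteq> U c \<longrightarrow> emeasure \<mu> B = emeasure (\<nu> c) B)"
    show "\<mu> = ?\<mu>"
    proof (rule measure_eqI)
      show "sets \<mu> = sets ?\<mu>" using \<mu> by simp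
      fix B assume "B \<in> sets \<mu>"
      then have B: "B \<in> sets N" using \<mu> by simp
      then show "emeasure \<mu> B = emeasure ?\<mu> B" using unique[OF _ _ B, of \<mu>] em[OF B] \<mu> by auto
    qed
  qed
qed

definition chart_measure :: "'a measure \<Rightarrow> 'm measure \<Rightarrow> 'a set \<Rightarrow> ('a \<Rightarrow> 'm) \<Rightarrow> ('a \<Rightarrow> real) \<Rightarrow> 'm measure" where
  "chart_measure L N W \<psi> d = distr (density (restrict_space L W) (\<lambda>x. ennreal (d x))) N \<psi>"

lemma sets_chart_measure [simp]: "sets (chart_measure L N W \<psi> d) = sets N"
  by (simp add: chart_measure_def)

lemma integral_chart_measure:
  assumes W: "W \<in> sets L" and \<psi>: "\<psi> \<in> measurable (restrict_space L W) N"
    and d: "d \<in> borel_measurable (restrict_space L W)"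
  shows "f \<in> borel_measurable N \<Longrightarrow>
      (\<integral>\<^sup>+x. f x \<partial>chart_measure L N W \<psi> d) = (\<integral>\<^sup>+x. ennreal (d x) * f (\<psi> x) * indicator W x \<partial>L)"
    and "g \<in> borel_measurable N \<Longrightarrow> (\<And>x. x \<in> W \<Longrightarrow> 0 \<le> d x) \<Longrightarrow>
      (\<integral>x. g x \<partial>chart_measure L N W \<psi> d) = (\<integral>x. indicator W x * (d x * g (\<psi> x)) \<partial>L) \<and>
      integrable (chart_measure L N W \<psi> d) g = integrable L (\<lambda>x. indicator W x * (d x * g (\<psi> x)))"
proof -
  have W': "W \<inter> space L \<in> sets L" using W by auto
  have sp: "space (restrict_space L W) = W"
    using W by (simp add: space_restrict_space sets.sets_into_space Int_absorb2)
  show "(\<integral>\<^sup>+x. f x \<partial>chart_measure L N W \<psi> d) = (\<integral>\<^sup>+x. ennreal (d x) * f (\<psi> x) * indicator W x \<partial>L)"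
    if "f \<in> borel_measurable N"
  proof -
    have "(\<integral>\<^sup>+x. f x \<partial>chart_measure L N W \<psi> d) = (\<integral>\<^sup>+x. ennreal (d x) * f (\<psi> x) \<partial>restrict_space L W)"
      unfolding chart_measure_def using \<psi> d that measurable_compose[OF \<psi> that]
      by (subst nn_integral_distr) (auto simp: nn_integral_density)
    then show ?thesis using W' by (simp add: nn_integral_restrict_space)
  qed
  show "(\<integral>x. g x \<partial>chart_measure L N W \<psi> d) = (\<integral>x. indicator W x * (d x * g (\<psi> x)) \<partial>L) \<and>
      integrable (chart_measure L N W \<psi> d) g = integrable L (\<lambda>x. indicator W x * (d x * g (\<psi> x)))"
    if "g \<in> borel_measurable N" "\<And>x. x \<in> W \<Longrightarrow> 0 \<le> d x" 
  proof -
    have AE: "AE x in restrict_space L W. 0 \<le> d x"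
      using that(2) sp by (intro AE_I2) auto
    have "(\<integral>x. g x \<partial>chart_measure L N W \<psi> d) = (\<integral>x. d x *\<^sub>R g (\<psi> x) \<partial>restrict_space L W)"
      unfolding chart_measure_def using \<psi> d that measurable_compose[OF \<psi> that(1)]
      by (subst integral_distr) (simp_all add: integral_density AE)
    moreover have "integrable (chart_measure L N W \<psi> d) g = integrable (restrict_space L W) (\<lambda>x. d x *\<^sub>R g (\<psi> x))"
      unfolding chart_measure_def using \<psi> d that measurable_compose[OF \<psi> that(1)]
      by (subst integrable_distr_eq) (simp_all add: integrable_density AE)
    ultimately show ?thesis using W' by (simp add: integral_restrict_space integrable_restrict_space)
  qed
qed

section \<open>Atlases and partitions of unity\<close>

lemma max_0_square_deriv: "((\<lambda>t::real. (max 0 t)\<^sup>2) has_real_derivative 2 * max 0 t) (at t)"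
proof -
  consider "t < 0" | "t = 0" | "0 < t" by linarith
  then show ?thesis
  proof cases
    case 1
    have "((\<lambda>t::real. 0) has_real_derivative 0) (at t)" by simp
    then have "((\<lambda>t::real. (max 0 t)\<^sup>2) has_real_derivative 0) (at t)"
      by (rule has_field_derivative_transform_within_open[where S = "{..<0}"]) (use 1 in auto)
    then show ?thesis using 1 by simp
  next
    case 2
    show ?thesis
      \<comment> \<open>At 0 the difference quotient is \<open>max 0\<close> itself, which is
        continuous.\<close>
      unfolding CARAT_DERIV
      by (rule exI[of _ "max 0"]) (auto simp: 2 power2_eq_square max_def intro!: continuous_intros)
  next
    case 3
    have "((\<lambda>t::real. t\<^sup>2) has_real_derivative 2 * t) (at t)" by (auto intro!: derivative_eq_intros)
    then have "((\<lambda>t::real. (max 0 t)\<^sup>2) has_real_derivative 2 * t) (at t)"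
      by (rule has_field_derivative_transform_within_open[where S = "{0<..}"]) (use 3 in auto)
    then show ?thesis using 3 by simp
  qed
qed

text \<open>For \<open>r\<close> > 0 this function is positive exactly on the open ball of radius
  \<open>r\<close>. Squaring the positive part removes its corner and thereby makes the function
  C1.\<close>

lemma C1_bump:
  fixes x0 :: "real^'n"
  shows "C1 k (halfspace k) (\<lambda>x. (max 0 (r\<^sup>2 - (x - x0) \<bullet> (x - x0)))\<^sup>2)"
proof (rule C1_real_compose[where h = "\<lambda>t. (max 0 t)\<^sup>2"])
  show "C1 k (halfspace k) (\<lambda>x. r\<^sup>2 - (x - x0) \<bullet> (x - x0))"
    by (rule C1I[where f' = "\<lambda>x v. - ((x - x0) \<bullet> v + v \<bullet> (x - x0))"])
      (auto intro!: derivative_eq_intros continuous_intros)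
  show "((\<lambda>t. (max 0 t)\<^sup>2) has_real_derivative 2 * max 0 (r\<^sup>2 - (x - x0) \<bullet> (x - x0))) (at (r\<^sup>2 - (x - x0) \<bullet> (x - x0)))" for x
    by (rule max_0_square_deriv)
  show "continuous_on ((\<lambda>x. r\<^sup>2 - (x - x0) \<bullet> (x - x0)) ` halfspace k) (\<lambda>t. 2 * max 0 t)"
    by (intro continuous_intros)
qed

section \<open>Charts, transition maps and the boundary\<close>

abbreviation chart_image :: "('m, 'n::finite) chart \<Rightarrow> (real^'n) set" where
  "chart_image c \<equiv> snd c ` fst c"

abbreviation chart_inv :: "('m, 'n::finite) chart \<Rightarrow> real^'n \<Rightarrow> 'm" where
  "chart_inv c \<equiv> inv_into (fst c) (snd c)"

definition jacobian :: "'n::finite \<Rightarrow> (real^'n \<Rightarrow> real^'n) \<Rightarrow> real^'n \<Rightarrow> real^'n^'n" where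
  "jacobian k \<tau> x = (\<chi> j i. partial k i \<tau> x $ j)"

definition C1_map :: "'n::finite \<Rightarrow> ('m, 'n) chart set \<Rightarrow> ('m \<Rightarrow> 'b::real_normed_vector) \<Rightarrow> bool" where
  "C1_map k A f \<longleftrightarrow> (\<forall>c\<in>A. C1 k (chart_image c) (local_rep c f))"

locale atlas =
  fixes k :: "'n::finite" and M :: "'m::t2_space set" and A :: "('m, 'n) chart set"
  assumes cm: "compact_manifold k M A"
begin

lemma compact_M: "compact M" and cover: "(\<Union>c\<in>A. fst c) = M"
  using cm by (auto simp: compact_manifold_def)

lemma chart:
  assumes "c \<in> A"
  shows "openin (top_of_set M) (fst c)" "openin (top_of_set (halfspace k)) (chart_image c)"
    "homeomorphism (fst c) (chart_image c) (snd c) (chart_inv c)"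
  using cm assms by (simp_all add: compact_manifold_def case_prod_beta)

lemma chart_inv [simp]: "c \<in> A \<Longrightarrow> p \<in> fst c \<Longrightarrow> chart_inv c (snd c p) = p"
  "c \<in> A \<Longrightarrow> x \<in> chart_image c \<Longrightarrow> snd c (chart_inv c x) = x"
  "c \<in> A \<Longrightarrow> x \<in> chart_image c \<Longrightarrow> chart_inv c x \<in> fst c"
  using chart(3)[of c] by (auto simp: homeomorphism_def)

lemma chart_subset: "c \<in> A \<Longrightarrow> fst c \<subseteq> M" "c \<in> A \<Longrightarrow> chart_image c \<subseteq> halfspace k"
  using chart[of c] by (auto dest: openin_imp_subset)

lemma openin_overlap:
  assumes "c \<in> A" "openin (top_of_set M) V"
  shows "openin (top_of_set (halfspace k)) (snd c ` (fst c \<inter> V))"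
proof -
  have "openin (top_of_set (fst c)) (fst c \<inter> V)"
    using assms chart_subset(1)[OF assms(1)] by (auto simp: openin_open)
  then have "openin (top_of_set (chart_image c)) (snd c ` (fst c \<inter> V))"
    using homeomorphism_imp_open_map[OF chart(3)[OF assms(1)]] by blast
  then show ?thesis using chart(2)[OF assms(1)] openin_trans by blast
qed

lemma overlap_mem:
  assumes "c \<in> A" shows "x \<in> snd c ` (fst c \<inter> V) \<longleftrightarrow> x \<in> chart_image c \<and> chart_inv c x \<in> V"
  using chart_inv(2,3)[OF assms, of x] chart_inv(1)[OF assms]
  by (auto intro!: image_eqI[of x "snd c" "chart_inv c x"])

abbreviation trans :: "('m, 'n) chart \<Rightarrow> ('m, 'n) chart \<Rightarrow> real^'n \<Rightarrow> real^'n" where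
  "trans c d \<equiv> local_rep c (snd d)"

lemma C1_trans:
  assumes "c \<in> A" "d \<in> A"
  shows "C1 k (snd c ` (fst c \<inter> fst d)) (trans c d)"
proof (rule smooth_on_C2(1)[OF openin_overlap[OF assms(1) chart(1)[OF assms(2)]]])
  have "smooth_on (snd c ` (fst c \<inter> fst d)) (snd d \<circ> chart_inv c)"
    using cm assms by (fastforce simp: compact_manifold_def)
  then show "smooth_on (snd c ` (fst c \<inter> fst d)) (trans c d)"
    by (simp add: local_rep_def o_def)
qed

lemma trans_image:
  assumes "c \<in> A" "d \<in> A" "x \<in> snd c ` (fst c \<inter> fst d)"
  shows "trans c d x \<in> snd d ` (fst c \<inter> fst d)" "trans d c (trans c d x) = x"
    "chart_inv d (trans c d x) = chart_inv c x"
  using assms by (auto simp: local_rep_def)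

lemma local_rep_trans:
  assumes "c \<in> A" "d \<in> A" "x \<in> snd c ` (fst c \<inter> fst d)"
  shows "local_rep c F x = local_rep d F (trans c d x)"
  using trans_image[OF assms] by (simp add: local_rep_def)

lemma partial_local_rep_trans:
  assumes cd: "c \<in> A" "d \<in> A" and x: "x \<in> snd c ` (fst c \<inter> fst d)"
    and F: "C1 k (snd d ` (fst c \<inter> fst d)) (local_rep d F)"
  shows "partial k i (local_rep c F) x = (\<Sum>j\<in>UNIV. jacobian k (trans c d) x $ j $ i *\<^sub>R partial k j (local_rep d F) (trans c d x))"
proof -
  have W: "openin (top_of_set (halfspace k)) (snd c ` (fst c \<inter> fst d))"
    by (intro openin_overlap chart cd)
  have im: "trans c d ` (snd c ` (fst c \<inter> fst d)) \<subseteq> snd d ` (fst c \<inter> fst d)"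
    using trans_image(1)[OF cd] by auto
  note comp = C1_compose[OF W C1_trans[OF cd] im F]
  have "partial k i (local_rep c F) x = partial k i (\<lambda>x. local_rep d F (trans c d x)) x"
    using comp(1) x local_rep_trans[OF cd] by (intro partial_cong[OF W x]) (auto simp: C1_def)
  then show ?thesis using comp(2)[OF x] by (simp add: jacobian_def)
qed

text \<open>In the chart \<open>c\<close> its own coordinate map is the identity. Computing its
  partial derivatives through \<open>d\<close> yields the product of the two Jacobians.\<close>

lemma jacobian_inverse:
  assumes cd: "c \<in> A" "d \<in> A" and x: "x \<in> snd c ` (fst c \<inter> fst d)"
  shows "jacobian k (trans d c) (trans c d x) ** jacobian k (trans c d) x = mat 1"
proof -
  have xH: "x \<in> halfspace k" using x chart_subset(2)[OF cd(1)] by auto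
  have W: "openin (top_of_set (halfspace k)) (snd c ` (fst c \<inter> fst d))"
    by (intro openin_overlap chart cd)
  have id: "((\<lambda>x. x) has_derivative (\<lambda>v. v)) (at x within halfspace k)" by simp
  have C: "C1 k (snd d ` (fst c \<inter> fst d)) (local_rep d (snd c))"
    using C1_trans[OF cd(2,1)] by (simp add: Int_commute)
  have "axis i 1 = (\<Sum>j\<in>UNIV. jacobian k (trans c d) x $ j $ i *\<^sub>R partial k j (trans d c) (trans c d x))" for i
  proof -
    have "axis i 1 = partial k i (\<lambda>x. x) x"
      using partial_eq[OF xH id] by simp
    also have "\<dots> = partial k i (local_rep c (snd c)) x"
      using id by (intro partial_cong[OF W x, symmetric]) (auto simp: local_rep_def differentiable_def cd)
    also have "\<dots> = (\<Sum>j\<in>UNIV. jacobian k (trans c d) x $ j $ i *\<^sub>R partial k j (trans d c) (trans c d x))"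
      by (rule partial_local_rep_trans[OF cd x C])
    finally show ?thesis .
  qed
  then have "axis i 1 $ l = (\<Sum>j\<in>UNIV. jacobian k (trans c d) x $ j $ i * partial k j (trans d c) (trans c d x) $ l)" for i l
    by (simp add: sum_component)
  note * = this
  have "(\<Sum>j\<in>UNIV. jacobian k (trans c d) x $ j $ i * partial k j (trans d c) (trans c d x) $ l) =
      (if l = i then 1 else 0)" for i l
  proof -
    have "axis i (1::real) $ l = (if l = i then 1 else 0)" by (simp add: axis_def)
    with *[of i l] show ?thesis by simp
  qed
  then show ?thesis
    by (simp add: vec_eq_iff matrix_matrix_mult_def mat_def jacobian_def mult.commute)
qed

lemma jacobian_det_nz:
  assumes "c \<in> A" "d \<in> A" "x \<in> snd c ` (fst c \<inter> fst d)"
  shows "det (jacobian k (trans c d) x) \<noteq> 0"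
  using arg_cong[OF jacobian_inverse[OF assms], of det] by (auto simp: det_mul)

text \<open>At a point with positive \<open>k\<close>-th coordinate, a transition map into the boundary hyperplane
  would have a minimum of its \<open>k\<close>-th component, and hence a singular Jacobian.\<close>

lemma boundary_invariant:
  assumes cd: "c \<in> A" "d \<in> A" and x: "x \<in> snd c ` (fst c \<inter> fst d)" and 0: "trans c d x $ k = 0"
  shows "x $ k = 0"
proof (rule ccontr)
  assume nz: "x $ k \<noteq> 0"
  have xH: "x \<in> halfspace k" using x chart_subset(2)[OF cd(1)] by auto
  with nz have pos: "0 < x $ k" by (simp add: halfspace_def)
  have W: "openin (top_of_set (halfspace k)) (snd c ` (fst c \<inter> fst d))"
    by (intro openin_overlap chart cd)
  then obtain T where T: "open T" "snd c ` (fst c \<inter> fst d) = halfspace k \<inter> T" by (auto simp: openin_open)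
  let ?S = "{y :: real^'n. 0 < y $ k}"
  have S: "open ?S" by (intro open_Collect_less continuous_intros)
  have at: "at x within halfspace k = at x"
    by (rule at_within_interior) (use interior_maximal[of ?S "halfspace k"] S pos in \<open>auto simp: halfspace_def\<close>)
  have der: "(trans c d has_derivative (\<lambda>v. \<Sum>i\<in>UNIV. v $ i *\<^sub>R partial k i (trans c d) x)) (at x)"
    using C1D(2)[OF C1_trans[OF cd] x] unfolding at .
  then have "((\<lambda>y. trans c d y $ k) has_derivative (\<lambda>v. (\<Sum>i\<in>UNIV. v $ i *\<^sub>R partial k i (trans c d) x) $ k)) (at x)"
    by (rule bounded_linear.has_derivative[OF bounded_linear_vec_nth])
  moreover obtain e where "0 < e" "ball x e \<subseteq> T \<inter> ?S"
    using openE[OF open_Int[OF T(1) S], of x] x T(2) pos by auto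
  moreover then have "trans c d x $ k \<le> trans c d y $ k" if "y \<in> ball x e" for y
  proof -
    have "y \<in> snd c ` (fst c \<inter> fst d)"
      using that \<open>ball x e \<subseteq> T \<inter> ?S\<close> T(2) by (auto simp: halfspace_def)
    then have "trans c d y \<in> halfspace k"
      using trans_image(1)[OF cd] chart_subset(2)[OF cd(2)] by blast
    then show ?thesis using 0 by (simp add: halfspace_def)
  qed
  ultimately have "(\<lambda>v. (\<Sum>i\<in>UNIV. v $ i *\<^sub>R partial k i (trans c d) x) $ k) = (\<lambda>v. 0)"
    by (intro has_derivative_local_min)
      (auto simp: eventually_at dist_commute intro!: exI[of _ e] simp del: sum_component)
  then have "(\<Sum>j\<in>UNIV. axis i 1 $ j *\<^sub>R partial k j (trans c d) x) $ k = 0" for i by meson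
  then have "jacobian k (trans c d) x $ k = 0"
    by (simp add: partial_sum_axis jacobian_def vec_eq_iff)
  then have "det (jacobian k (trans c d) x) = 0"
    using det_zero_row[of k "jacobian k (trans c d) x"] by (simp add: row_def vec_eq_iff)
  with jacobian_det_nz[OF cd x] show False by simp
qed

text \<open>The definition of \<open>boundary\<close> asks for some chart; by
  \<open>boundary_invariant\<close>, any chart around \<open>p\<close> decides.\<close>

lemma boundary_chart:
  assumes c: "c \<in> A" and p: "p \<in> fst c"
  shows "p \<in> boundary k A \<longleftrightarrow> snd c p $ k = 0"
proof
  assume "p \<in> boundary k A"
  then obtain d where d: "d \<in> A" "p \<in> fst d" "snd d p $ k = 0" by (auto simp: boundary_def)
  show "snd c p $ k = 0"
    by (rule boundary_invariant[OF c d(1), of "snd c p"]) (use p d c in \<open>auto simp: local_rep_def\<close>)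
qed (use assms in \<open>auto simp: boundary_def\<close>)

lemma boundary_subset: "boundary k A \<subseteq> M"
  using cover by (auto simp: boundary_def)

lemma closed_boundary: "closed (boundary k A)"
proof -
  have "openin (top_of_set M) (M - boundary k A)"
  proof (subst openin_subopen, intro ballI)
    fix p assume p: "p \<in> M - boundary k A"
    then obtain c where c: "c \<in> A" "p \<in> fst c" using cover by auto
    let ?V = "fst c \<inter> snd c -` {x. x $ k \<noteq> 0}"
    have "continuous_on (fst c) (snd c)" using chart(3)[OF c(1)] by (simp add: homeomorphism_def)
    moreover have "open {x :: real^'n. x $ k \<noteq> 0}"
      by (intro open_Collect_neq continuous_intros)
    ultimately have "openin (top_of_set (fst c)) ?V"
      by (rule continuous_openin_preimage_gen)
    then have "openin (top_of_set M) ?V" using chart(1)[OF c(1)] openin_trans by blast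
    then show "\<exists>T. openin (top_of_set M) T \<and> p \<in> T \<and> T \<subseteq> M - boundary k A"
      using p c boundary_chart[OF c(1)] chart_subset(1)[OF c(1)] by (intro exI[of _ ?V]) auto
  qed
  then have "closedin (top_of_set M) (boundary k A)"
    using boundary_subset by (simp add: closedin_def)
  then show ?thesis
    using compact_imp_closed[OF compact_M] closedin_closed_trans by blast
qed

section \<open>C1 functions on the manifold and partitions of unity\<close>

lemma C1_mapD: "C1_map k A f \<Longrightarrow> c \<in> A \<Longrightarrow> C1 k (chart_image c) (local_rep c f)"
  by (simp add: C1_map_def)

lemma continuous_map_chart:
  assumes f: "C1_map k A f" and c: "c \<in> A"
  shows "continuous_on (fst c) f"
proof -
  have "continuous_on (fst c) (\<lambda>q. local_rep c f (snd c q))"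
    by (rule continuous_on_compose2[OF C1_continuous_on[OF C1_mapD[OF f c]]
          homeomorphism_cont1[OF chart(3)[OF c]] order_refl])
  then show ?thesis
    by (rule continuous_on_eq) (simp add: local_rep_def c)
qed

lemma C1_map_sum: "(\<And>s. s \<in> S \<Longrightarrow> C1_map k A (f s)) \<Longrightarrow> C1_map k A (\<lambda>p. \<Sum>s\<in>S. f s p)"
  unfolding C1_map_def local_rep_def by (auto intro!: C1_sum chart_subset(2)[THEN subsetD])

text \<open>Turns a function of the coordinates of one chart into a global one. Another chart sees
  it through the transition map near points of \<open>fst c\<close>, and near all other points the
  closed set \<open>K\<close> is avoided and the function is 0.\<close>

lemma C1_map_extend:
  assumes c: "c \<in> A" and f: "C1 k (chart_image c) f" and K: "closed K" "K \<subseteq> fst c"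
    and 0: "\<And>p. p \<in> fst c \<Longrightarrow> p \<notin> K \<Longrightarrow> f (snd c p) = 0"
  shows "C1_map k A (\<lambda>p. if p \<in> fst c then f (snd c p) else 0)"
  unfolding C1_map_def
proof
  let ?w = "\<lambda>p. if p \<in> fst c then f (snd c p) else 0"
  fix d assume d: "d \<in> A"
  show "C1 k (chart_image d) (local_rep d ?w)"
  proof (rule C1_local[OF chart_subset(2)[OF d]])
    fix x assume x: "x \<in> chart_image d"
    show "\<exists>U g. open U \<and> x \<in> U \<and> C1 k (U \<inter> halfspace k) g \<and> (\<forall>y\<in>U \<inter> halfspace k. local_rep d ?w y = g y)"
    proof (cases "chart_inv d x \<in> fst c")
      case True
      have W: "openin (top_of_set (halfspace k)) (snd d ` (fst d \<inter> fst c))"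
        by (intro openin_overlap chart c d)
      then obtain T where T: "open T" "snd d ` (fst d \<inter> fst c) = halfspace k \<inter> T" by (auto simp: openin_open)
      have "C1 k (snd d ` (fst d \<inter> fst c)) (\<lambda>x. f (trans d c x))"
        by (rule C1_compose(1)[OF W C1_trans[OF d c] _ f]) (use trans_image(1)[OF d c] in auto)
      moreover have "local_rep d ?w y = f (trans d c y)" if "y \<in> snd d ` (fst d \<inter> fst c)" for y
        using that d by (auto simp: local_rep_def)
      moreover have "x \<in> snd d ` (fst d \<inter> fst c)" using True x overlap_mem[OF d] by blast
      ultimately show ?thesis
        using T by (intro exI[of _ T] exI[of _ "\<lambda>x. f (trans d c x)"]) (auto simp: Int_commute)
    next
      case False
      have "openin (top_of_set M) (M - K)"
        using K(1) by (auto simp: openin_open intro!: exI[of _ "- K"])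
      then have W: "openin (top_of_set (halfspace k)) (snd d ` (fst d \<inter> (M - K)))"
        by (intro openin_overlap d)
      then obtain T where T: "open T" "snd d ` (fst d \<inter> (M - K)) = halfspace k \<inter> T" by (auto simp: openin_open)
      have "local_rep d ?w y = 0" if "y \<in> snd d ` (fst d \<inter> (M - K))" for y
        using that d 0 by (auto simp: local_rep_def)
      moreover have "x \<in> snd d ` (fst d \<inter> (M - K))"
        using False x K(2) overlap_mem[OF d] chart_subset(1)[OF d] chart_inv(3)[OF d x] by blast
      ultimately show ?thesis
        using T by (intro exI[of _ T] exI[of _ "\<lambda>x. 0"]) (auto intro!: C1_const)
    qed
  qed
qed

lemma bump:
  assumes p: "p \<in> M"
  obtains c w K where "c \<in> A" "compact K" "K \<subseteq> fst c" "C1_map k A w" "0 < w p"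
    "\<And>q. 0 \<le> w q" "\<And>q. q \<notin> K \<Longrightarrow> w q = (0::real)"
proof -
  obtain c where c: "c \<in> A" "p \<in> fst c" using p cover by auto
  obtain T where T: "open T" "chart_image c = halfspace k \<inter> T"
    using chart(2)[OF c(1)] by (auto simp: openin_open)
  let ?x = "snd c p"
  have "?x \<in> T" using c T by blast
  then obtain r where r: "0 < r" "cball ?x r \<subseteq> T" using T(1) open_contains_cball by blast
  let ?f = "\<lambda>x. (max 0 (r\<^sup>2 - (x - ?x) \<bullet> (x - ?x)))\<^sup>2"
  let ?w = "\<lambda>q. if q \<in> fst c then ?f (snd c q) else 0"
  \<comment> \<open>The ball may stick out of the half-space, but its trace is compact and contained
    in the chart image. Its preimage is a compact set that contains the support of the bump.\<close>
  let ?B = "halfspace k \<inter> cball ?x r"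
  let ?K = "chart_inv c ` ?B"
  have B: "?B \<subseteq> chart_image c" using r T by auto
  have K: "compact ?K"
    using B chart(3)[OF c(1)] closed_halfspace[of k]
    by (intro compact_continuous_image closed_Int_compact) (auto simp: homeomorphism_def intro: continuous_on_subset)
  have Kc: "?K \<subseteq> fst c" using B chart_inv(3)[OF c(1)] by blast
  have 0: "?f (snd c q) = 0" if q: "q \<in> fst c" "q \<notin> ?K" for q
  proof -
    have "snd c q \<notin> ?B" using q chart_inv(1)[OF c(1) q(1)] by (metis imageI)
    then have "r < norm (snd c q - ?x)"
      using q c chart_subset(2)[OF c(1)] by (auto simp: dist_norm norm_minus_commute)
    then have "r\<^sup>2 \<le> (snd c q - ?x) \<bullet> (snd c q - ?x)"
      using r by (simp add: power2_norm_eq_inner[symmetric] power_mono)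
    then show ?thesis by simp
  qed
  show thesis
  proof (rule that[OF c(1) K Kc])
    show "C1_map k A ?w"
      by (rule C1_map_extend[OF c(1) C1_subset[OF C1_bump chart_subset(2)[OF c(1)]] compact_imp_closed[OF K] Kc 0])
    show "0 < ?w p" using c r by simp
    show "?w q = 0" if "q \<notin> ?K" for q using 0[OF _ that] by simp
  qed auto
qed

text \<open>The indices are finitely many points of the manifold, each carrying a chart around it.
  The compact sets \<open>K p\<close> inside single chart domains are what later makes the chart
  integrals finite and allows extension by zero.\<close>

lemma partition_of_unity:
  obtains P :: "'m set" and ch :: "'m \<Rightarrow> ('m, 'n) chart" and w :: "'m \<Rightarrow> 'm \<Rightarrow> real" and K :: "'m \<Rightarrow> 'm set"
  where "finite P" "\<And>p. p \<in> P \<Longrightarrow> ch p \<in> A" "\<And>p. p \<in> P \<Longrightarrow> compact (K p)" "\<And>p. p \<in> P \<Longrightarrow> K p \<subseteq> fst (ch p)"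
    "\<And>p. p \<in> P \<Longrightarrow> C1_map k A (w p)" "\<And>p q. p \<in> P \<Longrightarrow> 0 \<le> w p q" "\<And>p q. p \<in> P \<Longrightarrow> q \<notin> K p \<Longrightarrow> w p q = 0"
    "\<And>q. q \<in> M \<Longrightarrow> (\<Sum>p\<in>P. w p q) = 1"
proof -
  \<comment> \<open>A single predicate lets chart, weight and support be chosen together, one after
    the other, for every point.\<close>
  define Q where "Q p c w K \<longleftrightarrow> c \<in> A \<and> compact K \<and> K \<subseteq> fst c \<and> C1_map k A w \<and> 0 < w p \<and>
    (\<forall>q. 0 \<le> w q) \<and> (\<forall>q. q \<notin> K \<longrightarrow> w q = (0::real))" for p c w K
  have "\<forall>p\<in>M. \<exists>c w K. Q p c w K"
  proof
    fix p assume "p \<in> M"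
    then show "\<exists>c w K. Q p c w K"
    proof (rule bump)
      fix c w K
      assume "c \<in> A" "compact K" "K \<subseteq> fst c" "C1_map k A w" "0 < w p"
        "\<And>q. 0 \<le> w q" "\<And>q. q \<notin> K \<Longrightarrow> w q = (0::real)"
      then have "Q p c w K" unfolding Q_def by simp
      then show ?thesis by (intro exI)
    qed
  qed
  then obtain ch where "\<forall>p\<in>M. \<exists>w K. Q p (ch p) w K" by (rule bchoice[THEN exE])
  then obtain v where "\<forall>p\<in>M. \<exists>K. Q p (ch p) (v p) K" by (rule bchoice[THEN exE])
  then obtain K where "\<forall>p\<in>M. Q p (ch p) (v p) (K p)" by (rule bchoice[THEN exE])
  then have Q: "\<And>p. p \<in> M \<Longrightarrow> Q p (ch p) (v p) (K p)" by blast
  have b: "\<And>p. p \<in> M \<Longrightarrow> ch p \<in> A" "\<And>p. p \<in> M \<Longrightarrow> compact (K p)"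
    "\<And>p. p \<in> M \<Longrightarrow> K p \<subseteq> fst (ch p)" "\<And>p. p \<in> M \<Longrightarrow> C1_map k A (v p)" "\<And>p. p \<in> M \<Longrightarrow> 0 < v p p"
    "\<And>p q. p \<in> M \<Longrightarrow> 0 \<le> v p q" "\<And>p q. p \<in> M \<Longrightarrow> q \<notin> K p \<Longrightarrow> v p q = (0::real)"
    by (auto dest!: Q simp: Q_def)
  have "openin (top_of_set M) {q \<in> fst (ch p). 0 < v p q}" if p: "p \<in> M" for p
  proof -
    have "openin (top_of_set (fst (ch p))) (fst (ch p) \<inter> v p -` {0<..})"
      by (intro continuous_openin_preimage_gen continuous_map_chart b p) auto
    moreover have "fst (ch p) \<inter> v p -` {0<..} = {q \<in> fst (ch p). 0 < v p q}" by auto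
    ultimately show ?thesis using chart(1)[OF b(1)[OF p]] openin_trans by metis
  qed
  then obtain G where G: "\<And>p. p \<in> M \<Longrightarrow> open (G p)" "\<And>p. p \<in> M \<Longrightarrow> {q \<in> fst (ch p). 0 < v p q} = M \<inter> G p"
    unfolding openin_open by metis
  have "p \<in> G p" if "p \<in> M" for p
  proof -
    have "p \<in> K p" using b(5,7)[OF that] by (metis less_irrefl)
    then show ?thesis using G(2)[OF that] b(3,5)[OF that] that by auto
  qed
  then have "M \<subseteq> (\<Union>p\<in>M. G p)" by auto
  then obtain P where P: "P \<subseteq> M" "finite P" "M \<subseteq> (\<Union>p\<in>P. G p)"
    using compactE_image[OF compact_M, of M G] G(1) by metis
  \<comment> \<open>The sum of the bumps selected by compactness is positive on all of
    \<open>M\<close>; division by it normalises them.\<close>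
  define S where "S q = (\<Sum>p\<in>P. v p q)" for q
  have S: "0 < S q" if q: "q \<in> M" for q
  proof -
    obtain p where p: "p \<in> P" "q \<in> G p" using P(3) q by auto
    then have "0 < v p q" using G(2)[of p] P(1) q by auto
    then show ?thesis
      unfolding S_def using p P b(6) by (intro sum_pos2[of P p]) auto
  qed
  have "C1_map k A S" unfolding S_def using P b(4) by (intro C1_map_sum) auto
  then have Sinv: "C1 k (chart_image c) (\<lambda>x. inverse (local_rep c S x))" if "c \<in> A" for c
    using S chart_subset(1)[OF that] chart_inv(3)[OF that] that
    by (intro C1_inverse C1_mapD) (auto simp: local_rep_def intro!: less_imp_neq[symmetric])
  show thesis
  proof (rule that[of P ch K "\<lambda>p q. v p q * inverse (S q)"])
    show "C1_map k A (\<lambda>q. v p q * inverse (S q))" if "p \<in> P" for p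
      unfolding C1_map_def
    proof
      fix c assume c: "c \<in> A"
      have "C1 k (chart_image c) (\<lambda>x. local_rep c (v p) x * inverse (local_rep c S x))"
        using that P b(4) c by (intro C1_mult Sinv C1_mapD) auto
      then show "C1 k (chart_image c) (local_rep c (\<lambda>q. v p q * inverse (S q)))"
        by (simp add: local_rep_def[abs_def])
    qed
    show "(\<Sum>p\<in>P. v p q * inverse (S q)) = 1" if "q \<in> M" for q
      using S[OF that] by (simp add: sum_distrib_right[symmetric] S_def[symmetric])
    show "0 \<le> v p q * inverse (S q)" if "p \<in> P" for p q
      using that b(6)[OF subsetD[OF P(1)]] by (auto simp: S_def intro!: mult_nonneg_nonneg sum_nonneg)
  qed (use P(1,2) b subsetD[OF P(1)] in simp_all)
qed

lemma borel_M: "M \<in> sets borel"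
  using compact_M by (intro borel_closed compact_imp_closed)

lemma borel_chart_domain: "c \<in> A \<Longrightarrow> fst c \<in> sets borel"
  using chart(1)[of c] borel_M by (auto simp: openin_open)

lemma borel_chart_image: "c \<in> A \<Longrightarrow> chart_image c \<in> sets borel"
  using chart(2)[of c] by (auto simp: openin_open)

lemma borel_chart_image_set:
  assumes c: "c \<in> A" and B: "B \<in> sets borel" "B \<subseteq> fst c"
  shows "snd c ` B \<in> sets borel"
proof -
  have "chart_inv c \<in> borel_measurable (restrict_space borel (chart_image c))"
    by (intro borel_measurable_continuous_on_restrict homeomorphism_cont2[OF chart(3)[OF c]])
  from measurable_sets[OF this B(1)] have "chart_inv c -` B \<inter> chart_image c \<in> sets (restrict_space borel (chart_image c))"
    by (simp add: space_restrict_space)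
  moreover have "chart_inv c -` B \<inter> chart_image c = snd c ` B"
    using overlap_mem[OF c, of _ B] B(2) by (auto simp: Int_absorb1)
  ultimately show ?thesis
    using borel_chart_image[OF c] by (simp add: sets_restrict_space_iff)
qed

end

section \<open>Measures given by densities in charts\<close>

text \<open>A common frame for both volumes: \<open>L\<close> is Lebesgue measure with
  \<open>X = M\<close>, or \<open>hyperplane_lborel k\<close> with the boundary as \<open>X\<close>.
  The assumption \<open>compat\<close> is the change of variables, to be supplied by each
  instance.\<close>

locale atlas_density = atlas k M A
  for k :: "'n::finite" and M :: "'m::t2_space set" and A :: "('m, 'n) chart set" +
  fixes L :: "(real^'n) measure" and X :: "'m set" and dens :: "('m, 'n) chart \<Rightarrow> real^'n \<Rightarrow> real"
  assumes sets_L: "sets L = sets borel" and L_compact: "\<And>K. compact K \<Longrightarrow> emeasure L K < \<infinity>"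
    and X: "closed X" "X \<subseteq> M"
    and dens: "\<And>c. c \<in> A \<Longrightarrow> continuous_on (chart_image c) (dens c)"
      "\<And>c x. c \<in> A \<Longrightarrow> x \<in> chart_image c \<Longrightarrow> 0 \<le> dens c x"
    and compat: "\<And>c d B. c \<in> A \<Longrightarrow> d \<in> A \<Longrightarrow> B \<in> sets borel \<Longrightarrow> B \<subseteq> X \<Longrightarrow> B \<subseteq> fst c \<Longrightarrow> B \<subseteq> fst d \<Longrightarrow>
      (\<integral>\<^sup>+x\<in>snd c ` B. ennreal (dens c x) \<partial>L) = (\<integral>\<^sup>+x\<in>snd d ` B. ennreal (dens d x) \<partial>L)"
begin

abbreviation "N \<equiv> restrict_space borel X"

abbreviation "image_X c \<equiv> snd c ` (fst c \<inter> X)"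

text \<open>With the Gram densities this is the property inside the definite descriptions of
  \<open>volume_measure\<close> and \<open>boundary_volume_measure\<close>.\<close>

definition density_measure :: "'m measure \<Rightarrow> bool" where
  "density_measure \<mu> \<longleftrightarrow> sets \<mu> = sets N \<and>
     (\<forall>c\<in>A. \<forall>B\<in>sets \<mu>. B \<subseteq> fst c \<longrightarrow> emeasure \<mu> B = (\<integral>\<^sup>+x\<in>snd c ` B. ennreal (dens c x) \<partial>L))"

definition local_measure :: "('m, 'n) chart \<Rightarrow> 'm measure" where
  "local_measure c = chart_measure L N (image_X c) (chart_inv c) (dens c)"

lemma borel_X: "X \<in> sets borel" using X by auto

lemma sets_N: "B \<in> sets N \<longleftrightarrow> B \<subseteq> X \<and> B \<in> sets borel"
  using borel_X by (simp add: sets_restrict_space_iff)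

lemma space_N: "space N = X" by (simp add: space_restrict_space)

lemma image_X: "c \<in> A \<Longrightarrow> image_X c \<in> sets L" "image_X c \<subseteq> chart_image c"
  using borel_chart_image_set[of c "fst c \<inter> X"] borel_chart_domain[of c] borel_X by (auto simp: sets_L)

lemma chart_measurable:
  assumes c: "c \<in> A"
  shows "chart_inv c \<in> measurable (restrict_space L (image_X c)) N"
    and "dens c \<in> borel_measurable (restrict_space L (image_X c))"
proof -
  have eq: "sets (restrict_space L (image_X c)) = sets (restrict_space borel (image_X c))"
    by (rule sets_restrict_space_cong[OF sets_L])
  have "chart_inv c \<in> borel_measurable (restrict_space borel (image_X c))"
    by (intro borel_measurable_continuous_on_restrict continuous_on_subset[OF homeomorphism_cont2[OF chart(3)[OF c]] image_X(2)])
  then show "chart_inv c \<in> measurable (restrict_space L (image_X c)) N"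
    using c by (intro measurable_restrict_space2) (auto simp: measurable_cong_sets[OF eq refl] space_restrict_space)
  show "dens c \<in> borel_measurable (restrict_space L (image_X c))"
    unfolding measurable_cong_sets[OF eq refl]
    by (intro borel_measurable_continuous_on_restrict continuous_on_subset[OF dens(1)[OF c] image_X(2)])
qed

lemma sets_local_measure [simp]: "sets (local_measure c) = sets N"
  by (simp add: local_measure_def)

lemma emeasure_local_measure:
  assumes c: "c \<in> A" and B: "B \<in> sets N" "B \<subseteq> fst c"
  shows "emeasure (local_measure c) B = (\<integral>\<^sup>+x\<in>snd c ` B. ennreal (dens c x) \<partial>L)"
proof -
  have "emeasure (local_measure c) B = (\<integral>\<^sup>+x. indicator B x \<partial>local_measure c)"
    using B by simp
  also have "\<dots> = (\<integral>\<^sup>+x. ennreal (dens c x) * indicator B (chart_inv c x) * indicator (image_X c) x \<partial>L)"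
    unfolding local_measure_def using B
    by (intro integral_chart_measure(1) image_X chart_measurable c) auto
  also have "\<dots> = (\<integral>\<^sup>+x\<in>snd c ` B. ennreal (dens c x) \<partial>L)"
  proof (rule nn_integral_cong)
    fix x
    have "x \<in> snd c ` B \<longleftrightarrow> chart_inv c x \<in> B \<and> x \<in> image_X c"
      using overlap_mem[OF c, of x B] overlap_mem[OF c, of x X] B by (auto simp: sets_N Int_absorb1)
    then show "ennreal (dens c x) * indicator B (chart_inv c x) * indicator (image_X c) x =
        ennreal (dens c x) * indicator (snd c ` B) x"
      by (simp split: split_indicator)
  qed
  finally show ?thesis .
qed

lemma continuous_support_measurable:
  assumes f: "continuous_on K f" and K: "compact K" and 0: "\<And>p. p \<notin> K \<Longrightarrow> f p = (0::real)"
  shows "f \<in> borel_measurable N"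
proof -
  have "(\<lambda>p. indicator K p *\<^sub>R f p) \<in> borel_measurable borel"
    using K f by (intro borel_measurable_continuous_on_indicator borel_closed compact_imp_closed)
  moreover have "(\<lambda>p. indicator K p *\<^sub>R f p) = f" using 0 by (auto simp: fun_eq_iff split: split_indicator)
  ultimately show ?thesis by (auto intro: measurable_restrict_space1)
qed

lemma density_measure_alt:
  "density_measure \<mu> \<longleftrightarrow> sets \<mu> = sets N \<and>
     (\<forall>c\<in>A. \<forall>B\<in>sets \<mu>. B \<subseteq> fst c \<inter> X \<longrightarrow> emeasure \<mu> B = emeasure (local_measure c) B)"
  using emeasure_local_measure by (auto simp: density_measure_def sets_N)

text \<open>The local measures agree on overlaps by \<open>compat\<close> and are glued with the
  weights of a partition of unity. This makes the definite descriptions meaningful.\<close>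

lemma ex1_density_measure: "\<exists>!\<mu>. density_measure \<mu>"
proof -
  obtain P :: "'m set" and ch K and w :: "'m \<Rightarrow> 'm \<Rightarrow> real" where P: "finite P" "\<And>p. p \<in> P \<Longrightarrow> ch p \<in> A" "\<And>p. p \<in> P \<Longrightarrow> compact (K p)" "\<And>p. p \<in> P \<Longrightarrow> K p \<subseteq> fst (ch p)"
    "\<And>p. p \<in> P \<Longrightarrow> C1_map k A (w p)" "\<And>p q. p \<in> P \<Longrightarrow> 0 \<le> w p q" "\<And>p q. p \<in> P \<Longrightarrow> q \<notin> K p \<Longrightarrow> w p q = 0"
    "\<And>q. q \<in> M \<Longrightarrow> (\<Sum>p\<in>P. w p q) = 1"
    by (rule partition_of_unity) (rule that; assumption)
  show ?thesis
    unfolding density_measure_alt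
  proof (rule glue_measures[where P = P and ch = ch and w = "\<lambda>p q. ennreal (w p q)"])
    show "fst c \<inter> X \<in> sets N" if "c \<in> A" for c
      using borel_chart_domain[OF that] borel_X by (simp add: sets_N)
    show "emeasure (local_measure c) B = emeasure (local_measure d) B"
      if "c \<in> A" "d \<in> A" "B \<in> sets N" "B \<subseteq> fst c \<inter> X" "B \<subseteq> fst d \<inter> X" for c d B
      using that compat[of c d B] by (simp add: emeasure_local_measure sets_N)
    show "(\<lambda>q. ennreal (w p q)) \<in> borel_measurable N" if "p \<in> P" for p
      using that P(3,7) continuous_on_subset[OF continuous_map_chart[OF P(5)[OF that] P(2)[OF that]] P(4)[OF that]]
      by (intro measurable_compose[OF continuous_support_measurable[of "K p"] measurable_ennreal]) auto
    show "ennreal (w p q) = 0" if "p \<in> P" "q \<in> space N" "q \<notin> fst (ch p) \<inter> X" for p q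
      using that P(4,7) space_N by (metis IntI ennreal_0 subsetD)
    show "(\<Sum>p\<in>P. ennreal (w p q)) = 1" if "q \<in> space N" for q
      using that P(6,8) X(2) by (subst sum_ennreal) (auto simp: space_N)
  qed (use P in auto)
qed

text \<open>Since the support of \<open>f\<close> lies in one chart, the measure may be replaced by
  the local one. Integrability holds because a bounded function is integrated over a compact set, on
  which \<open>L\<close> is finite.\<close>

lemma integral_density_measure:
  assumes \<mu>: "density_measure \<mu>" and c: "c \<in> A" and K: "compact K" "K \<subseteq> fst c"
    and f: "continuous_on (fst c) f" "\<And>p. p \<notin> K \<Longrightarrow> f p = (0::real)"
  shows "integrable \<mu> f"
    and "(\<integral>p. f p \<partial>\<mu>) = (\<integral>x. indicator (image_X c) x * (dens c x * f (chart_inv c x)) \<partial>L)"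
    and "integrable L (\<lambda>x. indicator (image_X c) x * (dens c x * f (chart_inv c x)))"
proof -
  let ?g = "\<lambda>x. dens c x * f (chart_inv c x)"
  let ?K = "snd c ` (K \<inter> X)"
  have fm: "f \<in> borel_measurable N"
    using f K by (intro continuous_support_measurable[of K]) (auto intro: continuous_on_subset)
  have dm: "sets \<mu> = sets N" "\<And>B. B \<in> sets N \<Longrightarrow> B \<subseteq> fst c \<inter> X \<Longrightarrow> emeasure \<mu> B = emeasure (local_measure c) B"
    using \<mu> c by (auto simp: density_measure_alt)
  have UN: "fst c \<inter> X \<in> sets N"
    using borel_chart_domain[OF c] borel_X by (simp add: sets_N)
  have 1: "(\<integral>p. f p \<partial>\<mu>) = (\<integral>p. f p \<partial>local_measure c) \<and> integrable \<mu> f = integrable (local_measure c) f"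
    using fm f(2) K(2) by (intro nn_integral_eq_of_agree(2)[OF dm(1) sets_local_measure UN dm(2)]) (auto simp: space_N)
  have 2: "(\<integral>p. f p \<partial>local_measure c) = (\<integral>x. indicator (image_X c) x * ?g x \<partial>L) \<and>
      integrable (local_measure c) f = integrable L (\<lambda>x. indicator (image_X c) x * ?g x)"
    unfolding local_measure_def using dens(2)[OF c] image_X(2)
    by (intro integral_chart_measure(2) image_X chart_measurable c fm) auto
  have KX: "compact (K \<inter> X)" using K X by (intro compact_Int_closed)
  have cK: "compact ?K"
    by (rule compact_continuous_image[OF _ KX])
      (use K in \<open>auto intro: continuous_on_subset[OF homeomorphism_cont1[OF chart(3)[OF c]]]\<close>)
  have Ksub: "?K \<subseteq> chart_image c" using K by auto
  have cg: "continuous_on ?K ?g"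
    using Ksub c by (intro continuous_intros continuous_on_subset[OF dens(1)[OF c]]
      continuous_on_compose2[OF f(1)] continuous_on_subset[OF homeomorphism_cont2[OF chart(3)[OF c]]]) auto
  \<comment> \<open>The doubled indicator fits \<open>integrableI_bounded_set_indicator\<close>: one
    factor is the set of integration, the other makes the function measurable.\<close>
  have eq: "indicator (image_X c) x * ?g x = indicator ?K x *\<^sub>R (indicator ?K x *\<^sub>R ?g x)" for x
    using overlap_mem[OF c, of x "K \<inter> X"] overlap_mem[OF c, of x X] f(2)[of "chart_inv c x"] K(2)
    by (auto simp: Int_absorb1 le_infI1 split: split_indicator)
  have "bounded (?g ` ?K)" using compact_continuous_image[OF cg cK] by (rule compact_imp_bounded)
  then obtain b where b: "\<And>x. x \<in> ?K \<Longrightarrow> norm (?g x) \<le> b" by (auto simp: bounded_iff)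
  have Kb: "?K \<in> sets borel" using cK by (intro borel_closed compact_imp_closed)
  have gm: "(\<lambda>x. indicator ?K x *\<^sub>R ?g x) \<in> borel_measurable L"
    using borel_measurable_continuous_on_indicator[OF Kb cg] by (simp add: measurable_cong_sets[OF sets_L refl])
  have "integrable L (\<lambda>x. indicator ?K x *\<^sub>R (indicator ?K x *\<^sub>R ?g x))"
    using Kb gm L_compact[OF cK] b
    by (intro integrableI_bounded_set_indicator[where B = b]) (auto simp: sets_L intro!: AE_I2)
  then have "integrable L (\<lambda>x. indicator (image_X c) x * ?g x)"
    unfolding eq .
  with 1 2 show "integrable \<mu> f" "(\<integral>p. f p \<partial>\<mu>) = (\<integral>x. indicator (image_X c) x * ?g x \<partial>L)"
    "integrable L (\<lambda>x. indicator (image_X c) x * ?g x)" by auto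
qed

text \<open>The constant 1 is a finite sum of integrable weights. The second formula is the one
  through which both volumes are computed from here on.\<close>

lemma total_density_measure:
  assumes \<mu>: "density_measure \<mu>"
    and P: "finite P" "\<And>p. p \<in> P \<Longrightarrow> ch p \<in> A" "\<And>p. p \<in> P \<Longrightarrow> compact (K p)" "\<And>p. p \<in> P \<Longrightarrow> K p \<subseteq> fst (ch p)"
      "\<And>p. p \<in> P \<Longrightarrow> C1_map k A (w p)" "\<And>p q. p \<in> P \<Longrightarrow> q \<notin> K p \<Longrightarrow> w p q = (0::real)"
      "\<And>q. q \<in> M \<Longrightarrow> (\<Sum>p\<in>P. w p q) = 1"
  shows "emeasure \<mu> X < \<infinity>"
    and "measure \<mu> X = (\<Sum>p\<in>P. \<integral>x. indicator (image_X (ch p)) x * (dens (ch p) x * local_rep (ch p) (w p) x) \<partial>L)"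
proof -
  have int: "integrable \<mu> (w p)"
    "(\<integral>q. w p q \<partial>\<mu>) = (\<integral>x. indicator (image_X (ch p)) x * (dens (ch p) x * local_rep (ch p) (w p) x) \<partial>L)"
    if p: "p \<in> P" for p
    using integral_density_measure(1,2)[OF \<mu> P(2-4)[OF p] continuous_map_chart[OF P(5)[OF p] P(2)[OF p]] P(6)[OF p]]
    by (simp_all add: local_rep_def)
  have sp: "space \<mu> = X" using \<mu> sets_eq_imp_space_eq[of \<mu> N] by (simp add: density_measure_def space_N)
  have "integrable \<mu> (\<lambda>q. \<Sum>p\<in>P. w p q)" using int by auto
  then have "integrable \<mu> (\<lambda>q. 1 :: real)"
    by (rule Bochner_Integration.integrable_cong[THEN iffD1, rotated 2]) (use X(2) in \<open>auto simp: P(7) sp\<close>)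
  then show fin: "emeasure \<mu> X < \<infinity>"
    by (simp add: integrable_iff_bounded sp)
  have "measure \<mu> X = (\<integral>q. 1 \<partial>\<mu>)" by (simp add: sp)
  also have "\<dots> = (\<integral>q. (\<Sum>p\<in>P. w p q) \<partial>\<mu>)"
    by (rule Bochner_Integration.integral_cong) (use X(2) in \<open>auto simp: P(7) sp\<close>)
  also have "\<dots> = (\<Sum>p\<in>P. \<integral>q. w p q \<partial>\<mu>)" using int by (intro Bochner_Integration.integral_sum)
  finally show "measure \<mu> X = (\<Sum>p\<in>P. \<integral>x. indicator (image_X (ch p)) x * (dens (ch p) x * local_rep (ch p) (w p) x) \<partial>L)"
    using int by simp
qed

end

section \<open>Volume measures of induced metrics\<close>

lemma bounded_bilinear_form: "bounded_bilinear (form \<kappa> :: real \<times> 'v::euclidean_space \<Rightarrow> _)"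
  unfolding bilinear_conv_bounded_bilinear[symmetric] bilinear_def
  by (auto intro!: linearI simp: form_def algebra_simps inner_add_left inner_add_right)

text \<open>Thickening by the unit interval turns the claim into boundedness; the radius
  \<open>R + 1\<close> leaves room for the additional coordinate.\<close>

lemma hyperplane_lborel_compact_finite:
  fixes K :: "(real^'n) set"
  assumes "compact K" shows "emeasure (hyperplane_lborel k) K < \<infinity>"
proof -
  obtain R where R: "\<And>x. x \<in> K \<Longrightarrow> norm x \<le> R" using compact_imp_bounded[OF assms] by (auto simp: bounded_iff)
  have K: "K \<in> sets borel" using assms by (intro borel_closed compact_imp_closed)
  have "emeasure (hyperplane_lborel k) K = (\<integral>\<^sup>+y. indicator K y \<partial>hyperplane_lborel k)"
    using K by simp
  also have "\<dots> = (\<integral>\<^sup>+x. indicator K (flat k x) * indicator {x. x $ k \<in> {0..1}} x \<partial>lborel)"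
    using K by (intro nn_integral_hyperplane_thicken) simp
  also have "\<dots> \<le> (\<integral>\<^sup>+x. indicator (cball (0::real^'n) (R + 1)) x \<partial>lborel)"
  proof (rule nn_integral_mono)
    fix x :: "real^'n"
    have "norm x \<le> R + 1" if "flat k x \<in> K" "x $ k \<in> {0..1}"
    proof -
      have "norm x \<le> norm (flat k x) + norm (x $ k *\<^sub>R axis k (1::real))"
        by (metis flat_axis norm_triangle_ineq)
      then show ?thesis using R[OF that(1)] that(2) by simp
    qed
    then show "indicator K (flat k x) * indicator {x. x $ k \<in> {0..1}} x \<le> (indicator (cball 0 (R + 1)) x :: ennreal)"
      by (auto split: split_indicator)
  qed
  also have "\<dots> < \<infinity>"
    using emeasure_bounded_finite[of "cball (0::real^'n) (R + 1)"] by simp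
  finally show ?thesis .
qed

text \<open>If \<open>J\<close> maps directions tangent to the hyperplane to such directions, the
  tangential block of the transformed Gram matrix involves only the tangential blocks of
  \<open>J\<close> and \<open>G\<close>.\<close>

lemma delete_rc_congruence:
  assumes "\<And>i. i \<noteq> k \<Longrightarrow> J $ k $ i = 0"
  shows "delete_rc k (transpose J ** G ** J) = transpose (delete_rc k J) ** delete_rc k G ** delete_rc k J"
proof -
  let ?D = "delete_rc k"
  have "(\<Sum>m\<in>UNIV. (\<Sum>l\<in>UNIV. J $ l $ i * G $ l $ m) * J $ m $ j) =
      (\<Sum>m\<in>UNIV. (\<Sum>l\<in>UNIV. ?D J $ l $ i * ?D G $ l $ m) * ?D J $ m $ j)" if "i \<noteq> k" "j \<noteq> k" for i j
  proof (rule sum.cong[OF refl])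
    fix m
    show "(\<Sum>l\<in>UNIV. J $ l $ i * G $ l $ m) * J $ m $ j = (\<Sum>l\<in>UNIV. ?D J $ l $ i * ?D G $ l $ m) * ?D J $ m $ j"
    proof (cases "m = k")
      case False
      have "(\<Sum>l\<in>UNIV. J $ l $ i * G $ l $ m) = (\<Sum>l\<in>UNIV. ?D J $ l $ i * ?D G $ l $ m)"
        using that False assms by (intro sum.cong) (auto simp: delete_rc_def)
      then show ?thesis using that False by (simp add: delete_rc_def)
    qed (use that assms in \<open>simp add: delete_rc_def\<close>)
  qed
  moreover have "(\<Sum>m\<in>UNIV. (\<Sum>l\<in>UNIV. ?D J $ l $ i * ?D G $ l $ m) * ?D J $ m $ j) = (if i = j then 1 else 0)"
    if "i = k \<or> j = k" for i j
  proof -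
    have delta: "(\<Sum>l\<in>UNIV. (if l = k then 1 else 0) * f l) = f k" "(\<Sum>l\<in>UNIV. f l * (if l = k then 1 else 0)) = f k" for f :: "_ \<Rightarrow> real"
      by (simp_all add: if_distrib[of "\<lambda>x. x * _"] if_distrib[of "\<lambda>x. _ * x"] cong: if_cong)
    have col: "?D B $ l $ k = (if l = k then 1 else 0)" "?D B $ k $ l = (if l = k then 1 else 0)" for B l
      by (auto simp: delete_rc_def)
    from that show ?thesis
    proof
      assume "i = k"
      then show ?thesis by (auto simp: col delta)
    next
      assume "j = k"
      then show ?thesis by (auto simp: col delta)
    qed
  qed
  ultimately show ?thesis
    by (auto simp: vec_eq_iff matrix_matrix_mult_def transpose_def) (auto simp: delete_rc_def)
qed

lemma boundary_gram_eq: "boundary_gram \<kappa> k c F x = delete_rc k (gram \<kappa> k c F x)"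
  by (simp add: boundary_gram_def delete_rc_def)

lemma sqrt_det_congruence: "sqrt (det (transpose J ** G ** J)) = \<bar>det J\<bar> * sqrt (det (G :: real^'n^'n))"
  by (simp add: det_mul real_sqrt_mult mult.commute mult.left_commute flip: real_sqrt_abs power2_eq_square)

context atlas begin

lemma gram_trans:
  assumes cd: "c \<in> A" "d \<in> A" and x: "x \<in> snd c ` (fst c \<inter> fst d)" and F: "C1_map k A F"
  shows "gram \<kappa> k c F x =
    transpose (jacobian k (trans c d) x) ** gram \<kappa> k d F (trans c d x) ** jacobian k (trans c d) x"
proof -
  interpret bounded_bilinear "form \<kappa> :: real \<times> 'v::euclidean_space \<Rightarrow> _" by (rule bounded_bilinear_form)
  have "C1 k (snd d ` (fst c \<inter> fst d)) (local_rep d F)"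
    using C1_mapD[OF F cd(2)] by (rule C1_subset) auto
  note p = partial_local_rep_trans[OF cd x this]
  show ?thesis
    by (simp add: vec_eq_iff gram_def coord_vec_def p matrix_matrix_mult_def transpose_def
        sum_left sum_right scaleR_left scaleR_right sum_distrib_right sum_distrib_left mult_ac)
qed

text \<open>A short line segment through \<open>x\<close> in direction \<open>i\<close> stays in the
  hyperplane. Boundary points go to boundary points, so the \<open>k\<close>-th component of the
  transition map is constantly 0 on it.\<close>

lemma jacobian_boundary:
  assumes cd: "c \<in> A" "d \<in> A" and x: "x \<in> snd c ` (fst c \<inter> fst d)" and 0: "x $ k = 0" and i: "i \<noteq> k"
  shows "jacobian k (trans c d) x $ k $ i = 0"
proof -
  let ?W = "snd c ` (fst c \<inter> fst d)"
  let ?l = "\<lambda>t. x + t *\<^sub>R axis i (1::real)"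
  have W: "openin (top_of_set (halfspace k)) ?W" by (intro openin_overlap chart cd)
  then obtain T where T: "open T" "?W = halfspace k \<inter> T" by (auto simp: openin_open)
  let ?S = "?l -` T"
  have S: "open ?S" by (rule open_vimage[OF T(1)]) (intro continuous_intros)
  have lk: "?l t $ k = 0" for t using 0 i by (simp add: axis_def)
  have l: "?l t \<in> ?W" if "t \<in> ?S" for t
    using that T(2) lk[of t] by (auto simp: halfspace_def)
  have xS: "0 \<in> ?S" using x T by auto
  have "(trans c d has_derivative (\<lambda>v. \<Sum>j\<in>UNIV. v $ j *\<^sub>R partial k j (trans c d) x)) (at (?l 0) within ?l ` ?S)"
    using has_derivative_subset[OF C1D(2)[OF C1_trans[OF cd] x], of "?l ` ?S"] l chart_subset(2)[OF cd(1)] by auto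
  moreover have "(?l has_derivative (\<lambda>t. t *\<^sub>R axis i 1)) (at 0 within ?S)"
    by (auto intro!: derivative_eq_intros)
  ultimately have "((\<lambda>t. trans c d (?l t)) has_derivative
      (\<lambda>t. \<Sum>j\<in>UNIV. (t *\<^sub>R axis i (1::real)) $ j *\<^sub>R partial k j (trans c d) x)) (at 0 within ?S)"
    by (rule has_derivative_in_compose[rotated])
  then have "((\<lambda>t. trans c d (?l t)) has_derivative
      (\<lambda>t. \<Sum>j\<in>UNIV. (t *\<^sub>R axis i (1::real)) $ j *\<^sub>R partial k j (trans c d) x)) (at 0)"
    using at_within_open[OF xS S] by simp
  then have "((\<lambda>t. trans c d (?l t) $ k) has_derivative
      (\<lambda>t. (\<Sum>j\<in>UNIV. (t *\<^sub>R axis i (1::real)) $ j *\<^sub>R partial k j (trans c d) x) $ k)) (at 0)"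
    by (rule bounded_linear.has_derivative[OF bounded_linear_vec_nth])
  moreover have "((\<lambda>t. trans c d (?l t) $ k) has_derivative (\<lambda>t. 0)) (at 0)"
  proof (rule has_derivative_transform_within_open[OF _ S xS])
    show "((\<lambda>t. 0) has_derivative (\<lambda>t. 0)) (at 0)" by simp
    fix t assume "t \<in> ?S"
    from l[OF this] obtain q where q: "q \<in> fst c" "q \<in> fst d" "?l t = snd c q" by auto
    then have "snd d q $ k = 0"
      using lk[of t] boundary_chart[OF cd(1) q(1)] boundary_chart[OF cd(2) q(2)] by simp
    then show "0 = trans c d (?l t) $ k"
      using q cd by (simp add: local_rep_def)
  qed
  ultimately have "(\<lambda>t. (\<Sum>j\<in>UNIV. (t *\<^sub>R axis i (1::real)) $ j *\<^sub>R partial k j (trans c d) x) $ k) = (\<lambda>t. 0)"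
    by (rule has_derivative_unique)
  from fun_cong[OF this, of 1] show ?thesis
    using partial_sum_axis[of i "\<lambda>j. partial k j (trans c d) x"] by (simp add: jacobian_def del: sum_component)
qed

end

locale atlas_metric = atlas k M A
  for k :: "'n::finite" and M :: "'m::t2_space set" and A :: "('m, 'n) chart set" +
  fixes \<kappa> :: real and F :: "'m \<Rightarrow> real \<times> 'v::euclidean_space"
  assumes F: "C1_map k A F"
    and gram_pos: "\<And>c x. c \<in> A \<Longrightarrow> x \<in> chart_image c \<Longrightarrow> 0 < det (gram \<kappa> k c F x)"
      "\<And>c x. c \<in> A \<Longrightarrow> x \<in> chart_image c \<Longrightarrow> 0 < det (boundary_gram \<kappa> k c F x)"
begin

lemma continuous_gram:
  assumes "c \<in> A"
  shows "continuous_on (chart_image c) (\<lambda>x. gram \<kappa> k c F x $ i $ j)"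
    and "continuous_on (chart_image c) (\<lambda>x. boundary_gram \<kappa> k c F x $ i $ j)"
proof -
  have "continuous_on (chart_image c) (\<lambda>x. coord_vec k c F x i)" for i
    unfolding coord_vec_def using C1D(3)[OF C1_mapD[OF F assms]] by simp
  then show 1: "continuous_on (chart_image c) (\<lambda>x. gram \<kappa> k c F x $ i $ j)" for i j
    unfolding gram_def by (simp add: bounded_bilinear.continuous_on[OF bounded_bilinear_form])
  show "continuous_on (chart_image c) (\<lambda>x. boundary_gram \<kappa> k c F x $ i $ j)"
    using 1 by (cases "i = k \<or> j = k") (auto simp: boundary_gram_def)
qed

lemma continuous_dens:
  assumes "c \<in> A"
  shows "continuous_on (chart_image c) (\<lambda>x. sqrt (det (gram \<kappa> k c F x)))"
    and "continuous_on (chart_image c) (\<lambda>x. sqrt (det (boundary_gram \<kappa> k c F x)))"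
  by (intro continuous_on_real_sqrt continuous_on_det continuous_gram assms)+

lemma set_nn_integral_real: "(\<integral>\<^sup>+x\<in>S. ennreal (f x) \<partial>L) = (\<integral>\<^sup>+x. ennreal (indicator S x * f x) \<partial>L)"
  by (intro nn_integral_cong) (simp split: split_indicator)

lemma trans_inj:
  assumes "c \<in> A" "d \<in> A" "B \<subseteq> fst c" "B \<subseteq> fst d"
  shows "trans c d ` (snd c ` B) = snd d ` B" "inj_on (trans c d) (snd c ` B)"
    "snd c ` B \<subseteq> snd c ` (fst c \<inter> fst d)"
    "x \<in> snd c ` B \<Longrightarrow> (trans c d has_derivative (\<lambda>v. jacobian k (trans c d) x *v v)) (at x within snd c ` B)"
proof -
  show sub: "snd c ` B \<subseteq> snd c ` (fst c \<inter> fst d)" using assms by auto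
  show "trans c d ` (snd c ` B) = snd d ` B"
    using assms by (auto simp: image_image local_rep_def subset_iff intro!: image_cong)
  show "inj_on (trans c d) (snd c ` B)"
    by (rule inj_on_inverseI[of _ "trans d c"]) (use trans_image(2)[OF assms(1,2)] sub in auto)
  assume x: "x \<in> snd c ` B"
  have "(\<lambda>v. jacobian k (trans c d) x *v v) = (\<lambda>v. \<Sum>i\<in>UNIV. v $ i *\<^sub>R partial k i (trans c d) x)"
    by (simp add: fun_eq_iff vec_eq_iff jacobian_def matrix_vector_mult_def mult.commute)
  then show "(trans c d has_derivative (\<lambda>v. jacobian k (trans c d) x *v v)) (at x within snd c ` B)"
    using x sub chart_subset(2)[OF assms(1)]
    by (auto intro!: has_derivative_subset[OF C1D(2)[OF C1_trans[OF assms(1,2)]]])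
qed

sublocale bulk: atlas_density k M A lborel M "\<lambda>c x. sqrt (det (gram \<kappa> k c F x))"
proof
  show "emeasure lborel K < \<infinity>" if "compact K" for K :: "(real^'n) set"
    using emeasure_compact_finite[OF that] by (simp add: less_top)
  show "closed M" using compact_M by (rule compact_imp_closed)
  fix c d B assume c: "c \<in> A" and d: "d \<in> A" and B: "B \<in> sets borel" "B \<subseteq> M" "B \<subseteq> fst c" "B \<subseteq> fst d"
  note t = trans_inj[OF c d B(3,4)]
  let ?g = "\<lambda>d x. sqrt (det (gram \<kappa> k d F x))"
  have eq: "?g c x = \<bar>det (jacobian k (trans c d) x)\<bar> * ?g d (trans c d x)" if "x \<in> snd c ` B" for x
    using gram_trans[OF c d _ F] t(3) that by (auto simp: sqrt_det_congruence)
  have meas: "(\<lambda>x. indicator (snd c ` B) x * ?g c x) \<in> borel_measurable borel" if "c \<in> A" "B \<subseteq> fst c" for c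
    using borel_measurable_continuous_on_indicator[OF borel_chart_image_set[OF that(1) B(1) that(2)]
        continuous_on_subset[OF continuous_dens(1)[OF that(1)] image_mono[OF that(2)]]] by simp
  have "(\<integral>\<^sup>+y. ennreal (indicator (trans c d ` (snd c ` B)) y * ?g d y) \<partial>lborel) =
    (\<integral>\<^sup>+x. ennreal (indicator (snd c ` B) x * (\<bar>det (matrix ((*v) (jacobian k (trans c d) x)))\<bar> * ?g d (trans c d x))) \<partial>lborel)"
  proof (rule nn_integral_change_of_variables)
    show "snd c ` B \<in> sets borel" "trans c d ` (snd c ` B) \<in> sets borel"
      unfolding t(1) using B c d by (auto intro: borel_chart_image_set)
    show "(\<lambda>y. indicator (trans c d ` (snd c ` B)) y * ?g d y) \<in> borel_measurable borel"
      unfolding t(1) by (rule meas[OF d B(4)])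
    have "(\<lambda>x. indicator (snd c ` B) x * (\<bar>det (matrix ((*v) (jacobian k (trans c d) x)))\<bar> * ?g d (trans c d x))) =
      (\<lambda>x. indicator (snd c ` B) x * ?g c x)"
      using eq by (auto simp: fun_eq_iff split: split_indicator)
    then show "(\<lambda>x. indicator (snd c ` B) x * (\<bar>det (matrix ((*v) (jacobian k (trans c d) x)))\<bar> * ?g d (trans c d x)))
      \<in> borel_measurable borel" using meas[OF c B(3)] by simp
    show "0 \<le> ?g d y" if "y \<in> trans c d ` (snd c ` B)" for y
      using that B(4) gram_pos(1)[OF d] unfolding t(1) by (auto intro!: less_imp_le)
  qed (use t in auto)
  also have "\<dots> = (\<integral>\<^sup>+x. ennreal (indicator (snd c ` B) x * ?g c x) \<partial>lborel)"
    using eq by (intro nn_integral_cong) (auto split: split_indicator)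
  finally show "(\<integral>\<^sup>+x\<in>snd c ` B. ennreal (?g c x) \<partial>lborel) = (\<integral>\<^sup>+x\<in>snd d ` B. ennreal (?g d x) \<partial>lborel)"
    unfolding t(1) set_nn_integral_real by simp
qed (use continuous_dens gram_pos in \<open>auto intro: less_imp_le\<close>)

text \<open>On the boundary the Jacobian of the restricted transition map is
  \<open>delete_rc k\<close> of the full one. By \<open>jacobian_boundary\<close> and
  \<open>delete_rc_congruence\<close> the boundary density is multiplied by exactly its
  determinant.\<close>

sublocale bdry: atlas_density k M A "hyperplane_lborel k" "boundary k A" "\<lambda>c x. sqrt (det (boundary_gram \<kappa> k c F x))"
proof
  show "emeasure (hyperplane_lborel k) K < \<infinity>" if "compact K" for K :: "(real^'n) set"
    by (rule hyperplane_lborel_compact_finite[OF that])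
  show "closed (boundary k A)" "boundary k A \<subseteq> M" by (rule closed_boundary boundary_subset)+
  fix c d B assume c: "c \<in> A" and d: "d \<in> A" and B: "B \<in> sets borel" "B \<subseteq> boundary k A" "B \<subseteq> fst c" "B \<subseteq> fst d"
  note t = trans_inj[OF c d B(3,4)]
  let ?g = "\<lambda>d x. sqrt (det (boundary_gram \<kappa> k d F x))"
  have flat: "snd c ` B \<subseteq> {x. x $ k = 0}" if "c \<in> A" "B \<subseteq> fst c" for c
    using that B(2) boundary_chart[OF that(1)] by blast
  have eq: "?g c x = \<bar>det (delete_rc k (jacobian k (trans c d) x))\<bar> * ?g d (trans c d x)" if x: "x \<in> snd c ` B" for x
  proof -
    have x': "x \<in> snd c ` (fst c \<inter> fst d)" "x $ k = 0" using x t(3) flat[OF c B(3)] by auto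
    show ?thesis
      unfolding boundary_gram_eq gram_trans[OF c d x'(1) F]
      using delete_rc_congruence[OF jacobian_boundary[OF c d x']] by (simp add: sqrt_det_congruence)
  qed
  have meas: "(\<lambda>x. indicator (snd c ` B) x * ?g c x) \<in> borel_measurable borel" if "c \<in> A" "B \<subseteq> fst c" for c
    using borel_measurable_continuous_on_indicator[OF borel_chart_image_set[OF that(1) B(1) that(2)]
        continuous_on_subset[OF continuous_dens(2)[OF that(1)] image_mono[OF that(2)]]] by simp
  have "(\<integral>\<^sup>+y. ennreal (indicator (trans c d ` (snd c ` B)) y * ?g d y) \<partial>hyperplane_lborel k) =
    (\<integral>\<^sup>+x. ennreal (indicator (snd c ` B) x *
      (\<bar>det (delete_rc k (matrix ((*v) (jacobian k (trans c d) x))))\<bar> * ?g d (trans c d x))) \<partial>hyperplane_lborel k)"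
  proof (rule nn_integral_hyperplane_change_of_variables)
    show "snd c ` B \<in> sets borel" "trans c d ` (snd c ` B) \<in> sets borel"
      unfolding t(1) using B c d by (auto intro: borel_chart_image_set)
    show "snd c ` B \<subseteq> {x. x $ k = 0}" "trans c d ` (snd c ` B) \<subseteq> {x. x $ k = 0}"
      unfolding t(1) using flat c d B by auto
    show "(\<lambda>y. indicator (trans c d ` (snd c ` B)) y * ?g d y) \<in> borel_measurable borel"
      unfolding t(1) by (rule meas[OF d B(4)])
    have "(\<lambda>x. indicator (snd c ` B) x * (\<bar>det (delete_rc k (matrix ((*v) (jacobian k (trans c d) x))))\<bar> * ?g d (trans c d x))) =
      (\<lambda>x. indicator (snd c ` B) x * ?g c x)"
      using eq by (auto simp: fun_eq_iff split: split_indicator)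
    then show "(\<lambda>x. indicator (snd c ` B) x * (\<bar>det (delete_rc k (matrix ((*v) (jacobian k (trans c d) x))))\<bar> * ?g d (trans c d x)))
      \<in> borel_measurable borel" using meas[OF c B(3)] by simp
    show "0 \<le> ?g d y" if "y \<in> trans c d ` (snd c ` B)" for y
      using that B(4) gram_pos(2)[OF d] unfolding t(1) by (auto intro!: less_imp_le)
  qed (use t in auto)
  also have "\<dots> = (\<integral>\<^sup>+x. ennreal (indicator (snd c ` B) x * ?g c x) \<partial>hyperplane_lborel k)"
    using eq by (intro nn_integral_cong) (auto split: split_indicator)
  finally show "(\<integral>\<^sup>+x\<in>snd c ` B. ennreal (?g c x) \<partial>hyperplane_lborel k) =
      (\<integral>\<^sup>+x\<in>snd d ` B. ennreal (?g d x) \<partial>hyperplane_lborel k)"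
    unfolding t(1) set_nn_integral_real by simp
qed (use continuous_dens gram_pos in \<open>auto intro: less_imp_le\<close>)

lemma volume_measure: "bulk.density_measure (volume_measure \<kappa> k M A F)"
  using theI'[OF bulk.ex1_density_measure] unfolding volume_measure_def bulk.density_measure_def .

lemma boundary_volume_measure: "bdry.density_measure (boundary_volume_measure \<kappa> k A F)"
  using theI'[OF bdry.ex1_density_measure] unfolding boundary_volume_measure_def bdry.density_measure_def .

lemma boundary_image:
  assumes "c \<in> A" shows "snd c ` (fst c \<inter> boundary k A) = chart_image c \<inter> {x. x $ k = 0}"
  using boundary_chart[OF assms] by auto

lemma bulk_image: "c \<in> A \<Longrightarrow> snd c ` (fst c \<inter> M) = chart_image c"
  using chart_subset(1)[of c] by (simp add: Int_absorb2)

end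

section \<open>Frames tangent to space forms\<close>

lemma space_formD:
  assumes "q \<in> space_form \<kappa>"
  shows "(fst q)\<^sup>2 + \<kappa> * (snd q \<bullet> snd q) = 1" "\<kappa> \<le> 0 \<Longrightarrow> 0 < fst q"
  using assms by (auto simp: space_form_def)

text \<open>The delicate case is the hyperboloid: with \<open>v = (s, w)\<close> and
  \<open>q = (t, x)\<close>, tangency and the Cauchy-Schwarz inequality give |w|^2 \<le> t^2 (|w|^2
  - s^2), so the negative term cannot win. For \<kappa> = 0, tangency forces
  \<open>s = 0\<close>.\<close>

lemma form_pos:
  assumes \<kappa>: "\<kappa> \<in> {-1, 0, 1}" and q: "q \<in> space_form \<kappa>" and v: "v \<in> tangent_space \<kappa> q" "v \<noteq> 0"
  shows "0 < form \<kappa> v v"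
proof -
  obtain t x where qt: "q = (t, x)" by (cases q)
  obtain s w where vs: "v = (s, w)" by (cases v)
  have tan: "t * s + \<kappa> * (x \<bullet> w) = 0" using v by (simp add: tangent_space_def qt vs)
  have nz: "s \<noteq> 0 \<or> w \<noteq> 0" using v vs by (auto simp: zero_prod_def)
  consider "\<kappa> = -1" | "\<kappa> = 0" | "\<kappa> = 1" using \<kappa> by auto
  then show ?thesis
  proof cases
    case 1
    have t: "t\<^sup>2 = 1 + x \<bullet> x" "0 < t" using space_formD[OF q] 1 by (auto simp: qt)
    have "w \<noteq> 0" using nz tan t 1 by auto
    have "(t * s)\<^sup>2 \<le> (x \<bullet> x) * (w \<bullet> w)"
      using tan 1 Cauchy_Schwarz_ineq[of x w] by (simp add: power2_eq_square)
    then have "t\<^sup>2 * s\<^sup>2 \<le> (t\<^sup>2 - 1) * (w \<bullet> w)" using t by (simp add: power_mult_distrib)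
    then have "w \<bullet> w \<le> t\<^sup>2 * (w \<bullet> w - s\<^sup>2)" by (simp add: algebra_simps)
    moreover have "0 < w \<bullet> w" using \<open>w \<noteq> 0\<close> by simp
    ultimately have "0 < t\<^sup>2 * (w \<bullet> w - s\<^sup>2)" by linarith
    then show ?thesis using t(2) by (simp add: zero_less_mult_iff form_def vs 1 power2_eq_square)
  next
    case 2
    then show ?thesis using tan nz space_formD(2)[OF q] by (auto simp: form_def vs qt)
  next
    case 3
    have "0 < s * s \<or> 0 < w \<bullet> w" using nz by (auto simp: zero_less_mult_iff linorder_neq_iff)
    with 3 show ?thesis
      by (auto simp: form_def vs intro: add_pos_nonneg add_nonneg_pos)
  qed
qed

lemma subspace_tangent_space: "subspace (tangent_space \<kappa> q)"
  by (auto simp: subspace_def tangent_space_def inner_add_right algebra_simps)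
    (metis distrib_left mult.assoc mult.left_commute mult_zero_right)

lemma tangent_partial:
  fixes f :: "real^'n \<Rightarrow> real \<times> 'v::euclidean_space"
  assumes W: "openin (top_of_set (halfspace k)) W" "x \<in> W" and f: "C1 k W f"
    and S: "\<And>y. y \<in> W \<Longrightarrow> f y \<in> space_form \<kappa>"
  shows "partial k i f x \<in> tangent_space \<kappa> (f x)"
proof -
  have xH: "x \<in> halfspace k" using W C1D(1)[OF f] by auto
  let ?g = "\<lambda>y. fst (f y) * fst (f y) + \<kappa> * (snd (f y) \<bullet> snd (f y))"
  let ?f' = "\<lambda>v. \<Sum>i\<in>UNIV. v $ i *\<^sub>R partial k i f x"
  have "(?g has_derivative (\<lambda>v. fst (f x) * fst (?f' v) + fst (?f' v) * fst (f x) +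
      \<kappa> * (snd (f x) \<bullet> snd (?f' v) + snd (?f' v) \<bullet> snd (f x)))) (at x within halfspace k)"
    using C1D(2)[OF f W(2)] by (intro derivative_intros)
  from partial_eq[OF xH this, of i]
  have "partial k i ?g x = 2 * (fst (f x) * fst (partial k i f x) + \<kappa> * (snd (f x) \<bullet> snd (partial k i f x)))"
    by (simp add: partial_sum_axis inner_commute del: fst_sum snd_sum)
  moreover have "partial k i ?g x = partial k i (\<lambda>y. 1 :: real) x"
    by (rule partial_cong[OF W]) (use space_formD(1)[OF S] in \<open>auto simp: power2_eq_square\<close>)
  moreover have "partial k i (\<lambda>y. 1 :: real) x = 0"
    using partial_eq[OF xH has_derivative_const] .
  ultimately show ?thesis by (simp add: tangent_space_def)
qed

lemma tangent_curve:
  fixes q :: "real \<Rightarrow> real \<times> 'v::euclidean_space"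
  assumes q: "(q has_vector_derivative v) (at a within I)" and a: "at a within I \<noteq> bot" "a \<in> I"
    and S: "\<And>b. b \<in> I \<Longrightarrow> q b \<in> space_form \<kappa>"
  shows "v \<in> tangent_space \<kappa> (q a)"
proof -
  let ?g = "\<lambda>b. fst (q b) * fst (q b) + \<kappa> * (snd (q b) \<bullet> snd (q b))"
  have "(?g has_derivative (\<lambda>h. fst (q a) * fst (h *\<^sub>R v) + fst (h *\<^sub>R v) * fst (q a) +
      \<kappa> * (snd (q a) \<bullet> snd (h *\<^sub>R v) + snd (h *\<^sub>R v) \<bullet> snd (q a)))) (at a within I)"
    using q unfolding has_vector_derivative_def by (intro derivative_intros)
  moreover have "(\<lambda>h. fst (q a) * fst (h *\<^sub>R v) + fst (h *\<^sub>R v) * fst (q a) +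
      \<kappa> * (snd (q a) \<bullet> snd (h *\<^sub>R v) + snd (h *\<^sub>R v) \<bullet> snd (q a))) =
    (\<lambda>h. h *\<^sub>R (2 * (fst (q a) * fst v + \<kappa> * (snd (q a) \<bullet> snd v))))"
    by (simp add: fun_eq_iff inner_commute algebra_simps)
  ultimately have "(?g has_vector_derivative 2 * (fst (q a) * fst v + \<kappa> * (snd (q a) \<bullet> snd v))) (at a within I)"
    unfolding has_vector_derivative_def by simp
  moreover have "(?g has_vector_derivative 0) (at a within I)"
    by (rule has_vector_derivative_transform[OF a(2), where f = "\<lambda>b. 1"])
      (use space_formD(1)[OF S] in \<open>auto simp: power2_eq_square\<close>)
  ultimately have "2 * (fst (q a) * fst v + \<kappa> * (snd (q a) \<bullet> snd v)) = 0"
    by (rule vector_derivative_unique_within[OF a(1)])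
  then show ?thesis by (simp add: tangent_space_def)
qed

lemma form_sym: "form \<kappa> p q = form \<kappa> q p"
  by (simp add: form_def inner_commute mult.commute)

interpretation form: bounded_bilinear "form \<kappa> :: real \<times> 'v::euclidean_space \<Rightarrow> _" for \<kappa>
  by (rule bounded_bilinear_form)

definition gram_matrix :: "real \<Rightarrow> ('n::finite \<Rightarrow> real \<times> 'v::euclidean_space) \<Rightarrow> real^'n^'n" where
  "gram_matrix \<kappa> e = (\<chi> i j. form \<kappa> (e i) (e j))"

lemma gram_matrix_mult: "(gram_matrix \<kappa> e *v v) $ j = form \<kappa> (\<Sum>i\<in>UNIV. v $ i *\<^sub>R e i) (e j)"
  by (simp add: gram_matrix_def matrix_vector_mult_def form.sum_left form.scaleR_left form_sym[of \<kappa> "e j"] mult.commute)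

lemma gram_matrix_quadratic:
  "v \<bullet> (gram_matrix \<kappa> e *v v) = form \<kappa> (\<Sum>i\<in>UNIV. v $ i *\<^sub>R e i) (\<Sum>i\<in>UNIV. v $ i *\<^sub>R e i)"
  by (simp add: inner_vec_def gram_matrix_mult form.sum_right form.scaleR_right)

text \<open>The quadratic form of a Gram matrix is the square of the combined tangent vector,
  positive by \<open>form_pos\<close>. Deleting row and column \<open>k\<close> splits it into the
  square of \<open>v $ k\<close> and the old form on \<open>flat k v\<close>.\<close>

lemma gram_matrix_pos:
  assumes \<kappa>: "\<kappa> \<in> {-1, 0, 1}" and q: "q \<in> space_form \<kappa>" and e: "\<And>i. e i \<in> tangent_space \<kappa> q"
    and inj: "inj (\<lambda>v :: real^'n. \<Sum>i\<in>UNIV. v $ i *\<^sub>R e i)"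
  shows "0 < det (gram_matrix \<kappa> e)" "0 < det (delete_rc k (gram_matrix \<kappa> e))"
proof -
  have pos: "0 < v \<bullet> (gram_matrix \<kappa> e *v v)" if "v \<noteq> 0" for v
  proof -
    have "(\<Sum>i\<in>UNIV. v $ i *\<^sub>R e i) \<noteq> (\<Sum>i\<in>UNIV. (0 :: real^'n) $ i *\<^sub>R e i)"
      using injD[OF inj, of v 0] that by auto
    then show ?thesis
      unfolding gram_matrix_quadratic
      by (intro form_pos[OF \<kappa> q]) (auto intro!: subspace_sum subspace_scale subspace_tangent_space e)
  qed
  then show "0 < det (gram_matrix \<kappa> e)" by (rule det_pos_of_pos_def)
  show "0 < det (delete_rc k (gram_matrix \<kappa> e))"
  proof (rule det_pos_of_pos_def)
    fix v :: "real^'n" assume v: "v \<noteq> 0"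
    have "(delete_rc k G *v v) $ i = (if i = k then v $ k else (G *v flat k v) $ i)" for G i
    proof -
      have "(\<Sum>j\<in>UNIV. delete_rc k G $ k $ j * v $ j) = (\<Sum>j\<in>UNIV. if j = k then v $ j else 0)"
        by (intro sum.cong) (auto simp: delete_rc_def)
      moreover have "(\<Sum>j\<in>UNIV. delete_rc k G $ i $ j * v $ j) = (\<Sum>j\<in>UNIV. G $ i $ j * flat k v $ j)" if "i \<noteq> k"
        using that by (intro sum.cong) (auto simp: delete_rc_def flat_nth)
      ultimately show ?thesis by (simp add: matrix_vector_mult_def)
    qed
    then have "v \<bullet> (delete_rc k (gram_matrix \<kappa> e) *v v) =
        (\<Sum>i\<in>UNIV. (if i = k then v $ k * v $ k else 0) + flat k v $ i * (gram_matrix \<kappa> e *v flat k v) $ i)"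
      unfolding inner_vec_def by (intro sum.cong) (auto simp: flat_nth)
    also have "\<dots> = v $ k * v $ k + flat k v \<bullet> (gram_matrix \<kappa> e *v flat k v)"
      by (simp add: sum.distrib inner_vec_def)
    also have "0 < \<dots>"
    proof (cases "flat k v = 0")
      case True
      then have "v $ k \<noteq> 0" using v flat_axis[of k v] by auto
      then show ?thesis using True by (simp add: zero_less_mult_iff) linarith
    next
      case False
      then show ?thesis using pos[of "flat k v"] by (simp add: add_nonneg_pos)
    qed
    finally show "0 < v \<bullet> (delete_rc k (gram_matrix \<kappa> e) *v v)" .
  qed
qed

text \<open>A dimension count: the frame, \<nu> and a Euclidean normal \<open>m\<close> of the
  tangent space define an injective linear map between spaces of dimension
  \<open>CARD('n) + 2\<close>, hence a surjective one. Tangency of \<open>Z\<close> removes its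
  \<open>m\<close>-component.\<close>

lemma tangent_decomposition:
  fixes e :: "'n::finite \<Rightarrow> real \<times> 'v::euclidean_space"
  assumes dim: "DIM('v) = CARD('n) + 1" and q: "q \<in> space_form \<kappa>" and e: "\<And>i. e i \<in> tangent_space \<kappa> q"
    and inj: "inj (\<lambda>v :: real^'n. \<Sum>i\<in>UNIV. v $ i *\<^sub>R e i)"
    and \<nu>: "\<nu> \<in> tangent_space \<kappa> q" "form \<kappa> \<nu> \<nu> = 1" "\<And>i. form \<kappa> \<nu> (e i) = 0"
    and Z: "Z \<in> tangent_space \<kappa> q"
  obtains X :: "real^'n" and f where "Z = (\<Sum>i\<in>UNIV. X $ i *\<^sub>R e i) + f *\<^sub>R \<nu>"
proof -
  \<comment> \<open>Half the Euclidean gradient of the equation of the space form; the tangent space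
    is its orthogonal complement for the Euclidean inner product, not for
    \<open>form\<close>.\<close>
  define m where "m = (fst q, \<kappa> *\<^sub>R snd q)"
  have tan: "v \<in> tangent_space \<kappa> q \<longleftrightarrow> m \<bullet> v = 0" for v
    by (simp add: tangent_space_def inner_prod_def m_def)
  have m: "m \<noteq> 0" using space_formD(1)[OF q] by (auto simp: prod_eq_iff m_def)
  let ?E = "\<lambda>v :: real^'n. \<Sum>i\<in>UNIV. v $ i *\<^sub>R e i"
  define L where "L = (\<lambda>(v, s, u :: real). ?E v + s *\<^sub>R \<nu> + u *\<^sub>R m)"
  have E: "?E v \<in> tangent_space \<kappa> q" for v
    by (intro subspace_sum subspace_scale subspace_tangent_space e)
  have lin: "linear L"
    by (rule linearI) (auto simp: L_def scaleR_left_distrib sum.distrib scaleR_sum_right algebra_simps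
        split: prod.splits)
  have mL: "m \<bullet> L (v, s, u) = u * (m \<bullet> m)" for v s u
    using E[of v] \<nu>(1) by (simp add: L_def inner_add_right tan)
  have "inj L"
  proof (rule linear_injective_0[OF lin, THEN iffD2], intro allI impI)
    fix z assume "L z = 0"
    then obtain v s u where z: "z = (v, s, u)" "L (v, s, u) = 0" by (cases z) auto
    have "u = 0" using mL[of v s u] z(2) m by simp
    then have "form \<kappa> \<nu> (?E v + s *\<^sub>R \<nu>) = 0" using z(2) by (simp add: L_def form.zero_right)
    then have "s = 0" using \<nu> by (simp add: form.add_right form.sum_right form.scaleR_right)
    then have "?E v = ?E 0" using z(2) \<open>u = 0\<close> by (simp add: L_def)
    then show "z = 0" using injD[OF inj, of v 0] \<open>u = 0\<close> \<open>s = 0\<close> z by (simp add: zero_prod_def)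
  qed
  then have "dim (range L) = DIM((real^'n) \<times> real \<times> real)"
    using dim_image_eq[OF lin, of UNIV] by (simp add: dim_UNIV inj_on_subset)
  then have "span (range L) = UNIV"
    using dim by (subst dim_eq_full[symmetric]) simp
  moreover have "subspace (range L)" by (rule linear_subspace_image[OF lin subspace_UNIV])
  ultimately have "Z \<in> range L" by (simp add: span_eq_iff[THEN iffD2])
  then obtain v s u where z: "Z = L (v, s, u)" by auto
  have "u = 0" using mL[of v s u] Z m unfolding z tan by simp
  then show thesis using z by (intro that[of v s]) (simp add: L_def)
qed

section \<open>First variation in a chart\<close>

text \<open>In coordinates, \<open>G\<close> is the metric and \<open>g\<close> its inverse, \<open>B i j l = \<langle>\<partial>\<^sub>i \<partial>\<^sub>j F, \<partial>\<^sub>l F\<rangle>\<close>,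
  \<open>A i j = \<langle>\<partial>\<^sub>i V, \<partial>\<^sub>j F\<rangle>\<close>, \<open>C i j = \<langle>V, \<partial>\<^sub>i \<partial>\<^sub>j F\<rangle>\<close>, \<open>dX i l = \<partial>\<^sub>i X\<^sub>l\<close>, and \<open>h\<close> is the second fundamental
  form. The right-hand side is the divergence of \<open>X\<close> without its factor \<open>sqrt (det G)\<close>.\<close>

lemma first_variation_algebra:
  fixes g G :: "real^'n^'n" and X :: "'n \<Rightarrow> real"
  assumes inv: "g ** G = mat 1" and sym: "\<And>i j. g $ i $ j = g $ j $ i"
    and B: "\<And>i j l. B i j l = B j i l"
    and A: "\<And>i j. A i j = (\<Sum>l\<in>UNIV. (B i j l + B i l j) * X l + G $ j $ l * dX i l) - C i j"
    and C: "\<And>i j. C i j = (\<Sum>l\<in>UNIV. X l * B i j l) + f * h i j"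
    and h: "(\<Sum>i\<in>UNIV. \<Sum>j\<in>UNIV. g $ i $ j * h i j) = 0"
  shows "(\<Sum>i\<in>UNIV. \<Sum>j\<in>UNIV. g $ i $ j * A i j) =
    (\<Sum>i\<in>UNIV. dX i i + X i * (\<Sum>j\<in>UNIV. \<Sum>l\<in>UNIV. g $ j $ l * B i j l))"
proof -
  \<comment> \<open>Inserting \<open>C\<close> cancels the terms \<open>B i j l\<close>. The normal
    part survives only as the multiple \<open>f\<close> of \<open>h\<close>, whose contraction with
    the inverse metric is 0 by hypothesis.\<close>
  have "A i j = (\<Sum>l\<in>UNIV. B i l j * X l) + (\<Sum>l\<in>UNIV. G $ j $ l * dX i l) - f * h i j" for i j
    unfolding A C by (simp add: sum.distrib algebra_simps)
  then have "(\<Sum>i\<in>UNIV. \<Sum>j\<in>UNIV. g $ i $ j * A i j) = (\<Sum>i\<in>UNIV. \<Sum>j\<in>UNIV. g $ i $ j *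
      ((\<Sum>l\<in>UNIV. B i l j * X l) + (\<Sum>l\<in>UNIV. G $ j $ l * dX i l) - f * h i j))"
    by (simp only:)
  also have "\<dots> =
     (\<Sum>i\<in>UNIV. \<Sum>j\<in>UNIV. g $ i $ j * (\<Sum>l\<in>UNIV. B i l j * X l)) +
     (\<Sum>i\<in>UNIV. \<Sum>j\<in>UNIV. g $ i $ j * (\<Sum>l\<in>UNIV. G $ j $ l * dX i l)) -
     f * (\<Sum>i\<in>UNIV. \<Sum>j\<in>UNIV. g $ i $ j * h i j)"
    by (simp add: distrib_left right_diff_distrib sum.distrib sum_subtractf sum_distrib_left mult.left_commute)
  also have "(\<Sum>i\<in>UNIV. \<Sum>j\<in>UNIV. g $ i $ j * (\<Sum>l\<in>UNIV. G $ j $ l * dX i l)) = (\<Sum>i\<in>UNIV. dX i i)"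
  proof (rule sum.cong[OF refl])
    fix i
    have "(\<Sum>j\<in>UNIV. g $ i $ j * (\<Sum>l\<in>UNIV. G $ j $ l * dX i l)) = (\<Sum>l\<in>UNIV. (g ** G) $ i $ l * dX i l)"
      unfolding matrix_matrix_mult_def
      by (simp add: sum_distrib_left sum_distrib_right mult.assoc) (rule sum.swap)
    then show "(\<Sum>j\<in>UNIV. g $ i $ j * (\<Sum>l\<in>UNIV. G $ j $ l * dX i l)) = dX i i"
      unfolding inv by (simp add: mat_def if_distrib[of "\<lambda>x. x * _"] cong: if_cong)
  qed
  also have "(\<Sum>i\<in>UNIV. \<Sum>j\<in>UNIV. g $ i $ j * (\<Sum>l\<in>UNIV. B i l j * X l)) =
      (\<Sum>l\<in>UNIV. X l * (\<Sum>i\<in>UNIV. \<Sum>j\<in>UNIV. g $ i $ j * B l i j))"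
  proof -
    have "(\<Sum>i\<in>UNIV. \<Sum>j\<in>UNIV. g $ i $ j * (\<Sum>l\<in>UNIV. B i l j * X l)) =
        (\<Sum>i\<in>UNIV. \<Sum>l\<in>UNIV. \<Sum>j\<in>UNIV. X l * (g $ i $ j * B l i j))"
    proof (rule sum.cong[OF refl])
      fix i
      have "(\<Sum>j\<in>UNIV. g $ i $ j * (\<Sum>l\<in>UNIV. B i l j * X l)) = (\<Sum>j\<in>UNIV. \<Sum>l\<in>UNIV. X l * (g $ i $ j * B l i j))"
        by (simp add: sum_distrib_left B[of i] mult_ac)
      also have "\<dots> = (\<Sum>l\<in>UNIV. \<Sum>j\<in>UNIV. X l * (g $ i $ j * B l i j))" by (rule sum.swap)
      finally show "(\<Sum>j\<in>UNIV. g $ i $ j * (\<Sum>l\<in>UNIV. B i l j * X l)) =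
        (\<Sum>l\<in>UNIV. \<Sum>j\<in>UNIV. X l * (g $ i $ j * B l i j))" .
    qed
    also have "\<dots> = (\<Sum>l\<in>UNIV. \<Sum>i\<in>UNIV. \<Sum>j\<in>UNIV. X l * (g $ i $ j * B l i j))" by (rule sum.swap)
    finally show ?thesis by (simp add: sum_distrib_left)
  qed
  finally show ?thesis using h by (simp add: sum.distrib)
qed

lemma C1_cong:
  assumes W: "openin (top_of_set (halfspace k)) W" and g: "C1 k W g" and eq: "\<And>x. x \<in> W \<Longrightarrow> f x = g x"
  shows "C1 k W f"
proof (rule C1_transform[OF g])
  obtain T where "open T" "W = halfspace k \<inter> T" using W by (auto simp: openin_open)
  then show "\<exists>U. open U \<and> x \<in> U \<and> (\<forall>y\<in>U \<inter> halfspace k. f y = g y)" if "x \<in> W" for x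
    using that eq by (intro exI[of _ T]) auto
qed

lemma partial_sum:
  assumes x: "x \<in> halfspace k" and f: "\<And>s. s \<in> S \<Longrightarrow> f s differentiable (at x within halfspace k)"
  shows "partial k i (\<lambda>y. \<Sum>s\<in>S. f s y) x = (\<Sum>s\<in>S. partial k i (f s) x)"
proof -
  have "((\<lambda>y. \<Sum>s\<in>S. f s y) has_derivative (\<lambda>v. \<Sum>s\<in>S. \<Sum>j\<in>UNIV. v $ j *\<^sub>R partial k j (f s) x))
      (at x within halfspace k)"
    by (intro has_derivative_sum has_derivative_partial x f)
  from partial_eq[OF x this, of i] show ?thesis by (simp add: partial_sum_axis)
qed

lemma has_derivative_sqrt_det:
  fixes A :: "'a::real_normed_vector \<Rightarrow> real^'n^'n"
  assumes A: "\<And>i j. ((\<lambda>y. A y $ i $ j) has_derivative (\<lambda>h. A' h $ i $ j)) (at x within S)"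
    and pos: "0 < det (A x)"
  shows "((\<lambda>y. sqrt (det (A y))) has_derivative (\<lambda>h. sqrt (det (A x)) / 2 * trace (matrix_inv (A x) ** A' h))) (at x within S)"
proof -
  have "((\<lambda>y. sqrt (det (A y))) has_derivative (\<lambda>h. inverse (sqrt (det (A x))) / 2 *
      (det (A x) * trace (matrix_inv (A x) ** A' h)))) (at x within S)"
    using pos by (intro has_derivative_compose[OF has_derivative_det[OF A]
        DERIV_real_sqrt[OF pos, unfolded has_field_derivative_def]]) auto
  moreover have "inverse (sqrt (det (A x))) / 2 * (det (A x) * t) = sqrt (det (A x)) / 2 * t" for t
    using pos real_sqrt_mult_self[of "det (A x)"] by (simp add: field_simps)
  ultimately show ?thesis by (simp only:)
qed

lemma trace_mult_symmetric:
  fixes g :: "real^'n^'n"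
  shows "(\<And>i j. M $ i $ j = M $ j $ i) \<Longrightarrow> trace (g ** M) = (\<Sum>i\<in>UNIV. \<Sum>j\<in>UNIV. g $ i $ j * M $ i $ j)"
  by (simp add: trace_def matrix_matrix_mult_def)

lemma matrix_inv_symmetric:
  fixes G :: "real^'n^'n"
  assumes G: "transpose G = G" and nz: "det G \<noteq> 0"
  shows "matrix_inv G $ i $ j = matrix_inv G $ j $ i"
proof -
  let ?g = "matrix_inv G"
  have "G ** transpose ?g = mat 1"
    using arg_cong[OF matrix_inv_mult(2)[OF nz], of transpose] by (simp add: matrix_transpose_mul G transpose_mat)
  then have "?g = ?g ** (G ** transpose ?g)" by simp
  also have "\<dots> = transpose ?g" by (simp add: matrix_mul_assoc matrix_inv_mult[OF nz])
  finally have "?g $ i $ j = transpose ?g $ i $ j" by (rule arg_cong)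
  then show ?thesis by (simp add: transpose_def)
qed

lemma transpose_gram_matrix: "transpose (gram_matrix \<kappa> e) = gram_matrix \<kappa> e"
  by (simp add: transpose_def gram_matrix_def form_sym vec_eq_iff)

text \<open>The situation at one fixed parameter in one chart. The velocity \<open>V\<close> is a
  given vector field here, and only space derivatives occur.\<close>

locale chart_variation =
  fixes \<kappa> :: real and k :: "'n::finite" and W :: "(real^'n) set" and F V :: "real^'n \<Rightarrow> real \<times> 'v::euclidean_space"
  assumes W: "openin (top_of_set (halfspace k)) W"
    and F: "C1 k W F" and dF: "\<And>i. C1 k W (partial k i F)"
    and sym: "\<And>i j x. x \<in> W \<Longrightarrow> partial k i (partial k j F) x = partial k j (partial k i F) x"
    and V: "C1 k W V"
    and pos: "\<And>x. x \<in> W \<Longrightarrow> 0 < det (gram_matrix \<kappa> (\<lambda>i. partial k i F x))"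
begin

definition G where "G x = gram_matrix \<kappa> (\<lambda>i. partial k i F x)"

text \<open>\<open>X\<close> is the coordinate vector of the tangential part of the velocity \<open>V\<close>.\<close>

definition X where "X x = matrix_inv (G x) *v (\<chi> j. form \<kappa> (V x) (partial k j F x))"

text \<open>The coordinate divergence of this vector density is \<open>sqrt (det (G x))\<close>
  times the Riemannian divergence of \<open>X\<close>, which allows integration by parts without
  Christoffel symbols.\<close>

definition flux where "flux i x = sqrt (det (G x)) * X x $ i"

lemma det_G:
  assumes "x \<in> W" shows "0 < det (G x)" "det (G x) \<noteq> 0"
  using pos[OF assms] by (auto simp: G_def)

lemma G_X: "x \<in> W \<Longrightarrow> (\<Sum>l\<in>UNIV. G x $ j $ l * X x $ l) = form \<kappa> (V x) (partial k j F x)"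
proof -
  assume "x \<in> W"
  then have "G x *v X x = (\<chi> j. form \<kappa> (V x) (partial k j F x))"
    by (simp add: X_def matrix_vector_mul_assoc matrix_inv_mult det_G)
  then show ?thesis by (simp add: vec_eq_iff matrix_vector_mult_def)
qed

lemma WH: "W \<subseteq> halfspace k" using F by (rule C1D)

lemma C1_G: "C1 k W (\<lambda>x. G x $ i $ j)"
  by (simp add: G_def gram_matrix_def C1_bilinear[OF bounded_bilinear_form dF dF])

lemma C1_det_G: "C1 k W (\<lambda>x. det (G x))"
  by (intro C1_det WH C1_G)

lemma C1_X: "C1 k W (\<lambda>x. X x $ i)"
proof (rule C1_cong[OF W])
  \<comment> \<open>Cramer's rule: a coefficient of the tangential part is a quotient of two
    determinants with C1 entries, so no derivative of \<open>matrix_inv\<close> is taken.\<close>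
  let ?C = "\<lambda>x. \<chi> i' j. if j = i then form \<kappa> (V x) (partial k i' F x) else G x $ i' $ j"
  have "C1 k W (\<lambda>x. ?C x $ i' $ j)" for i' j
    using C1_G C1_bilinear[OF bounded_bilinear_form V dF] by (cases "j = i") auto
  then show "C1 k W (\<lambda>x. det (?C x) * inverse (det (G x)))"
    by (intro C1_mult C1_det WH C1_inverse C1_det_G det_G)
  fix x assume x: "x \<in> W"
  have "G x *v X x = (\<chi> j. form \<kappa> (V x) (partial k j F x))"
    using G_X[OF x] by (simp add: vec_eq_iff matrix_vector_mult_def)
  then have "X x = (\<chi> l. det (\<chi> i' j. if j = l then (\<chi> j. form \<kappa> (V x) (partial k j F x)) $ i' else G x $ i' $ j) / det (G x))"
    using cramer[OF det_G(2)[OF x]] by blast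
  then show "X x $ i = det (?C x) * inverse (det (G x))"
    by (simp add: divide_inverse cong: if_cong)
qed

lemma C1_flux: "C1 k W (flux i)"
  unfolding flux_def[abs_def] by (intro C1_mult C1_sqrt C1_det_G det_G C1_X)

lemma partial_G:
  assumes x: "x \<in> W"
  shows "partial k l (\<lambda>x. G x $ i $ j) x =
    form \<kappa> (partial k l (partial k i F) x) (partial k j F x) + form \<kappa> (partial k i F x) (partial k l (partial k j F) x)"
proof -
  have "partial k l (\<lambda>x. form \<kappa> (partial k i F x) (partial k j F x)) x =
    form \<kappa> (partial k i F x) (partial k l (partial k j F) x) + form \<kappa> (partial k l (partial k i F) x) (partial k j F x)"
    using dF x WH by (intro partial_bilinear(2)[OF bounded_bilinear_form]) (auto simp: C1_def)
  then show ?thesis by (simp add: G_def gram_matrix_def)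
qed

text \<open>The left-hand side is the rate of change of the area density. The decomposition of
  \<open>V\<close> is used at the single point \<open>x\<close>, so \<nu> is never differentiated:
  the derivative falls on the products <V, d_j F>, which equal the lowered components of
  \<open>X\<close> on all of \<open>W\<close>.\<close>

lemma divergence_flux:
  assumes x: "x \<in> W" and dec: "V x = (\<Sum>i\<in>UNIV. Y $ i *\<^sub>R partial k i F x) + f *\<^sub>R \<nu>"
    and \<nu>: "\<And>i. form \<kappa> \<nu> (partial k i F x) = 0"
    and minimal: "trace (matrix_inv (G x) ** (\<chi> i j. form \<kappa> (partial k i (partial k j F) x) \<nu>)) = 0"
  shows "sqrt (det (G x)) / 2 * trace (matrix_inv (G x) **
      (\<chi> i j. form \<kappa> (partial k i V x) (partial k j F x) + form \<kappa> (partial k i F x) (partial k j V x))) =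
    (\<Sum>i\<in>UNIV. partial k i (flux i) x)"
proof -
  let ?g = "matrix_inv (G x)" and ?D = "sqrt (det (G x))"
  let ?B = "\<lambda>i j l. form \<kappa> (partial k i (partial k j F) x) (partial k l F x)"
  let ?A = "\<lambda>i j. form \<kappa> (partial k i V x) (partial k j F x)"
  let ?dX = "\<lambda>i l. partial k i (\<lambda>x. X x $ l) x"
  have xH: "x \<in> halfspace k" using x WH by auto
  have gs: "?g $ i $ j = ?g $ j $ i" for i j
    by (rule matrix_inv_symmetric) (use det_G[OF x] in \<open>simp_all add: G_def transpose_gram_matrix\<close>)
  have double: "trace (?g ** (\<chi> i j. C i j + C j i)) = 2 * (\<Sum>i\<in>UNIV. \<Sum>j\<in>UNIV. ?g $ i $ j * C i j)" for C
  proof -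
    have "trace (?g ** (\<chi> i j. C i j + C j i)) = (\<Sum>i\<in>UNIV. \<Sum>j\<in>UNIV. ?g $ i $ j * (C i j + C j i))"
      by (subst trace_mult_symmetric) (simp_all add: add.commute)
    also have "\<dots> = (\<Sum>i\<in>UNIV. \<Sum>j\<in>UNIV. ?g $ i $ j * C i j) + (\<Sum>i\<in>UNIV. \<Sum>j\<in>UNIV. ?g $ j $ i * C j i)"
      using gs by (simp add: distrib_left sum.distrib)
    also have "(\<Sum>i\<in>UNIV. \<Sum>j\<in>UNIV. ?g $ j $ i * C j i) = (\<Sum>i\<in>UNIV. \<Sum>j\<in>UNIV. ?g $ i $ j * C i j)"
      by (rule sum.swap)
    finally show ?thesis by simp
  qed
  have dD: "partial k l (\<lambda>x. sqrt (det (G x))) x = ?D * (\<Sum>i\<in>UNIV. \<Sum>j\<in>UNIV. ?g $ i $ j * ?B l i j)" for l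
  proof -
    have "((\<lambda>y. G y $ i $ j) has_derivative (\<lambda>v. (\<chi> i j. \<Sum>l\<in>UNIV. v $ l *\<^sub>R partial k l (\<lambda>x. G x $ i $ j) x) $ i $ j))
        (at x within halfspace k)" for i j
      using C1D(2)[OF C1_G x] by simp
    from partial_eq[OF xH has_derivative_sqrt_det[OF this det_G(1)[OF x]], of l]
    have "partial k l (\<lambda>x. sqrt (det (G x))) x = ?D / 2 * trace (?g ** (\<chi> i j. ?B l i j + ?B l j i))"
      unfolding partial_sum_axis partial_G[OF x] by (simp add: form_sym[of _ "partial k _ F x"])
    then show ?thesis unfolding double by simp
  qed
  have XY: "X x = Y"
  proof -
    have "(\<chi> j. form \<kappa> (V x) (partial k j F x)) = G x *v Y"
      by (simp add: vec_eq_iff G_def gram_matrix_mult dec form.add_left form.scaleR_left \<nu>)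
    then show ?thesis
      by (simp add: X_def matrix_vector_mul_assoc matrix_inv_mult det_G[OF x])
  qed
  have sumA: "(\<Sum>i\<in>UNIV. \<Sum>j\<in>UNIV. ?g $ i $ j * ?A i j) =
      (\<Sum>i\<in>UNIV. ?dX i i + X x $ i * (\<Sum>j\<in>UNIV. \<Sum>l\<in>UNIV. ?g $ j $ l * ?B i j l))"
  proof (rule first_variation_algebra[where C = "\<lambda>i j. form \<kappa> (V x) (partial k i (partial k j F) x)" and f = f
        and h = "\<lambda>i j. form \<kappa> (partial k i (partial k j F) x) \<nu>" and G = "G x" and g = ?g and A = ?A and B = ?B and X = "\<lambda>l. X x $ l" and dX = ?dX])
    show "?g ** G x = mat 1" by (rule matrix_inv_mult(2)[OF det_G(2)[OF x]])
    show "?B i j l = ?B j i l" for i j l using sym[OF x] by simp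
    show "form \<kappa> (V x) (partial k i (partial k j F) x) =
        (\<Sum>l\<in>UNIV. X x $ l * ?B i j l) + f * form \<kappa> (partial k i (partial k j F) x) \<nu>" for i j
      by (subst dec) (simp add: XY form.add_left form.sum_left form.scaleR_left form_sym[of \<kappa> _ "partial k i (partial k j F) x"])
    show "(\<Sum>i\<in>UNIV. \<Sum>j\<in>UNIV. ?g $ i $ j * form \<kappa> (partial k i (partial k j F) x) \<nu>) = 0"
      using minimal sym[OF x] by (subst (asm) trace_mult_symmetric) simp_all
    show "?A i j = (\<Sum>l\<in>UNIV. (?B i j l + ?B i l j) * X x $ l + G x $ j $ l * ?dX i l) -
        form \<kappa> (V x) (partial k i (partial k j F) x)" for i j
    proof -
      have "partial k i (\<lambda>y. form \<kappa> (V y) (partial k j F y)) x =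
          form \<kappa> (V x) (partial k i (partial k j F) x) + ?A i j"
        using dF V x xH by (intro partial_bilinear(2)[OF bounded_bilinear_form]) (auto simp: C1_def)
      moreover have "partial k i (\<lambda>y. form \<kappa> (V y) (partial k j F y)) x =
          partial k i (\<lambda>y. \<Sum>l\<in>UNIV. G y $ j $ l * X y $ l) x"
      proof (rule partial_cong[OF W x])
        have "C1 k W (\<lambda>y. \<Sum>l\<in>UNIV. G y $ j $ l * X y $ l)" by (intro C1_sum WH C1_mult C1_G C1_X)
        then show "(\<lambda>y. \<Sum>l\<in>UNIV. G y $ j $ l * X y $ l) differentiable at x within halfspace k"
          using x by (auto simp: C1_def)
      qed (simp add: G_X)
      moreover have "partial k i (\<lambda>y. \<Sum>l\<in>UNIV. G y $ j $ l * X y $ l) x =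
          (\<Sum>l\<in>UNIV. partial k i (\<lambda>y. G y $ j $ l * X y $ l) x)"
        using C1_mult[OF C1_G C1_X] x by (intro partial_sum[OF xH]) (auto simp: C1_def)
      moreover have "partial k i (\<lambda>y. G y $ j $ l * X y $ l) x = (?B i j l + ?B i l j) * X x $ l + G x $ j $ l * ?dX i l" for l
        using C1_G C1_X x
        by (subst partial_mult[OF xH]) (auto simp: C1_def partial_G[OF x] form_sym[of _ "partial k j F x"] algebra_simps)
      ultimately show ?thesis by simp
    qed
  qed (rule gs)
  have pflux: "partial k i (flux i) x = ?D * (?dX i i + X x $ i * (\<Sum>j\<in>UNIV. \<Sum>l\<in>UNIV. ?g $ j $ l * ?B i j l))" for i
  proof -
    have "(\<lambda>x. sqrt (det (G x))) differentiable at x within halfspace k" "(\<lambda>x. X x $ i) differentiable at x within halfspace k"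
      using C1_sqrt[OF C1_det_G det_G(1)] C1_X x by (auto simp: C1_def)
    from partial_mult[OF xH this] show ?thesis
      unfolding flux_def[abs_def] dD by (simp add: algebra_simps)
  qed
  have tr: "trace (?g ** (\<chi> i j. ?A i j + form \<kappa> (partial k i F x) (partial k j V x))) =
      2 * (\<Sum>i\<in>UNIV. \<Sum>j\<in>UNIV. ?g $ i $ j * ?A i j)"
    unfolding double[symmetric] by (simp add: form_sym[of _ "partial k _ F x"])
  have "?D / 2 * trace (?g ** (\<chi> i j. ?A i j + form \<kappa> (partial k i F x) (partial k j V x))) =
      ?D * (\<Sum>i\<in>UNIV. \<Sum>j\<in>UNIV. ?g $ i $ j * ?A i j)"
    unfolding tr by simp
  also have "\<dots> = (\<Sum>i\<in>UNIV. partial k i (flux i) x)"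
    by (simp only: sumA pflux sum_distrib_left[of ?D])
  finally show ?thesis .
qed

text \<open>The coordinates of the conormal are a multiple of the \<open>k\<close>-th column of the inverse metric, whose
  \<open>k\<close>-th entry is \<open>det (delete_rc k G) / det G\<close>.\<close>

lemma boundary_flux:
  assumes x: "x \<in> W" and \<eta>: "\<eta> = (\<Sum>i\<in>UNIV. v $ i *\<^sub>R partial k i F x)" "form \<kappa> \<eta> \<eta> = 1" "v $ k < 0"
    "\<And>i. i \<noteq> k \<Longrightarrow> form \<kappa> \<eta> (partial k i F x) = 0"
  shows "flux k x = - (sqrt (det (delete_rc k (G x))) * form \<kappa> \<eta> (V x))"
proof -
  let ?g = "matrix_inv (G x)" and ?c = "form \<kappa> \<eta> (partial k k F x)"
  have gs: "?g $ i $ j = ?g $ j $ i" for i j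
    by (rule matrix_inv_symmetric) (use det_G[OF x] in \<open>simp_all add: G_def transpose_gram_matrix\<close>)
  have Gv: "G x *v v = ?c *\<^sub>R axis k 1"
    using \<eta>(4) by (auto simp: vec_eq_iff G_def gram_matrix_mult \<eta>(1)[symmetric] axis_def)
  have "1 = form \<kappa> \<eta> (\<Sum>i\<in>UNIV. v $ i *\<^sub>R partial k i F x)" using \<eta>(1,2) by simp
  also have "\<dots> = (\<Sum>i\<in>UNIV. if i = k then v $ k * ?c else 0)"
    unfolding form.sum_right form.scaleR_right using \<eta>(4) by (intro sum.cong) auto
  \<comment> \<open>The tangential components of the conormal vanish, so its unit length alone fixes
    its product with the transversal coordinate vector.\<close>
  finally have c: "v $ k * ?c = 1" by simp
  have "v = ?g *v (G x *v v)" by (simp add: matrix_vector_mul_assoc matrix_inv_mult det_G[OF x])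
  also have "\<dots> = ?c *\<^sub>R (?g *v axis k 1)"
    unfolding Gv by (simp add: matrix_vector_mult_scaleR)
  finally have v': "v = ?c *\<^sub>R (?g *v axis k 1)" .
  have v: "v $ j = ?c * ?g $ j $ k" for j
    using arg_cong[OF v', of "\<lambda>v. v $ j"] by (simp add: matrix_vector_mul_component inner_axis)
  have vg: "?g $ j $ k = v $ k * v $ j" for j
    using v[of j] c by (metis mult.assoc mult_1)
  have "(v $ k)\<^sup>2 = det (delete_rc k (G x)) / det (G x)"
    using vg[of k] matrix_inv_diag[OF det_G(2)[OF x], of k] by (simp add: power2_eq_square)
  then have "sqrt (det (delete_rc k (G x)) / det (G x)) = \<bar>v $ k\<bar>"
    by (metis real_sqrt_abs)
  \<comment> \<open>The minus sign is the outward orientation: \<open>v $ k\<close> is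
    negative.\<close>
  then have "sqrt (det (delete_rc k (G x))) = - (v $ k * sqrt (det (G x)))"
    using det_G(1)[OF x] \<eta>(3) by (simp add: real_sqrt_divide field_simps)
  moreover have "X x $ k = v $ k * form \<kappa> \<eta> (V x)"
  proof -
    have "X x $ k = (\<Sum>j\<in>UNIV. ?g $ k $ j * form \<kappa> (V x) (partial k j F x))"
      by (simp add: X_def matrix_vector_mult_def)
    also have "\<dots> = (\<Sum>j\<in>UNIV. v $ k * (v $ j * form \<kappa> (V x) (partial k j F x)))"
      unfolding gs[of k] vg by (simp add: mult.assoc)
    also have "\<dots> = v $ k * form \<kappa> \<eta> (V x)"
      by (simp add: \<eta>(1) form.sum_left form.scaleR_left form_sym[of \<kappa> "V x"] sum_distrib_left)
    finally show ?thesis .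
  qed
  ultimately show ?thesis by (simp add: flux_def)
qed

end

section \<open>Curves on geodesic spheres\<close>

lemma space_form_1: "q \<in> space_form 1 \<longleftrightarrow> q \<bullet> q = 1"
  by (cases q) (simp add: space_form_def inner_prod_def power2_eq_square)

text \<open>The condition \<open>is_gradient\<close> is tested along curves that stay in the space
  form for all times, so each tangent vector must be realised by one: a curve on the hyperboloid
  over a straight line, a straight line, or a straight line projected radially to the
  sphere.\<close>

lemma curve_with_velocity:
  fixes q :: "real \<times> 'v::euclidean_space"
  assumes \<kappa>: "\<kappa> \<in> {-1, 0, 1}" and q: "q \<in> space_form \<kappa>" and v: "v \<in> tangent_space \<kappa> q"
  obtains \<gamma> where "\<And>t. \<gamma> t \<in> space_form \<kappa>" "\<gamma> 0 = q" "(\<gamma> has_vector_derivative v) (at 0)"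
proof -
  obtain t x where qt: "q = (t, x)" by (cases q)
  obtain s w where vs: "v = (s, w)" by (cases v)
  have tan: "t * s + \<kappa> * (x \<bullet> w) = 0" using v by (simp add: tangent_space_def qt vs)
  consider "\<kappa> = -1" | "\<kappa> = 0" | "\<kappa> = 1" using \<kappa> by auto
  then show thesis
  proof cases
    case 1
    have t: "t\<^sup>2 = 1 + x \<bullet> x" "0 < t" using space_formD[OF q] 1 by (auto simp: qt)
    then have st: "sqrt (1 + x \<bullet> x) = t" by (metis real_sqrt_unique less_imp_le)
    have s: "s = (x \<bullet> w) / t" using tan 1 t(2) by (simp add: field_simps)
    let ?y = "\<lambda>h. x + h *\<^sub>R w"
    have y: "(?y has_vector_derivative w) (at 0)"
      by (auto intro!: derivative_eq_intros)
    have "((\<lambda>h. 1 + ?y h \<bullet> ?y h) has_real_derivative 2 * (x \<bullet> w)) (at 0)"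
      by (auto intro!: derivative_eq_intros simp: inner_add_left inner_add_right inner_commute)
    then have "((\<lambda>h. sqrt (1 + ?y h \<bullet> ?y h)) has_real_derivative s) (at 0)"
      by (rule DERIV_chain2[OF DERIV_real_sqrt, THEN DERIV_cong, rotated])
        (simp_all add: st s field_simps add_pos_nonneg)
    then show thesis
      using y st by (intro that[of "\<lambda>h. (sqrt (1 + ?y h \<bullet> ?y h), ?y h)"])
        (auto simp: space_form_def 1 qt vs add_pos_nonneg has_real_derivative_iff_has_vector_derivative
          intro!: has_vector_derivative_Pair)
  next
    case 2
    then have "t = 1" "s = 0" using space_formD[OF q] tan by (auto simp: qt power2_eq_1_iff)
    then show thesis
      by (intro that[of "\<lambda>h. (1, x + h *\<^sub>R w)"])
        (auto simp: space_form_def 2 qt vs intro!: has_vector_derivative_Pair derivative_eq_intros)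
  next
    case 3
    have qq: "q \<bullet> q = 1" and qv: "q \<bullet> v = 0"
      using q tan by (simp_all add: space_form_1 3 qt vs)
    let ?s = "\<lambda>h. inverse (sqrt (1 + h\<^sup>2 * (v \<bullet> v)))"
    have pos: "0 < 1 + h\<^sup>2 * (v \<bullet> v)" for h by (simp add: add_pos_nonneg)
    have "(?s has_real_derivative 0) (at 0)"
      by (auto intro!: derivative_eq_intros)
    then have "((\<lambda>h. ?s h *\<^sub>R (q + h *\<^sub>R v)) has_vector_derivative ?s 0 *\<^sub>R v + 0 *\<^sub>R (q + 0 *\<^sub>R v)) (at 0)"
      by (intro has_vector_derivative_scaleR) (auto intro!: derivative_eq_intros)
    moreover have "?s h *\<^sub>R (q + h *\<^sub>R v) \<in> space_form \<kappa>" for h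
    proof -
      have "(q + h *\<^sub>R v) \<bullet> (q + h *\<^sub>R v) = 1 + h\<^sup>2 * (v \<bullet> v)"
        by (simp add: inner_add_left inner_add_right qq qv inner_commute[of v q] power2_eq_square)
      then have "(?s h *\<^sub>R (q + h *\<^sub>R v)) \<bullet> (?s h *\<^sub>R (q + h *\<^sub>R v)) = ?s h * (?s h * (1 + h\<^sup>2 * (v \<bullet> v)))"
        by (simp only: inner_scaleR_left inner_scaleR_right)
      also have "\<dots> = 1"
        using pos[of h] real_sqrt_mult_self[of "1 + h\<^sup>2 * (v \<bullet> v)"] by (simp add: field_simps)
      finally show ?thesis unfolding 3 space_form_1 .
    qed
    ultimately show thesis by (intro that[of "\<lambda>h. ?s h *\<^sub>R (q + h *\<^sub>R v)"]) auto
  qed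
qed

text \<open>These bounds put the arguments of \<open>arccos\<close> and \<open>arcosh\<close> in
  \<open>space_dist\<close> into the ranges where cos and cosh undo them. The hyperbolic bound
  follows from (s t)^2 - (1 + |x| |y|)^2 = (|x| - |y|)^2.\<close>

lemma form_bounds:
  assumes "p \<in> space_form \<kappa>" "q \<in> space_form \<kappa>"
  shows "\<kappa> = 1 \<Longrightarrow> \<bar>form \<kappa> p q\<bar> \<le> 1" and "\<kappa> = -1 \<Longrightarrow> 1 \<le> - form \<kappa> p q"
proof -
  show "\<bar>form \<kappa> p q\<bar> \<le> 1" if "\<kappa> = 1"
  proof -
    have "norm p = 1" "norm q = 1" using assms that by (simp_all add: space_form_1 norm_eq_sqrt_inner)
    then show ?thesis
      using Cauchy_Schwarz_ineq2[of p q] that by (simp add: form_def inner_prod_def)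
  qed
  show "1 \<le> - form \<kappa> p q" if "\<kappa> = -1"
  proof -
    obtain s x t y where pq: "p = (s, x)" "q = (t, y)" by (cases p, cases q)
    have s: "s\<^sup>2 = 1 + x \<bullet> x" "0 < s" and t: "t\<^sup>2 = 1 + y \<bullet> y" "0 < t"
      using space_formD[OF assms(1)] space_formD[OF assms(2)] that by (auto simp: pq)
    have "(1 + norm x * norm y)\<^sup>2 \<le> (s * t)\<^sup>2"
    proof -
      have "(s * t)\<^sup>2 = (1 + (norm x)\<^sup>2) * (1 + (norm y)\<^sup>2)"
        by (simp add: power_mult_distrib s(1) t(1) power2_norm_eq_inner)
      then have "(s * t)\<^sup>2 - (1 + norm x * norm y)\<^sup>2 = (norm x - norm y)\<^sup>2"
        by (simp add: power2_eq_square algebra_simps)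
      then show ?thesis by (metis diff_ge_0_iff_ge zero_le_power2)
    qed
    then have "1 + norm x * norm y \<le> s * t"
      by (rule power2_le_imp_le) (simp add: less_imp_le[OF mult_pos_pos[OF s(2) t(2)]])
    then show ?thesis
      using norm_cauchy_schwarz[of x y] by (simp add: form_def that pq)
  qed
qed

lemma continuous_on_space_dist:
  assumes \<kappa>: "\<kappa> \<in> {-1, 0, 1}" and p: "p \<in> space_form \<kappa>"
  shows "continuous_on (space_form \<kappa>) (space_dist \<kappa> p)"
proof -
  have f: "continuous_on (space_form \<kappa>) (\<lambda>q. form \<kappa> p q)"
    unfolding form_def by (intro continuous_intros)
  consider "\<kappa> = -1" | "\<kappa> = 0" | "\<kappa> = 1" using \<kappa> by auto
  then show ?thesis
  proof cases
    case 1
    have "continuous_on (space_form \<kappa>) (\<lambda>q. arcosh (- form \<kappa> p q))"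
      using f form_bounds(2)[OF p] 1
      by (intro continuous_on_compose2[OF continuous_on_arcosh[of "{1..}"]] continuous_intros) auto
    then show ?thesis using 1 by (simp add: space_dist_def[abs_def])
  next
    case 2
    then show ?thesis by (simp add: space_dist_def[abs_def]) (intro continuous_intros)
  next
    case 3
    have "continuous_on (space_form \<kappa>) (\<lambda>q. arccos (form \<kappa> p q))"
      using f form_bounds(1)[OF p] 3 by (intro continuous_on_arccos) (auto simp: abs_le_iff)
    then show ?thesis using 3 by (simp add: space_dist_def[abs_def])
  qed
qed

text \<open>The sphere is defined as a topological frontier. By continuity of the distance the ball
  is closed, and points at distance less than \<open>r\<close> are interior, so a frontier point is
  at distance exactly \<open>r\<close>.\<close>

lemma geo_sphereD:
  assumes \<kappa>: "\<kappa> \<in> {-1, 0, 1}" and p: "p \<in> space_form \<kappa>" and q: "q \<in> geo_sphere \<kappa> p r"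
  shows "q \<in> space_form \<kappa>" "space_dist \<kappa> p q = r"
proof -
  let ?S = "space_form \<kappa>" and ?d = "space_dist \<kappa> p"
  let ?T = "top_of_set ?S"
  note cont = continuous_on_space_dist[OF \<kappa> p]
  have "closedin ?T (?S \<inter> ?d -` {..r})" by (rule continuous_closedin_preimage[OF cont]) simp
  moreover have ball: "geo_ball \<kappa> p r = ?S \<inter> ?d -` {..r}" by (auto simp: geo_ball_def)
  ultimately have "?T closure_of geo_ball \<kappa> p r = geo_ball \<kappa> p r" by (simp add: closure_of_closedin)
  then have q': "q \<in> geo_ball \<kappa> p r" "q \<notin> ?T interior_of geo_ball \<kappa> p r"
    using q by (auto simp: geo_sphere_def frontier_of_def)
  then show "q \<in> ?S" by (simp add: geo_ball_def)
  have "openin ?T (?S \<inter> ?d -` {..<r})" by (rule continuous_openin_preimage_gen[OF cont]) simp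
  then have "?S \<inter> ?d -` {..<r} \<subseteq> ?T interior_of geo_ball \<kappa> p r"
    by (intro interior_of_maximal) (auto simp: ball)
  then have "\<not> ?d q < r" using q'(2) \<open>q \<in> ?S\<close> by auto
  then show "?d q = r" using q'(1) by (simp add: geo_ball_def)
qed

text \<open>\<open>space_dist\<close> is differentiable only along the space form; composing it with \<open>h\<close> gives the restriction
  of a function \<open>L\<close> that is differentiable in the ambient space.\<close>

lemma radial_velocity_aux:
  assumes \<kappa>: "\<kappa> \<in> {-1, 0, 1}"
    and q: "(q has_vector_derivative v) (at a within I)" and a: "at a within I \<noteq> bot" "a \<in> I"
    and S: "\<And>b. b \<in> I \<Longrightarrow> q b \<in> space_form \<kappa>" and d: "\<And>b. b \<in> I \<Longrightarrow> space_dist \<kappa> p (q b) = r b"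
    and r: "(r has_real_derivative r') (at a within I)"
    and \<eta>: "is_gradient \<kappa> (space_dist \<kappa> p) (q a) \<eta>"
    and L: "\<And>y. y \<in> space_form \<kappa> \<Longrightarrow> L y = h (space_dist \<kappa> p y)" "(L has_derivative L') (at (q a))"
    and h: "(h has_real_derivative h') (at (r a))" "h' \<noteq> 0"
  shows "form \<kappa> \<eta> v = r'"
proof -
  interpret L': bounded_linear L' by (rule has_derivative_bounded_linear[OF L(2)])
  have v: "v \<in> tangent_space \<kappa> (q a)" by (rule tangent_curve[OF q a S])
  \<comment> \<open>The curve \<open>q\<close> itself is tied to \<open>I\<close>, with a derivative
    possibly one-sided, and does not qualify for \<open>is_gradient\<close>. A curve through the
    same point with the same velocity does, and both see the same value \<open>L' v\<close>.\<close>
  obtain \<gamma> where \<gamma>: "\<And>t. \<gamma> t \<in> space_form \<kappa>" "\<gamma> 0 = q a" "(\<gamma> has_vector_derivative v) (at 0)"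
    using curve_with_velocity[OF \<kappa> S[OF a(2)] v] by blast
  have "((\<lambda>t. space_dist \<kappa> p (\<gamma> t)) has_real_derivative form \<kappa> \<eta> v) (at 0)"
    using \<eta> \<gamma> unfolding is_gradient_def by blast
  moreover have "(h has_real_derivative h') (at (space_dist \<kappa> p (\<gamma> 0)))"
    using h d[OF a(2)] \<gamma>(2) by simp
  ultimately have "((\<lambda>t. h (space_dist \<kappa> p (\<gamma> t))) has_real_derivative h' * form \<kappa> \<eta> v) (at 0)"
    by (rule DERIV_chain2[rotated])
  moreover have "((\<lambda>t. L (\<gamma> t)) has_real_derivative L' v) (at 0)"
  proof -
    have "((\<lambda>t. L (\<gamma> t)) has_derivative (\<lambda>t. L' (t *\<^sub>R v))) (at 0)"
      by (rule has_derivative_compose[OF \<gamma>(3)[unfolded has_vector_derivative_def]]) (simp add: \<gamma> L)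
    then show ?thesis by (simp add: has_field_derivative_def L'.scaleR mult_commute_abs)
  qed
  ultimately have 1: "h' * form \<kappa> \<eta> v = L' v"
    using L(1)[OF \<gamma>(1)] DERIV_unique by simp
  have "((\<lambda>b. L (q b)) has_derivative (\<lambda>t. L' (t *\<^sub>R v))) (at a within I)"
    by (rule has_derivative_compose[OF q[unfolded has_vector_derivative_def] L(2)])
  then have "((\<lambda>b. L (q b)) has_vector_derivative L' v) (at a within I)"
    by (simp add: has_vector_derivative_def L'.scaleR)
  moreover have "((\<lambda>b. L (q b)) has_vector_derivative h' * r') (at a within I)"
  proof (rule has_vector_derivative_transform[OF a(2)])
    show "((\<lambda>b. h (r b)) has_vector_derivative h' * r') (at a within I)"
      unfolding has_real_derivative_iff_has_vector_derivative[symmetric] by (rule DERIV_chain2[OF h(1) r])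
  qed (simp add: L(1) S d)
  ultimately have "L' v = h' * r'" by (rule vector_derivative_unique_within[OF a(1)])
  with 1 h(2) show ?thesis by simp
qed

text \<open>The auxiliary function \<open>h\<close> is cosh, the square, or cos. Its derivative at
  \<open>r a\<close> is nonzero because \<open>r a\<close> is positive and, on the sphere, less than
  \<open>pi\<close>.\<close>

lemma radial_velocity:
  assumes \<kappa>: "\<kappa> \<in> {-1, 0, 1}" and p: "p \<in> space_form \<kappa>"
    and q: "(q has_vector_derivative v) (at a within I)" and a: "at a within I \<noteq> bot" "a \<in> I"
    and S: "\<And>b. b \<in> I \<Longrightarrow> q b \<in> geo_sphere \<kappa> p (r b)"
    and r: "(r has_real_derivative r') (at a within I)" "0 < r a" "\<kappa> = 1 \<Longrightarrow> r a < pi"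
    and \<eta>: "is_gradient \<kappa> (space_dist \<kappa> p) (q a) \<eta>"
  shows "form \<kappa> \<eta> v = r'"
proof -
  note aux = radial_velocity_aux[OF \<kappa> q a geo_sphereD(1)[OF \<kappa> p S] geo_sphereD(2)[OF \<kappa> p S] r(1) \<eta>]
  have f: "(form \<kappa> p has_derivative form \<kappa> p) (at y)" for y
    by (intro bounded_linear_imp_has_derivative bounded_bilinear.bounded_linear_right[OF bounded_bilinear_form])
  consider "\<kappa> = -1" | "\<kappa> = 0" | "\<kappa> = 1" using \<kappa> by auto
  then show ?thesis
  proof cases
    case 1
    show ?thesis
    proof (rule aux[where L = "\<lambda>y. - form \<kappa> p y" and h = cosh and h' = "sinh (r a)"])
      show "- form \<kappa> p y = cosh (space_dist \<kappa> p y)" if "y \<in> space_form \<kappa>" for y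
        using form_bounds(2)[OF p that 1] 1 by (simp add: space_dist_def)
      show "sinh (r a) \<noteq> 0" using r(2) by simp
      show "(cosh has_real_derivative sinh (r a)) (at (r a))" by (auto intro!: derivative_eq_intros)
    qed (assumption | rule has_derivative_minus[OF f])+
  next
    case 2
    show ?thesis
    proof (rule aux[where L = "\<lambda>y. (snd p - snd y) \<bullet> (snd p - snd y)" and h = "\<lambda>t. t\<^sup>2" and h' = "2 * r a"])
      show "(snd p - snd y) \<bullet> (snd p - snd y) = (space_dist \<kappa> p y)\<^sup>2" if "y \<in> space_form \<kappa>" for y
        using 2 by (simp add: space_dist_def dist_norm power2_norm_eq_inner)
      show "((\<lambda>t. t\<^sup>2) has_real_derivative 2 * r a) (at (r a))" by (auto intro!: derivative_eq_intros)
      show "((\<lambda>y. (snd p - snd y) \<bullet> (snd p - snd y)) has_derivative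
          (\<lambda>h. (snd p - snd (q a)) \<bullet> (- snd h) + (- snd h) \<bullet> (snd p - snd (q a)))) (at (q a))"
        by (auto intro!: derivative_eq_intros)
    qed (assumption | use r(2) in simp)+
  next
    case 3
    show ?thesis
    proof (rule aux[where L = "form \<kappa> p" and h = cos and h' = "- sin (r a)"])
      show "form \<kappa> p y = cos (space_dist \<kappa> p y)" if "y \<in> space_form \<kappa>" for y
        using form_bounds(1)[OF p that 3] 3 by (simp add: space_dist_def abs_le_iff)
      show "- sin (r a) \<noteq> 0" using sin_gt_zero[of "r a"] r(2,3) 3 by simp
      show "(cos has_real_derivative - sin (r a)) (at (r a))" by (auto intro!: derivative_eq_intros)
    qed (assumption | rule f)+
  qed
qed

context atlas begin

lemma partial_zero_off_support:
  assumes d: "d \<in> A" and K: "closed K" and w: "\<And>q. q \<notin> K \<Longrightarrow> w q = (0::real)"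
    and y: "y \<in> chart_image d" "chart_inv d y \<notin> K"
  shows "partial k i (local_rep d w) y = 0"
proof -
  have "openin (top_of_set M) (M - K)"
    using K by (auto simp: openin_open intro!: exI[of _ "- K"])
  then have W: "openin (top_of_set (halfspace k)) (snd d ` (fst d \<inter> (M - K)))"
    by (rule openin_overlap[OF d])
  have y': "y \<in> snd d ` (fst d \<inter> (M - K))"
    using y overlap_mem[OF d] chart_subset(1)[OF d] chart_inv(3)[OF d] by blast
  have "partial k i (local_rep d w) y = partial k i (\<lambda>x. 0 :: real) y"
    by (rule partial_cong[OF W y']) (auto simp: local_rep_def w d)
  also have "\<dots> = 0"
    using y chart_subset(2)[OF d] by (intro partial_eq) auto
  finally show ?thesis .
qed

end

text \<open>By thickening, the set has at least the Lebesgue measure of an open slab over it, and a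
  nonempty open set is not negligible.\<close>

lemma emeasure_hyperplane_lborel_pos:
  fixes x :: "real^'n"
  assumes T: "open T" "x \<in> T" "x $ k = 0"
  shows "0 < emeasure (hyperplane_lborel k) (T \<inter> {x. x $ k = 0})"
proof -
  let ?S = "T \<inter> {x. x $ k = 0}"
  let ?O = "flat k -` T \<inter> {y. 0 < y $ k} \<inter> {y. y $ k < 1}"
  have S: "?S \<in> sets borel"
    using T(1) by (intro sets.Int borel_open borel_closed closed_Collect_eq continuous_intros)
  have "continuous_on UNIV (flat k :: real^'n \<Rightarrow> real^'n)"
    unfolding flat_def[abs_def]
  proof (rule continuous_on_vec_lambda)
    show "continuous_on UNIV (\<lambda>x :: real^'n. if i = k then 0 else x $ i)" for i
      by (cases "i = k") (auto intro: continuous_intros)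
  qed
  then have O: "open ?O"
    by (intro open_Int open_vimage T open_Collect_less continuous_intros) auto
  \<comment> \<open>The lift of \<open>x\<close> to height 1/2, in the middle of the slab, shows
    that the slab is nonempty.\<close>
  have "flat k (x + (1/2) *\<^sub>R axis k 1) = x"
    using T(3) by (simp add: vec_eq_iff flat_nth axis_def)
  then have "x + (1/2) *\<^sub>R axis k 1 \<in> ?O"
    using T by (simp add: axis_def)
  then have "\<not> negligible ?O" using open_not_negligible[OF O] by blast
  then have "emeasure lborel ?O \<noteq> 0"
    using O by (auto simp: negligible_iff_null_sets null_sets_completion_iff intro!: null_setsI)
  moreover have "emeasure lborel ?O \<le> emeasure (hyperplane_lborel k) ?S"
  proof -
    have "emeasure lborel ?O = (\<integral>\<^sup>+y. indicator ?O y \<partial>lborel)" using O by simp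
    also have "\<dots> \<le> (\<integral>\<^sup>+y. indicator ?S (flat k y) * indicator {y. y $ k \<in> {0..1}} y \<partial>lborel)"
      by (intro nn_integral_mono) (auto simp: flat_nth split: split_indicator)
    also have "\<dots> = (\<integral>\<^sup>+y. indicator ?S y \<partial>hyperplane_lborel k)"
      using S by (intro nn_integral_hyperplane_thicken[symmetric]) simp
    finally show ?thesis using S by simp
  qed
  ultimately show ?thesis by (metis not_gr_zero bot.extremum_uniqueI bot_ennreal)
qed

context atlas_metric begin

text \<open>A single chart suffices for positivity: a positive density is integrated over a nonempty
  relatively open piece of the hyperplane.\<close>

lemma boundary_volume_pos:
  assumes "boundary k A \<noteq> {}"
  shows "0 < induced_boundary_volume \<kappa> k A F"
proof -
  let ?\<mu> = "boundary_volume_measure \<kappa> k A F"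
  obtain p where p: "p \<in> boundary k A" using assms by auto
  then obtain c where c: "c \<in> A" "p \<in> fst c" by (auto simp: boundary_def)
  let ?B = "fst c \<inter> boundary k A"
  obtain T where T: "open T" "chart_image c = halfspace k \<inter> T"
    using chart(2)[OF c(1)] by (auto simp: openin_open)
  have img: "snd c ` ?B = T \<inter> {x. x $ k = 0}"
    using boundary_image[OF c(1)] T(2) by (auto simp: halfspace_def)
  have "sets ?\<mu> = sets bdry.N" using boundary_volume_measure by (simp add: bdry.density_measure_def)
  moreover have B: "?B \<in> sets bdry.N"
    using borel_chart_domain[OF c(1)] bdry.borel_X by (simp add: bdry.sets_N)
  ultimately have sub: "emeasure ?\<mu> ?B \<le> emeasure ?\<mu> (boundary k A)"
    and em: "emeasure ?\<mu> ?B =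
      (\<integral>\<^sup>+x\<in>snd c ` ?B. ennreal (sqrt (det (boundary_gram \<kappa> k c F x))) \<partial>hyperplane_lborel k)"
    using boundary_volume_measure c(1) bdry.borel_X
    by (simp_all add: emeasure_mono bdry.sets_N) (simp add: bdry.density_measure_def bdry.sets_N)
  have "emeasure ?\<mu> ?B \<noteq> 0"
  proof
    let ?f = "\<lambda>x. indicator (snd c ` ?B) x * sqrt (det (boundary_gram \<kappa> k c F x))"
    have pos: "0 < sqrt (det (boundary_gram \<kappa> k c F x))" if "x \<in> snd c ` ?B" for x
      using that gram_pos(2)[OF c(1), of x] by auto
    assume "emeasure ?\<mu> ?B = 0"
    then have "(\<integral>\<^sup>+x. ennreal (?f x) \<partial>hyperplane_lborel k) = 0"
      unfolding em set_nn_integral_real by simp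
    moreover have "?f \<in> borel_measurable borel"
      using borel_measurable_continuous_on_indicator[OF borel_chart_image_set[OF c(1), of ?B]
          continuous_on_subset[OF continuous_dens(2)[OF c(1)]]] B by (auto simp: bdry.sets_N)
    ultimately have "AE x in hyperplane_lborel k. ennreal (?f x) = 0"
      by (subst (asm) nn_integral_0_iff_AE) auto
    then have "AE x in hyperplane_lborel k. ?f x \<le> 0"
      by (simp only: ennreal_eq_0_iff)
    then have "AE x in hyperplane_lborel k. x \<notin> snd c ` ?B"
      by eventually_elim (metis indicator_simps(1) mult_1 not_le pos)
    moreover have "snd c ` ?B \<in> sets borel"
      using B by (intro borel_chart_image_set[OF c(1)]) (auto simp: bdry.sets_N)
    ultimately have "emeasure (hyperplane_lborel k) (snd c ` ?B) = 0"
      by (subst emeasure_eq_AE[where B = "{}"]) auto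
    moreover have "snd c p \<in> T" "snd c p $ k = 0"
      using p c img by auto
    ultimately show False
      unfolding img using emeasure_hyperplane_lborel_pos[OF T(1)] by force
  qed
  with sub have "0 < emeasure ?\<mu> (boundary k A)"
    by (metis bot.extremum_uniqueI bot_ennreal not_gr_zero)
  moreover obtain P :: "'m set" and ch K and w :: "'m \<Rightarrow> 'm \<Rightarrow> real" where P: "finite P" "\<And>p. p \<in> P \<Longrightarrow> ch p \<in> A"
    "\<And>p. p \<in> P \<Longrightarrow> compact (K p)" "\<And>p. p \<in> P \<Longrightarrow> K p \<subseteq> fst (ch p)"
    "\<And>p. p \<in> P \<Longrightarrow> C1_map k A (w p)" "\<And>p q. p \<in> P \<Longrightarrow> 0 \<le> w p q" "\<And>p q. p \<in> P \<Longrightarrow> q \<notin> K p \<Longrightarrow> w p q = 0"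
    "\<And>q. q \<in> M \<Longrightarrow> (\<Sum>p\<in>P. w p q) = 1"
    by (rule partition_of_unity) (rule that; assumption)
  \<comment> \<open>Finiteness matters as well: \<open>measure\<close> would turn an infinite value
    into 0.\<close>
  have "emeasure ?\<mu> (boundary k A) < \<infinity>"
    by (rule bdry.total_density_measure(1)[OF boundary_volume_measure P(1-5) P(7) P(8)])
  ultimately show ?thesis
    by (simp add: induced_boundary_volume_def measure_def enn2real_positive_iff)
qed

end

section \<open>First variation of the volume\<close>

lemma gram_eq_gram_matrix: "gram \<kappa> k c F x = gram_matrix \<kappa> (\<lambda>i. partial k i (local_rep c F) x)"
  by (simp add: gram_def coord_vec_def gram_matrix_def)

locale atlas_velocity = atlas_metric k M A \<kappa> F
  for k :: "'n::finite" and M :: "'m::t2_space set" and A :: "('m, 'n) chart set" and \<kappa> :: real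
    and F :: "'m \<Rightarrow> real \<times> 'v::euclidean_space" +
  fixes V :: "'m \<Rightarrow> real \<times> 'v"
  assumes dF: "\<And>c i. c \<in> A \<Longrightarrow> C1 k (chart_image c) (partial k i (local_rep c F))"
    and sym: "\<And>c i j x. c \<in> A \<Longrightarrow> x \<in> chart_image c \<Longrightarrow>
      partial k i (partial k j (local_rep c F)) x = partial k j (partial k i (local_rep c F)) x"
    and V: "C1_map k A V"
begin

abbreviation field :: "('m, 'n) chart \<Rightarrow> real^'n \<Rightarrow> real^'n" where
  "field c \<equiv> chart_variation.X \<kappa> k (local_rep c F) (local_rep c V)"

abbreviation flux :: "('m, 'n) chart \<Rightarrow> 'n \<Rightarrow> real^'n \<Rightarrow> real" where
  "flux c \<equiv> chart_variation.flux \<kappa> k (local_rep c F) (local_rep c V)"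

text \<open>The derivative of \<open>f\<close> in the direction of the tangential part of the
  velocity.\<close>

definition along :: "('m, 'n) chart \<Rightarrow> ('m \<Rightarrow> real) \<Rightarrow> real^'n \<Rightarrow> real" where
  "along c f x = (\<Sum>i\<in>UNIV. field c x $ i * partial k i (local_rep c f) x)"

lemma chart_variation: "c \<in> A \<Longrightarrow> chart_variation \<kappa> k (chart_image c) (local_rep c F) (local_rep c V)"
  using chart(2) C1_mapD[OF F] dF sym C1_mapD[OF V] gram_pos(1)
  by unfold_locales (simp_all add: gram_eq_gram_matrix)

text \<open>The tangential part of the velocity is a geometric vector field, so its coordinates
  change by the Jacobian. The equation that characterises it changes on both sides by the transposed
  Jacobian, which cancels.\<close>

lemma field_trans:
  assumes cd: "c \<in> A" "d \<in> A" and x: "x \<in> snd c ` (fst c \<inter> fst d)"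
  shows "field d (trans c d x) = jacobian k (trans c d) x *v field c x"
proof -
  interpret c: chart_variation \<kappa> k "chart_image c" "local_rep c F" "local_rep c V" by (rule chart_variation[OF cd(1)])
  interpret d: chart_variation \<kappa> k "chart_image d" "local_rep d F" "local_rep d V" by (rule chart_variation[OF cd(2)])
  let ?J = "jacobian k (trans c d) x" and ?y = "trans c d x"
  let ?rhs = "\<lambda>c x. (\<chi> j. form \<kappa> (local_rep c V x) (partial k j (local_rep c F) x))"
  have xy: "x \<in> chart_image c" "?y \<in> chart_image d" using x trans_image(1)[OF cd x] by auto
  have "C1 k (snd d ` (fst c \<inter> fst d)) (local_rep d F)"
    using C1_mapD[OF F cd(2)] by (rule C1_subset) auto
  note pF = partial_local_rep_trans[OF cd x this]
  have rhs: "?rhs c x = transpose ?J *v ?rhs d ?y"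
    by (simp add: vec_eq_iff pF local_rep_trans[OF cd x, of V] matrix_vector_mult_def transpose_def
        form.sum_right form.scaleR_right)
  have "transpose ?J *v (d.G ?y *v (?J *v c.X x)) = c.G x *v c.X x"
    using gram_trans[OF cd x F] by (simp add: gram_eq_gram_matrix c.G_def d.G_def matrix_vector_mul_assoc matrix_mul_assoc)
  also have "\<dots> = ?rhs c x"
    using c.G_X[OF xy(1)] by (simp add: vec_eq_iff matrix_vector_mult_def)
  finally have "transpose ?J *v (d.G ?y *v (?J *v c.X x)) = transpose ?J *v ?rhs d ?y" by (simp add: rhs)
  moreover have nz: "det (transpose ?J) \<noteq> 0" using jacobian_det_nz[OF cd x] by simp
  have "matrix_inv (transpose ?J) *v (transpose ?J *v u) = u" for u
    by (simp only: matrix_vector_mul_assoc matrix_inv_mult(2)[OF nz] matrix_vector_mul_lid)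
  ultimately have "d.G ?y *v (?J *v c.X x) = ?rhs d ?y"
    by metis
  then have "matrix_inv (d.G ?y) *v (d.G ?y *v (?J *v c.X x)) = d.X ?y"
    by (simp add: d.X_def)
  then show ?thesis
    by (simp add: matrix_vector_mul_assoc matrix_mul_assoc matrix_inv_mult d.det_G[OF xy(2)])
qed

lemma along_trans:
  assumes cd: "c \<in> A" "d \<in> A" and x: "x \<in> snd c ` (fst c \<inter> fst d)" and f: "C1_map k A f"
  shows "along c f x = along d f (trans c d x)"
proof -
  have "C1 k (snd d ` (fst c \<inter> fst d)) (local_rep d f)"
    using C1_mapD[OF f cd(2)] by (rule C1_subset) auto
  note pf = partial_local_rep_trans[OF cd x this]
  have "along c f x = (\<Sum>i\<in>UNIV. \<Sum>j\<in>UNIV. jacobian k (trans c d) x $ j $ i * field c x $ i * partial k j (local_rep d f) (trans c d x))"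
    by (simp add: along_def pf sum_distrib_left mult_ac)
  also have "\<dots> = (\<Sum>j\<in>UNIV. \<Sum>i\<in>UNIV. jacobian k (trans c d) x $ j $ i * field c x $ i * partial k j (local_rep d f) (trans c d x))"
    by (rule sum.swap)
  also have "\<dots> = along d f (trans c d x)"
    unfolding along_def field_trans[OF cd x] by (simp add: matrix_vector_mult_def sum_distrib_right)
  finally show ?thesis .
qed

text \<open>Moves the derivative from the chart to the manifold, where the contributions of
  different charts can be added before integration.\<close>

definition along_fun :: "('m, 'n) chart \<Rightarrow> ('m \<Rightarrow> real) \<Rightarrow> 'm \<Rightarrow> real" where
  "along_fun c f q = (if q \<in> fst c then along c f (snd c q) else 0)"

lemma along_fun:
  assumes c: "c \<in> A" and w: "C1_map k A w" and K: "compact K" "K \<subseteq> fst c" "\<And>q. q \<notin> K \<Longrightarrow> w q = 0"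
  shows "continuous_on (fst c) (along_fun c w)" and "q \<notin> K \<Longrightarrow> along_fun c w q = 0"
proof -
  interpret c: chart_variation \<kappa> k "chart_image c" "local_rep c F" "local_rep c V" by (rule chart_variation[OF c])
  have "continuous_on (chart_image c) (along c w)"
    unfolding along_def[abs_def]
    by (intro continuous_on_sum continuous_on_mult C1_continuous_on[OF c.C1_X] C1D(3)[OF C1_mapD[OF w c]])
  then have "continuous_on (fst c) (\<lambda>q. along c w (snd c q))"
    by (rule continuous_on_compose2[OF _ homeomorphism_cont1[OF chart(3)[OF c]] order_refl])
  then show "continuous_on (fst c) (along_fun c w)"
    by (rule continuous_on_eq) (simp add: along_fun_def)
  show "along_fun c w q = 0" if "q \<notin> K"
    using partial_zero_off_support[OF c compact_imp_closed[OF K(1)] K(3), where y = "snd c q"] that c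
    by (simp add: along_fun_def along_def)
qed

lemma integral_along:
  assumes c: "c \<in> A" and w: "C1_map k A w" and K: "compact K" "K \<subseteq> fst c" "\<And>q. q \<notin> K \<Longrightarrow> w q = 0"
  shows "integrable (volume_measure \<kappa> k M A F) (along_fun c w)"
    and "(\<integral>q. along_fun c w q \<partial>volume_measure \<kappa> k M A F) =
      (\<integral>x. indicator (chart_image c) x * (sqrt (det (gram \<kappa> k c F x)) * along c w x) \<partial>lborel)"
    and "integrable lborel (\<lambda>x. indicator (chart_image c) x * (sqrt (det (gram \<kappa> k c F x)) * along c w x))"
proof -
  note int = bulk.integral_density_measure[OF volume_measure c K(1,2) along_fun[OF c w K]]
  have eq: "indicator (bulk.image_X c) x * (sqrt (det (gram \<kappa> k c F x)) * along_fun c w (chart_inv c x)) =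
      indicator (chart_image c) x * (sqrt (det (gram \<kappa> k c F x)) * along c w x)" for x
    using c by (auto simp: bulk_image along_fun_def split: split_indicator)
  show "integrable (volume_measure \<kappa> k M A F) (along_fun c w)" by (rule int(1))
  show "(\<integral>q. along_fun c w q \<partial>volume_measure \<kappa> k M A F) =
      (\<integral>x. indicator (chart_image c) x * (sqrt (det (gram \<kappa> k c F x)) * along c w x) \<partial>lborel)"
    using int(2) unfolding eq .
  show "integrable lborel (\<lambda>x. indicator (chart_image c) x * (sqrt (det (gram \<kappa> k c F x)) * along c w x))"
    using int(3) unfolding eq .
qed

text \<open>The derivatives of a partition of unity along the tangential field, which does not depend on the chart,
  sum up to the derivative of \<open>1\<close>.\<close>

lemma sum_integral_along:
  assumes P: "finite P" "\<And>p. p \<in> P \<Longrightarrow> ch p \<in> A" "\<And>p. p \<in> P \<Longrightarrow> compact (K p)" "\<And>p. p \<in> P \<Longrightarrow> K p \<subseteq> fst (ch p)"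
      "\<And>p. p \<in> P \<Longrightarrow> C1_map k A (w p)" "\<And>p q. p \<in> P \<Longrightarrow> q \<notin> K p \<Longrightarrow> w p q = (0::real)"
      "\<And>q. q \<in> M \<Longrightarrow> (\<Sum>p\<in>P. w p q) = 1"
  shows "(\<Sum>p\<in>P. \<integral>x. indicator (chart_image (ch p)) x * (sqrt (det (gram \<kappa> k (ch p) F x)) * along (ch p) (w p) x) \<partial>lborel) = 0"
proof -
  have "(\<Sum>p\<in>P. \<integral>x. indicator (chart_image (ch p)) x * (sqrt (det (gram \<kappa> k (ch p) F x)) * along (ch p) (w p) x) \<partial>lborel) =
      (\<Sum>p\<in>P. \<integral>q. along_fun (ch p) (w p) q \<partial>volume_measure \<kappa> k M A F)"
    using integral_along(2)[OF P(2) P(5) P(3) P(4) P(6)] by simp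
  also have "\<dots> = (\<integral>q. (\<Sum>p\<in>P. along_fun (ch p) (w p) q) \<partial>volume_measure \<kappa> k M A F)"
    by (intro Bochner_Integration.integral_sum[symmetric] integral_along(1)[OF P(2) P(5) P(3) P(4) P(6)])
  also have "\<dots> = (\<integral>q. 0 \<partial>volume_measure \<kappa> k M A F)"
  proof (rule Bochner_Integration.integral_cong[OF refl])
    fix q assume "q \<in> space (volume_measure \<kappa> k M A F)"
    then have q: "q \<in> M"
      using volume_measure sets_eq_imp_space_eq[of "volume_measure \<kappa> k M A F" bulk.N]
      by (simp add: bulk.density_measure_def bulk.space_N)
    then obtain d where d: "d \<in> A" "q \<in> fst d" using cover by auto
    let ?y = "snd d q"
    have "along_fun (ch p) (w p) q = along d (w p) ?y" if p: "p \<in> P" for p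
    proof (cases "q \<in> fst (ch p)")
      case True
      then have "along (ch p) (w p) (snd (ch p) q) = along d (w p) (trans (ch p) d (snd (ch p) q))"
        using d P(2,5)[OF p] by (intro along_trans) auto
      also have "trans (ch p) d (snd (ch p) q) = ?y" using True P(2)[OF p] by (simp add: local_rep_def)
      finally show ?thesis using True by (simp add: along_fun_def)
    next
      case False
      then have "chart_inv d ?y \<notin> K p" using P(4)[OF p] d by auto
      then have "along d (w p) ?y = 0"
        using d partial_zero_off_support[OF d(1) compact_imp_closed[OF P(3)[OF p]] P(6)[OF p], where y = ?y]
        by (simp add: along_def)
      then show ?thesis using False by (simp add: along_fun_def)
    qed
    then have "(\<Sum>p\<in>P. along_fun (ch p) (w p) q) = (\<Sum>p\<in>P. along d (w p) ?y)" by simp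
    also have "\<dots> = (\<Sum>i\<in>UNIV. field d ?y $ i * (\<Sum>p\<in>P. partial k i (local_rep d (w p)) ?y))"
      unfolding along_def by (subst sum.swap) (simp add: sum_distrib_left)
    also have "\<dots> = 0"
    proof (rule sum.neutral, intro ballI)
      fix i
      have yH: "?y \<in> halfspace k" using chart_subset(2)[OF d(1)] d(2) by auto
      have "(\<Sum>p\<in>P. partial k i (local_rep d (w p)) ?y) = partial k i (\<lambda>x. \<Sum>p\<in>P. local_rep d (w p) x) ?y"
        using C1_mapD[OF P(5) d(1)] d(2) by (intro partial_sum[OF yH, symmetric]) (auto simp: C1_def)
      also have "\<dots> = partial k i (\<lambda>x. 1 :: real) ?y"
        using d chart_subset(1)[OF d(1)] chart_inv(3)[OF d(1)]
        by (intro partial_cong[OF chart(2)[OF d(1)]]) (auto simp: local_rep_def intro!: P(7))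
      also have "\<dots> = 0" using partial_eq[OF yH has_derivative_const] .
      finally show "field d ?y $ i * (\<Sum>p\<in>P. partial k i (local_rep d (w p)) ?y) = 0" by simp
    qed
    finally show "(\<Sum>p\<in>P. along_fun (ch p) (w p) q) = 0" .
  qed
  finally show ?thesis by simp
qed

text \<open>Integration by parts in one chart. The weighted flux, extended by zero, is C1 on the
  half-space with bounded support, so each of its components can be integrated. The product rule
  leaves the last term, which disappears when the weights are summed.\<close>

lemma weighted_divergence:
  assumes c: "c \<in> A" and w: "C1_map k A w" and K: "compact K" "K \<subseteq> fst c" "\<And>q. q \<notin> K \<Longrightarrow> w q = 0"
  shows "(\<integral>x. indicator (chart_image c) x * (local_rep c w x * (\<Sum>i\<in>UNIV. partial k i (flux c i) x)) \<partial>lborel) =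
    - (\<integral>y. indicator (chart_image c \<inter> {y. y $ k = 0}) y * (local_rep c w y * flux c k y) \<partial>hyperplane_lborel k) -
    (\<integral>x. indicator (chart_image c) x * (sqrt (det (gram \<kappa> k c F x)) * along c w x) \<partial>lborel)"
proof -
  interpret c: chart_variation \<kappa> k "chart_image c" "local_rep c F" "local_rep c V" by (rule chart_variation[OF c])
  let ?W = "chart_image c" and ?\<omega> = "local_rep c w" and ?K = "snd c ` K"
  let ?f = "\<lambda>i x. if x \<in> ?W then ?\<omega> x * flux c i x else 0"
  have cK: "compact ?K"
    by (rule compact_continuous_image[OF continuous_on_subset[OF homeomorphism_cont1[OF chart(3)[OF c]] K(2)] K(1)])
  have KW: "?K \<subseteq> ?W" using K(2) by auto
  have \<omega>0: "?\<omega> x = 0" if "x \<in> ?W" "x \<notin> ?K" for x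
    using that K(3)[of "chart_inv c x"] c by (auto simp: local_rep_def image_iff)
  have C\<omega>: "C1 k ?W ?\<omega>" by (rule C1_mapD[OF w c])
  have Cf: "C1 k (halfspace k) (?f i)" for i
    by (rule C1_extend_zero[OF chart(2)[OF c] compact_imp_closed[OF cK] KW C1_mult[OF C\<omega> c.C1_flux]])
      (simp add: \<omega>0)
  obtain R where R: "0 < R" "\<And>x. x \<in> ?K \<Longrightarrow> norm x < R"
    using compact_imp_bounded[OF cK] by (auto simp: bounded_pos_less)
  have f0: "?f i x = 0" if "R \<le> norm x" for i x
    using R(2)[of x] \<omega>0[of x] that by force
  have pf: "indicator (halfspace k) x * partial k i (?f i) x =
      indicator ?W x * (?\<omega> x * partial k i (flux c i) x + partial k i ?\<omega> x * flux c i x)" for i x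
  proof (cases "x \<in> ?W")
    case True
    then have xH: "x \<in> halfspace k" using chart_subset(2)[OF c] by auto
    have d: "?\<omega> differentiable at x within halfspace k" "flux c i differentiable at x within halfspace k"
      using C\<omega> c.C1_flux True by (auto simp: C1_def)
    have "partial k i (?f i) x = partial k i (\<lambda>x. ?\<omega> x * flux c i x) x"
      using C1_mult[OF C\<omega> c.C1_flux] True by (intro partial_cong[OF chart(2)[OF c] True]) (auto simp: C1_def)
    then show ?thesis using True xH by (simp add: partial_mult[OF xH d])
  next
    case False
    show ?thesis
    proof (cases "x \<in> halfspace k")
      case True
      have "partial k i (?f i) x = partial k i (\<lambda>x. 0 :: real) x"
      proof (rule partial_cong)
        show "openin (top_of_set (halfspace k)) (halfspace k \<inter> - ?K)"
          using compact_imp_closed[OF cK] by (auto simp: openin_open)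
        show "x \<in> halfspace k \<inter> - ?K" using True False KW by auto
      qed (use \<omega>0 in auto)
      also have "\<dots> = 0" using partial_eq[OF True has_derivative_const] .
      finally show ?thesis using False by simp
    qed (use False in simp)
  qed
  note ip = integral_partial_halfspace[OF Cf R(1) f0]
  have al: "sqrt (det (gram \<kappa> k c F x)) * along c w x = (\<Sum>i\<in>UNIV. partial k i ?\<omega> x * flux c i x)" for x
    by (simp add: along_def c.flux_def c.G_def gram_eq_gram_matrix sum_distrib_left mult_ac)
  have "(\<integral>x. indicator ?W x * (?\<omega> x * (\<Sum>i\<in>UNIV. partial k i (flux c i) x)) \<partial>lborel) =
    (\<integral>x. (\<Sum>i\<in>UNIV. indicator (halfspace k) x * partial k i (?f i) x) -
      indicator ?W x * (sqrt (det (gram \<kappa> k c F x)) * along c w x) \<partial>lborel)"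
    unfolding pf al by (simp add: sum_distrib_left sum.distrib distrib_left)
  also have "\<dots> = (\<integral>x. (\<Sum>i\<in>UNIV. indicator (halfspace k) x * partial k i (?f i) x) \<partial>lborel) -
      (\<integral>x. indicator ?W x * (sqrt (det (gram \<kappa> k c F x)) * along c w x) \<partial>lborel)"
    by (intro Bochner_Integration.integral_diff Bochner_Integration.integrable_sum ip(1) integral_along(3)[OF c w K])
  also have "(\<integral>x. (\<Sum>i\<in>UNIV. indicator (halfspace k) x * partial k i (?f i) x) \<partial>lborel) =
      (\<Sum>i\<in>UNIV. \<integral>x. indicator (halfspace k) x * partial k i (?f i) x \<partial>lborel)"
    by (intro Bochner_Integration.integral_sum ip(1))
  also have "\<dots> = - (\<integral>y. indicator {y. y $ k = 0} y * ?f k y \<partial>hyperplane_lborel k)"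
    by (simp add: ip(2) if_distrib cong: if_cong)
  also have "(\<lambda>y. indicator {y. y $ k = 0} y * ?f k y) = (\<lambda>y. indicator (?W \<inter> {y. y $ k = 0}) y * (?\<omega> y * flux c k y))"
    by (auto simp: fun_eq_iff split: split_indicator)
  finally show ?thesis .
qed

text \<open>By \<open>bd\<close>, the normal speed is the same number \<open>r\<close> at all
  boundary points, so it leaves the boundary integral, and the weights reassemble the boundary
  volume.\<close>

lemma variation_integral:
  assumes P: "finite P" "\<And>p. p \<in> P \<Longrightarrow> ch p \<in> A" "\<And>p. p \<in> P \<Longrightarrow> compact (K p)" "\<And>p. p \<in> P \<Longrightarrow> K p \<subseteq> fst (ch p)"
      "\<And>p. p \<in> P \<Longrightarrow> C1_map k A (w p)" "\<And>p q. p \<in> P \<Longrightarrow> q \<notin> K p \<Longrightarrow> w p q = (0::real)"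
      "\<And>q. q \<in> M \<Longrightarrow> (\<Sum>p\<in>P. w p q) = 1"
    and bd: "\<And>c x. c \<in> A \<Longrightarrow> x \<in> chart_image c \<Longrightarrow> x $ k = 0 \<Longrightarrow>
      flux c k x = - (sqrt (det (boundary_gram \<kappa> k c F x)) * r)"
  shows "(\<Sum>p\<in>P. \<integral>x. indicator (chart_image (ch p)) x *
      (local_rep (ch p) (w p) x * (\<Sum>i\<in>UNIV. partial k i (flux (ch p) i) x)) \<partial>lborel) =
    r * induced_boundary_volume \<kappa> k A F"
proof -
  let ?b = "\<lambda>p. \<integral>y. indicator (bdry.image_X (ch p)) y *
      (sqrt (det (boundary_gram \<kappa> k (ch p) F y)) * local_rep (ch p) (w p) y) \<partial>hyperplane_lborel k"
  let ?a = "\<lambda>p. \<integral>x. indicator (chart_image (ch p)) x * (sqrt (det (gram \<kappa> k (ch p) F x)) * along (ch p) (w p) x) \<partial>lborel"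
  have b: "- (\<integral>y. indicator (chart_image (ch p) \<inter> {y. y $ k = 0}) y * (local_rep (ch p) (w p) y * flux (ch p) k y)
      \<partial>hyperplane_lborel k) = r * ?b p" if p: "p \<in> P" for p
  proof -
    have "(\<lambda>y. indicator (chart_image (ch p) \<inter> {y. y $ k = 0}) y * (local_rep (ch p) (w p) y * flux (ch p) k y)) =
      (\<lambda>y. - r * (indicator (bdry.image_X (ch p)) y *
        (sqrt (det (boundary_gram \<kappa> k (ch p) F y)) * local_rep (ch p) (w p) y)))"
      unfolding boundary_image[OF P(2)[OF p]] using bd[OF P(2)[OF p]] by (auto simp: fun_eq_iff split: split_indicator)
    then show ?thesis by simp
  qed
  have "(\<Sum>p\<in>P. \<integral>x. indicator (chart_image (ch p)) x *
      (local_rep (ch p) (w p) x * (\<Sum>i\<in>UNIV. partial k i (flux (ch p) i) x)) \<partial>lborel) = (\<Sum>p\<in>P. r * ?b p - ?a p)"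
  proof (rule sum.cong[OF refl])
    fix p assume p: "p \<in> P"
    show "(\<integral>x. indicator (chart_image (ch p)) x *
      (local_rep (ch p) (w p) x * (\<Sum>i\<in>UNIV. partial k i (flux (ch p) i) x)) \<partial>lborel) = r * ?b p - ?a p"
      by (rule weighted_divergence[OF P(2)[OF p] P(5)[OF p] P(3)[OF p] P(4)[OF p] P(6)[OF p], unfolded b[OF p]])
  qed
  also have "\<dots> = (\<Sum>p\<in>P. r * ?b p)"
  proof -
    have "(\<Sum>p\<in>P. ?a p) = 0" by (rule sum_integral_along[OF P])
    then show ?thesis by (simp only: sum_subtractf diff_0_right)
  qed
  also have "\<dots> = r * induced_boundary_volume \<kappa> k A F"
  proof -
    have "induced_boundary_volume \<kappa> k A F = (\<Sum>p\<in>P. ?b p)"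
      unfolding induced_boundary_volume_def by (rule bdry.total_density_measure(2)[OF boundary_volume_measure P])
    then show ?thesis by (simp only: sum_distrib_left)
  qed
  finally show ?thesis .
qed

end

section \<open>Variable-radius families\<close>

lemma continuous_on_matrix_inv:
  fixes B :: "'a::topological_space \<Rightarrow> real^'n^'n"
  assumes B: "\<And>i j. continuous_on S (\<lambda>x. B x $ i $ j)" and nz: "\<And>x. x \<in> S \<Longrightarrow> det (B x) \<noteq> 0"
  shows "continuous_on S (\<lambda>x. matrix_inv (B x) $ i $ j)"
proof -
  let ?C = "\<lambda>x. \<chi> i' j'. if j' = i then axis j 1 $ i' else B x $ i' $ j'"
  have "continuous_on S (\<lambda>x. ?C x $ i' $ j')" for i' j'
    using B by (cases "j' = i") auto
  then have "continuous_on S (\<lambda>x. det (?C x) / det (B x))"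
    using nz by (intro continuous_on_divide continuous_on_det[OF B] continuous_on_det) auto
  moreover have "det (?C x) / det (B x) = matrix_inv (B x) $ i $ j" if "x \<in> S" for x
  proof -
    have "B x *v (matrix_inv (B x) *v axis j 1) = axis j 1"
      by (simp add: matrix_vector_mul_assoc matrix_inv_mult nz[OF that])
    then have "matrix_inv (B x) *v axis j 1 = (\<chi> l. det (\<chi> i' j'. if j' = l then axis j 1 $ i' else B x $ i' $ j') / det (B x))"
      using cramer[OF nz[OF that]] by blast
    then have "(matrix_inv (B x) *v axis j 1) $ i = det (?C x) / det (B x)" by simp
    then show ?thesis by (simp add: matrix_vector_mul_component inner_axis)
  qed
  ultimately show ?thesis by (rule continuous_on_eq)
qed

lemma continuous_on_extend_zero:
  fixes g :: "'a::euclidean_space \<Rightarrow> real"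
  assumes Y: "openin (top_of_set Z) Y" and C: "closed C" "Z \<inter> C \<subseteq> Y"
    and g: "continuous_on Y g" "\<And>z. z \<in> Y \<Longrightarrow> z \<notin> C \<Longrightarrow> g z = 0"
  shows "continuous_on Z (\<lambda>z. if z \<in> Y then g z else 0)"
proof -
  have Z: "Y \<union> (Z - C) = Z" using C(2) openin_imp_subset[OF Y] by auto
  have "openin (top_of_set Z) (Z - C)"
    using C(1) by (auto simp: openin_open intro!: exI[of _ "- C"])
  then have "continuous_on (Y \<union> (Z - C)) (\<lambda>z. if z \<in> Y then g z else 0)"
  proof (intro continuous_on_Un_local_open)
    show "continuous_on Y (\<lambda>z. if z \<in> Y then g z else 0)"
      using g(1) by (rule continuous_on_eq) simp
    show "continuous_on (Z - C) (\<lambda>z. if z \<in> Y then g z else 0)"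
      using continuous_on_const[of "Z - C" "0 :: real"] by (rule continuous_on_eq) (use g(2) in auto)
  qed (use Y in \<open>simp_all add: Z\<close>)
  then show ?thesis unfolding Z .
qed

text \<open>The Leibniz rule is applied over a compact box. The compact support of \<omega> keeps
  the integrands continuous when they are extended by zero from \<open>W\<close> to the
  half-space.\<close>

lemma weighted_integral_derivative:
  fixes D D' :: "real \<Rightarrow> real^'n \<Rightarrow> real"
  assumes I: "is_interval I" "a \<in> I"
    and W: "openin (top_of_set (halfspace k)) W" and K: "compact K" "K \<subseteq> W"
    and \<omega>: "continuous_on W \<omega>" "\<And>x. x \<in> W \<Longrightarrow> x \<notin> K \<Longrightarrow> \<omega> x = 0"
    and D: "continuous_on (I \<times> W) (\<lambda>(b, x). D b x)" "continuous_on (I \<times> W) (\<lambda>(b, x). D' b x)"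
    and der: "\<And>b x. b \<in> I \<Longrightarrow> x \<in> W \<Longrightarrow> ((\<lambda>b. D b x) has_real_derivative D' b x) (at b within I)"
  shows "((\<lambda>b. \<integral>x. indicator W x * (D b x * \<omega> x) \<partial>lborel) has_real_derivative
    (\<integral>x. indicator W x * (\<omega> x * D' a x) \<partial>lborel)) (at a within I)"
proof -
  obtain R where R: "\<And>x. x \<in> K \<Longrightarrow> norm x \<le> R" using compact_imp_bounded[OF K(1)] by (auto simp: bounded_iff)
  \<comment> \<open>The box must contain \<open>K\<close> without leaving the half-space, on which
    continuity is known; hence the lower bound 0 in direction \<open>k\<close>.\<close>
  let ?l = "\<chi> i. if i = k then 0 else - R" and ?u = "(\<chi> i. R) :: real^'n"
  let ?Q = "cbox ?l ?u"
  have WH: "W \<subseteq> halfspace k" using openin_imp_subset[OF W] .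
  have QH: "?Q \<subseteq> halfspace k" by (auto simp: mem_box_cart halfspace_def dest!: spec[of _ k])
  have KQ: "K \<subseteq> ?Q"
  proof
    fix x assume x: "x \<in> K"
    then have "0 \<le> x $ k" using K(2) WH by (auto simp: halfspace_def)
    moreover have "\<bar>x $ i\<bar> \<le> R" for i using R[OF x] component_le_norm_cart[of x i] by simp
    ultimately show "x \<in> ?Q" by (auto simp: mem_box_cart abs_le_iff) (metis minus_le_iff)
  qed
  let ?h = "\<lambda>E b x. if x \<in> W then E b x * \<omega> x else 0"
  have cont: "continuous_on (I \<times> halfspace k) (\<lambda>(b, x). ?h E b x)"
    if E: "continuous_on (I \<times> W) (\<lambda>(b, x). E b x)" for E
  proof -
    have "openin (top_of_set (I \<times> halfspace k)) (I \<times> W)" by (intro openin_Times W openin_subtopology_self)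
    moreover have "continuous_on (I \<times> W) (\<lambda>z. (case z of (b, x) \<Rightarrow> E b x) * \<omega> (snd z))"
      by (intro continuous_on_mult E continuous_on_compose2[OF \<omega>(1)] continuous_intros) auto
    ultimately have "continuous_on (I \<times> halfspace k)
        (\<lambda>z. if z \<in> I \<times> W then (case z of (b, x) \<Rightarrow> E b x) * \<omega> (snd z) else 0)"
      using K(2) compact_imp_closed[OF K(1)]
      by (intro continuous_on_extend_zero[where C = "UNIV \<times> K"]) (auto intro: closed_Times dest: \<omega>(2))
    then show ?thesis by (rule continuous_on_eq) (auto split: if_splits)
  qed
  have slice: "continuous_on ?Q (?h E b)" if E: "continuous_on (I \<times> W) (\<lambda>(b, x). E b x)" and b: "b \<in> I" for E b
  proof -
    have "continuous_on ?Q (\<lambda>x. case (b, x) of (b, x) \<Rightarrow> ?h E b x)"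
      by (rule continuous_on_compose2[OF cont[OF E]]) (use QH b in \<open>auto intro: continuous_intros\<close>)
    then show ?thesis unfolding prod.case .
  qed
  have int: "(\<integral>x. indicator W x * (E b x * \<omega> x) \<partial>lborel) = integral ?Q (?h E b)"
    if E: "continuous_on (I \<times> W) (\<lambda>(b, x). E b x)" and b: "b \<in> I" for E b
  proof -
    have "set_integrable lborel ?Q (?h E b)"
      unfolding set_integrable_def by (intro borel_integrable_compact compact_cbox slice E b)
    then have "(LINT x : ?Q | lborel. ?h E b x) = integral ?Q (?h E b)"
      by (rule set_borel_integral_eq_integral)
    moreover have "(\<lambda>x. indicator ?Q x *\<^sub>R ?h E b x) = (\<lambda>x. indicator W x * (E b x * \<omega> x))"
      using KQ \<omega>(2) by (auto simp: fun_eq_iff split: split_indicator)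
    ultimately show ?thesis by (simp add: set_lebesgue_integral_def)
  qed
  have L: "((\<lambda>b. integral ?Q (?h D b)) has_field_derivative integral ?Q (?h D' a)) (at a within I)"
  proof (rule leibniz_rule_field_derivative)
    show "((\<lambda>b. ?h D b x) has_field_derivative ?h D' b x) (at b within I)" if "b \<in> I" "x \<in> ?Q" for b x
      using der[OF that(1)] by (cases "x \<in> W") (auto intro: DERIV_cmult_right)
    show "?h D b integrable_on ?Q" if "b \<in> I" for b
      by (rule integrable_continuous[OF slice[OF D(1) that]])
    show "continuous_on (I \<times> ?Q) (\<lambda>(b, x). ?h D' b x)"
      by (rule continuous_on_subset[OF cont[OF D(2)]]) (use QH in auto)
    show "convex I" using I(1) is_interval_convex by blast
  qed (rule I(2))
  have "((\<lambda>b. \<integral>x. indicator W x * (D b x * \<omega> x) \<partial>lborel) has_field_derivative integral ?Q (?h D' a)) (at a within I)"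
    by (rule has_field_derivative_transform_within[OF L zero_less_one I(2)]) (erule int[OF D(1), symmetric])
  then show ?thesis
    unfolding int[OF D(2) I(2), symmetric] by (simp only: mult.commute[of "\<omega> _"])
qed

locale radius_family =
  fixes \<kappa> :: real and k :: "'n::finite" and M :: "'m::t2_space set" and A :: "('m, 'n) chart set"
    and p\<^sub>0 :: "real \<times> 'v::euclidean_space" and I :: "real set" and r :: "real \<Rightarrow> real"
    and \<Phi> :: "real \<Rightarrow> 'm \<Rightarrow> real \<times> 'v"
  assumes \<kappa>: "\<kappa> \<in> {-1, 0, 1}" and dim: "DIM('v) = CARD('n) + 1" and p0: "p\<^sub>0 \<in> space_form \<kappa>"
    and family: "variable_radius_family \<kappa> k M A p\<^sub>0 I r \<Phi>"
begin

lemma interval: "is_interval I" and manifold: "compact_manifold k M A"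
  and r: "smooth_on I r" "a \<in> I \<Longrightarrow> 0 < r a" "a \<in> I \<Longrightarrow> \<kappa> = 1 \<Longrightarrow> r a < pi"
  and smooth: "c \<in> A \<Longrightarrow> smooth_on (I \<times> chart_image c) (\<lambda>(a, x). local_rep c (\<Phi> a) x)"
  and fbm: "a \<in> I \<Longrightarrow> free_boundary_minimal_immersion \<kappa> k M A p\<^sub>0 (r a) (\<Phi> a)"
  using family by (simp_all add: variable_radius_family_def)

sublocale atlas k M A
  by unfold_locales (rule manifold)

lemma immersion: "a \<in> I \<Longrightarrow> immersion k A (\<Phi> a)" and minimal: "a \<in> I \<Longrightarrow> minimal \<kappa> k A (\<Phi> a)"
  and two_sided: "a \<in> I \<Longrightarrow> two_sided \<kappa> k M A (\<Phi> a)"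
  and boundary_nonempty: "a \<in> I \<Longrightarrow> boundary k A \<noteq> {}"
  and boundary_sphere: "a \<in> I \<Longrightarrow> p \<in> boundary k A \<Longrightarrow> \<Phi> a p \<in> geo_sphere \<kappa> p\<^sub>0 (r a)"
  and conormal: "a \<in> I \<Longrightarrow> p \<in> boundary k A \<Longrightarrow>
    \<exists>\<eta>. outward_conormal \<kappa> k A (\<Phi> a) p \<eta> \<and> is_gradient \<kappa> (space_dist \<kappa> p\<^sub>0) (\<Phi> a p) \<eta>"
  using fbm[of a] unfolding free_boundary_minimal_immersion_def by blast+

lemma \<Phi>_space_form: "a \<in> I \<Longrightarrow> p \<in> M \<Longrightarrow> \<Phi> a p \<in> space_form \<kappa>"
  using fbm[of a] unfolding free_boundary_minimal_immersion_def geo_ball_def by blast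

lemma local_C2:
  assumes "a \<in> I" "c \<in> A"
  shows "C1 k (chart_image c) (local_rep c (\<Phi> a))" "C1 k (chart_image c) (partial k i (local_rep c (\<Phi> a)))"
    "x \<in> chart_image c \<Longrightarrow>
      partial k i (partial k j (local_rep c (\<Phi> a))) x = partial k j (partial k i (local_rep c (\<Phi> a))) x"
proof -
  have "smooth_on (chart_image c) (local_rep c (\<Phi> a))"
    using immersion[OF assms(1)] assms(2) by (auto simp: immersion_def smooth_map_def)
  note C2 = smooth_on_C2[OF chart(2)[OF assms(2)] this]
  show "C1 k (chart_image c) (local_rep c (\<Phi> a))" "C1 k (chart_image c) (partial k i (local_rep c (\<Phi> a)))"
    "x \<in> chart_image c \<Longrightarrow>
      partial k i (partial k j (local_rep c (\<Phi> a))) x = partial k j (partial k i (local_rep c (\<Phi> a))) x"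
    by (rule C2 | assumption)+
qed

lemma frame:
  assumes a: "a \<in> I" and c: "c \<in> A" and x: "x \<in> chart_image c"
  shows "local_rep c (\<Phi> a) x \<in> space_form \<kappa>"
    "partial k i (local_rep c (\<Phi> a)) x \<in> tangent_space \<kappa> (local_rep c (\<Phi> a) x)"
    "inj (\<lambda>v :: real^'n. \<Sum>i\<in>UNIV. v $ i *\<^sub>R partial k i (local_rep c (\<Phi> a)) x)"
proof -
  have S: "local_rep c (\<Phi> a) y \<in> space_form \<kappa>" if "y \<in> chart_image c" for y
    using \<Phi>_space_form[OF a] chart_subset(1)[OF c] chart_inv(3)[OF c that] by (auto simp: local_rep_def)
  then show "local_rep c (\<Phi> a) x \<in> space_form \<kappa>" using x by simp
  show "partial k i (local_rep c (\<Phi> a)) x \<in> tangent_space \<kappa> (local_rep c (\<Phi> a) x)"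
    by (rule tangent_partial[OF chart(2)[OF c] x local_C2(1)[OF a c] S])
  show "inj (\<lambda>v :: real^'n. \<Sum>i\<in>UNIV. v $ i *\<^sub>R partial k i (local_rep c (\<Phi> a)) x)"
    using immersion[OF a] c x by (auto simp: immersion_def coord_vec_def)
qed

lemma metric: "a \<in> I \<Longrightarrow> atlas_metric k M A \<kappa> (\<Phi> a)"
proof unfold_locales
  assume a: "a \<in> I"
  show "C1_map k A (\<Phi> a)" using local_C2(1)[OF a] by (simp add: C1_map_def)
  fix c x assume "c \<in> A" "x \<in> chart_image c"
  note fr = frame[OF a this]
  show "0 < det (gram \<kappa> k c (\<Phi> a) x)" "0 < det (boundary_gram \<kappa> k c (\<Phi> a) x)"
    unfolding boundary_gram_eq gram_eq_gram_matrix by (rule gram_matrix_pos[OF \<kappa> fr])+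
qed

lemma volume_pos: "a \<in> I \<Longrightarrow> 0 < induced_boundary_volume \<kappa> k A (\<Phi> a)"
  using atlas_metric.boundary_volume_pos[OF metric boundary_nonempty] .

lemma radius_derivative:
  assumes a: "a \<in> I"
  shows "(r has_real_derivative vector_derivative r (at a within I)) (at a within I)"
proof -
  obtain U g g1 g2 where U: "open U" "a \<in> U" "\<And>y. y \<in> U \<Longrightarrow> y \<in> I \<Longrightarrow> g y = r y"
    "\<And>y. y \<in> U \<Longrightarrow> (g has_derivative g1 y) (at y)"
    "\<And>y v. y \<in> U \<Longrightarrow> ((\<lambda>y. g1 y v) has_derivative g2 y v) (at y)"
    "\<And>v. continuous_on U (\<lambda>y. g1 y v)" "\<And>v w. continuous_on U (\<lambda>y. g2 y v w)"
    "\<And>y v w. y \<in> U \<Longrightarrow> g2 y v w = g2 y w v"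
    by (rule smooth_on_local_C2[OF r(1) a]) (rule that; assumption)
  have "(r has_derivative g1 a) (at a within I)"
    by (rule has_derivative_agree[OF has_derivative_at_withinI[OF U(4)[OF U(2)]] U(1,2) a]) (use U(3) in auto)
  then show ?thesis
    unfolding has_real_derivative_iff_has_vector_derivative
    using vector_derivative_works differentiableI by blast
qed

section \<open>Time derivatives of the family\<close>

definition velocity :: "real \<Rightarrow> 'm \<Rightarrow> real \<times> 'v" where
  "velocity a q = vector_derivative (\<lambda>b. \<Phi> b q) (at a within I)"

text \<open>If \<open>I\<close> is a single point, then \<open>at a within I\<close> is the trivial filter, \<open>vector_derivative\<close> is an
  arbitrary value, and everything is a derivative.\<close>

context
  fixes a
  assumes a: "a \<in> I" and nontrivial: "at a within I \<noteq> bot"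
begin

text \<open>An interval that accumulates at one of its points has more than one point, and a
  connected set with more than one point accumulates at each of its points.\<close>

lemma nontrivial_at:
  assumes "b \<in> I" shows "at b within I \<noteq> bot"
proof -
  have "I \<noteq> {x}" for x
    using nontrivial a by (auto simp: trivial_limit_within islimpt_finite)
  then have "b islimpt I"
    using connected_imp_perfect[of I b] interval assms by (auto simp: is_interval_connected_1)
  then show ?thesis by (simp add: trivial_limit_within)
qed

lemma
  assumes c: "c \<in> A"
  shows local_time_derivative: "b \<in> I \<Longrightarrow> x \<in> chart_image c \<Longrightarrow>
      ((\<lambda>b. local_rep c (\<Phi> b) x) has_vector_derivative local_rep c (velocity b) x) (at b within I)"
    and C1_velocity: "b \<in> I \<Longrightarrow> C1 k (chart_image c) (local_rep c (velocity b))"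
    and partial_time_derivative: "b \<in> I \<Longrightarrow> x \<in> chart_image c \<Longrightarrow>
      ((\<lambda>b. partial k i (local_rep c (\<Phi> b)) x) has_vector_derivative partial k i (local_rep c (velocity b)) x) (at b within I)"
    and continuous_partial: "continuous_on (I \<times> chart_image c) (\<lambda>(b, x). partial k i (local_rep c (\<Phi> b)) x)"
    and continuous_partial_velocity:
      "continuous_on (I \<times> chart_image c) (\<lambda>(b, x). partial k i (local_rep c (velocity b)) x)"
proof -
  have eq: "local_rep c (velocity b) = (\<lambda>x. vector_derivative (\<lambda>b. local_rep c (\<Phi> b) x) (at b within I))" for b
    by (simp add: local_rep_def velocity_def)
  note sf = smooth_family[OF nontrivial_at chart(2)[OF c] smooth[OF c], folded eq]
  show "b \<in> I \<Longrightarrow> x \<in> chart_image c \<Longrightarrow>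
      ((\<lambda>b. local_rep c (\<Phi> b) x) has_vector_derivative local_rep c (velocity b) x) (at b within I)"
    using sf(1) by (simp add: local_rep_def velocity_def)
  show "b \<in> I \<Longrightarrow> C1 k (chart_image c) (local_rep c (velocity b))"
    using sf(2) by (simp add: eq)
  show "b \<in> I \<Longrightarrow> x \<in> chart_image c \<Longrightarrow>
      ((\<lambda>b. partial k i (local_rep c (\<Phi> b)) x) has_vector_derivative partial k i (local_rep c (velocity b)) x) (at b within I)"
    using sf(3) by (simp add: eq)
  show "continuous_on (I \<times> chart_image c) (\<lambda>(b, x). partial k i (local_rep c (\<Phi> b)) x)"
    using sf(4) .
  show "continuous_on (I \<times> chart_image c) (\<lambda>(b, x). partial k i (local_rep c (velocity b)) x)"
    using sf(5) by (simp add: eq)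
qed

lemma atlas_velocity: "atlas_velocity k M A \<kappa> (\<Phi> a) (velocity a)"
proof -
  interpret atlas_metric k M A \<kappa> "\<Phi> a" by (rule metric[OF a])
  show ?thesis
    using local_C2[OF a] C1_velocity a by unfold_locales (auto simp: C1_map_def)
qed

definition area_density :: "('m, 'n) chart \<Rightarrow> real \<Rightarrow> real^'n \<Rightarrow> real" where
  "area_density c b x = sqrt (det (gram \<kappa> k c (\<Phi> b) x))"

text \<open>Jacobi's formula applied to \<open>area_density\<close>: the matrix is the derivative of
  the Gram matrix in the parameter.\<close>

definition area_rate :: "('m, 'n) chart \<Rightarrow> real \<Rightarrow> real^'n \<Rightarrow> real" where
  "area_rate c b x = sqrt (det (gram \<kappa> k c (\<Phi> b) x)) / 2 * trace (matrix_inv (gram \<kappa> k c (\<Phi> b) x) **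
    (\<chi> i j. form \<kappa> (partial k i (local_rep c (velocity b)) x) (partial k j (local_rep c (\<Phi> b)) x) +
      form \<kappa> (partial k i (local_rep c (\<Phi> b)) x) (partial k j (local_rep c (velocity b)) x)))"

lemma area_density_derivative:
  assumes c: "c \<in> A" and b: "b \<in> I" and x: "x \<in> chart_image c"
  shows "((\<lambda>b. area_density c b x) has_real_derivative area_rate c b x) (at b within I)"
proof -
  let ?e = "\<lambda>i b. partial k i (local_rep c (\<Phi> b)) x" and ?v = "\<lambda>i. partial k i (local_rep c (velocity b)) x"
  let ?G' = "\<chi> i j. form \<kappa> (?v i) (?e j b) + form \<kappa> (?e i b) (?v j)"
  have "((\<lambda>b. gram \<kappa> k c (\<Phi> b) x $ i $ j) has_derivative (\<lambda>h. (h *\<^sub>R ?G') $ i $ j)) (at b within I)" for i j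
  proof -
    have "((\<lambda>b. form \<kappa> (?e i b) (?e j b)) has_derivative
        (\<lambda>h. form \<kappa> (?e i b) (h *\<^sub>R ?v j) + form \<kappa> (h *\<^sub>R ?v i) (?e j b))) (at b within I)"
      by (rule bounded_bilinear.FDERIV[OF bounded_bilinear_form
          partial_time_derivative[OF c b x, unfolded has_vector_derivative_def]
          partial_time_derivative[OF c b x, unfolded has_vector_derivative_def]])
    then show ?thesis
      by (simp add: gram_eq_gram_matrix gram_matrix_def algebra_simps
          bounded_bilinear.scaleR_left[OF bounded_bilinear_form] bounded_bilinear.scaleR_right[OF bounded_bilinear_form])
  qed
  from has_derivative_sqrt_det[OF this atlas_metric.gram_pos(1)[OF metric[OF b] c x]]
  have "((\<lambda>b. area_density c b x) has_derivative (\<lambda>h. sqrt (det (gram \<kappa> k c (\<Phi> b) x)) / 2 *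
      trace (matrix_inv (gram \<kappa> k c (\<Phi> b) x) ** (h *\<^sub>R ?G')))) (at b within I)"
    unfolding area_density_def .
  moreover have tr: "trace (B ** (h *\<^sub>R C)) = h * trace (B ** C)" for B C :: "real^'n^'n" and h
    by (simp add: trace_def matrix_matrix_mult_def sum_distrib_left mult_ac)
  have "(\<lambda>h. sqrt (det (gram \<kappa> k c (\<Phi> b) x)) / 2 * trace (matrix_inv (gram \<kappa> k c (\<Phi> b) x) ** (h *\<^sub>R ?G'))) =
      (*) (area_rate c b x)"
    unfolding tr area_rate_def by (simp add: fun_eq_iff)
  ultimately show ?thesis unfolding has_field_derivative_def by simp
qed

lemma continuous_area_density:
  assumes c: "c \<in> A"
  shows "continuous_on (I \<times> chart_image c) (\<lambda>(b, x). area_density c b x)"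
    "continuous_on (I \<times> chart_image c) (\<lambda>(b, x). area_rate c b x)"
proof -
  note cp = continuous_partial[OF c, unfolded case_prod_beta]
  note cv = continuous_partial_velocity[OF c, unfolded case_prod_beta]
  note cf = bounded_bilinear.continuous_on[OF bounded_bilinear_form]
  have G: "continuous_on (I \<times> chart_image c) (\<lambda>z. gram \<kappa> k c (\<Phi> (fst z)) (snd z) $ i $ j)" for i j
    unfolding gram_eq_gram_matrix gram_matrix_def by (simp add: cf[OF cp cp])
  then have D: "continuous_on (I \<times> chart_image c) (\<lambda>z. sqrt (det (gram \<kappa> k c (\<Phi> (fst z)) (snd z))))"
    by (intro continuous_on_real_sqrt continuous_on_det)
  then show "continuous_on (I \<times> chart_image c) (\<lambda>(b, x). area_density c b x)"
    by (simp add: case_prod_beta area_density_def)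
  have inv: "continuous_on (I \<times> chart_image c) (\<lambda>z. matrix_inv (gram \<kappa> k c (\<Phi> (fst z)) (snd z)) $ i $ j)" for i j
  proof (rule continuous_on_matrix_inv[OF G])
    fix z assume "z \<in> I \<times> chart_image c"
    then show "det (gram \<kappa> k c (\<Phi> (fst z)) (snd z)) \<noteq> 0"
      using atlas_metric.gram_pos(1)[OF metric _, of "fst z" c "snd z"] c by (auto simp: less_imp_neq[symmetric])
  qed
  show "continuous_on (I \<times> chart_image c) (\<lambda>(b, x). area_rate c b x)"
    unfolding case_prod_beta area_rate_def trace_def matrix_matrix_mult_def vec_lambda_beta
    by (intro continuous_on_mult continuous_on_divide continuous_on_sum continuous_on_add continuous_on_const D inv
        cf[OF cv cp] cf[OF cp cv]) simp
qed

text \<open>Here minimality enters. Two-sidedness supplies a unit normal at the point under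
  consideration, with which the velocity is decomposed and the mean curvature evaluated.\<close>

lemma area_rate_eq_divergence:
  assumes c: "c \<in> A" and x: "x \<in> chart_image c"
  shows "area_rate c a x = (\<Sum>i\<in>UNIV. partial k i (atlas_velocity.flux k \<kappa> (\<Phi> a) (velocity a) c i) x)"
proof -
  interpret atlas_velocity k M A \<kappa> "\<Phi> a" "velocity a" by (rule atlas_velocity)
  interpret c: chart_variation \<kappa> k "chart_image c" "local_rep c (\<Phi> a)" "local_rep c (velocity a)"
    by (rule chart_variation[OF c])
  let ?p = "chart_inv c x"
  have p: "?p \<in> fst c" "?p \<in> M" using chart_inv(3)[OF c x] chart_subset(1)[OF c] by auto
  obtain \<nu> where \<nu>: "unit_normal \<kappa> k A (\<Phi> a) ?p \<nu>"
    using two_sided[OF a] p(2) unfolding two_sided_def by blast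
  have \<nu>': "\<nu> \<in> tangent_space \<kappa> (local_rep c (\<Phi> a) x)" "form \<kappa> \<nu> \<nu> = 1"
    "form \<kappa> \<nu> (partial k i (local_rep c (\<Phi> a)) x) = 0" for i
    using \<nu> c p(1) chart_inv(2)[OF c x] unfolding unit_normal_def coord_vec_def local_rep_def by auto
  have H: "trace (matrix_inv (c.G x) ** (\<chi> i j. form \<kappa> (partial k i (partial k j (local_rep c (\<Phi> a))) x) \<nu>)) = 0"
  proof -
    have "mean_curvature \<kappa> k c (\<Phi> a) (snd c ?p) \<nu> = 0"
      using minimal[OF a] \<nu> c p(1) unfolding minimal_def by blast
    then show ?thesis
      unfolding mean_curvature_def second_ff_def gram_eq_gram_matrix c.G_def chart_inv(2)[OF c x] .
  qed
  have "local_rep c (velocity a) x \<in> tangent_space \<kappa> (local_rep c (\<Phi> a) x)"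
    by (rule tangent_curve[OF local_time_derivative[OF c a x] nontrivial a]) (rule frame(1)[OF _ c x])
  then obtain Y f where "local_rep c (velocity a) x = (\<Sum>i\<in>UNIV. Y $ i *\<^sub>R partial k i (local_rep c (\<Phi> a)) x) + f *\<^sub>R \<nu>"
    by (rule tangent_decomposition[OF dim frame[OF a c x] \<nu>'])
  from c.divergence_flux[OF x this \<nu>'(3) H] show ?thesis
    by (simp add: area_rate_def gram_eq_gram_matrix c.G_def)
qed

lemma boundary_flux:
  assumes c: "c \<in> A" and x: "x \<in> chart_image c" "x $ k = 0"
  shows "atlas_velocity.flux k \<kappa> (\<Phi> a) (velocity a) c k x =
    - (sqrt (det (boundary_gram \<kappa> k c (\<Phi> a) x)) * vector_derivative r (at a within I))"
proof -
  interpret atlas_velocity k M A \<kappa> "\<Phi> a" "velocity a" by (rule atlas_velocity)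
  interpret c: chart_variation \<kappa> k "chart_image c" "local_rep c (\<Phi> a)" "local_rep c (velocity a)"
    by (rule chart_variation[OF c])
  let ?p = "chart_inv c x"
  have pc: "?p \<in> fst c" "snd c ?p = x" using chart_inv(2,3)[OF c x(1)] by auto
  have p: "?p \<in> boundary k A" using boundary_chart[OF c pc(1)] pc(2) x(2) by simp
  obtain \<eta> where \<eta>: "outward_conormal \<kappa> k A (\<Phi> a) ?p \<eta>" "is_gradient \<kappa> (space_dist \<kappa> p\<^sub>0) (\<Phi> a ?p) \<eta>"
    using conormal[OF a p] by blast
  then obtain v where v: "v $ k < 0" "\<eta> = (\<Sum>i\<in>UNIV. v $ i *\<^sub>R partial k i (local_rep c (\<Phi> a)) x)"
    "\<And>i. i \<noteq> k \<Longrightarrow> form \<kappa> \<eta> (partial k i (local_rep c (\<Phi> a)) x) = 0" "form \<kappa> \<eta> \<eta> = 1"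
    using c pc unfolding outward_conormal_def coord_vec_def by fastforce
  \<comment> \<open>The boundary is the same set for all parameters, so a fixed boundary point moves
    within the spheres of radius \<open>r b\<close>.\<close>
  have "form \<kappa> \<eta> (local_rep c (velocity a) x) = vector_derivative r (at a within I)"
    by (rule radial_velocity[OF \<kappa> p0 local_time_derivative[OF c a x(1)] nontrivial a _ radius_derivative[OF a]])
      (use boundary_sphere p r a \<eta>(2) in \<open>auto simp: local_rep_def\<close>)
  then show ?thesis
    using c.boundary_flux[OF x(1) v(2,4,1,3)] by (simp add: boundary_gram_eq gram_eq_gram_matrix c.G_def)
qed

lemma volume_derivative:
  "((\<lambda>a. induced_volume \<kappa> k M A (\<Phi> a)) has_real_derivative
     vector_derivative r (at a within I) * induced_boundary_volume \<kappa> k A (\<Phi> a)) (at a within I)"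
proof -
  obtain P :: "'m set" and ch K and w :: "'m \<Rightarrow> 'm \<Rightarrow> real" where P: "finite P" "\<And>p. p \<in> P \<Longrightarrow> ch p \<in> A"
    "\<And>p. p \<in> P \<Longrightarrow> compact (K p)" "\<And>p. p \<in> P \<Longrightarrow> K p \<subseteq> fst (ch p)"
    "\<And>p. p \<in> P \<Longrightarrow> C1_map k A (w p)" "\<And>p q. p \<in> P \<Longrightarrow> 0 \<le> w p q" "\<And>p q. p \<in> P \<Longrightarrow> q \<notin> K p \<Longrightarrow> w p q = 0"
    "\<And>q. q \<in> M \<Longrightarrow> (\<Sum>p\<in>P. w p q) = 1"
    by (rule partition_of_unity) (rule that; assumption)
  interpret atlas_velocity k M A \<kappa> "\<Phi> a" "velocity a" by (rule atlas_velocity)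
  let ?V = "\<lambda>p b. \<integral>x. indicator (chart_image (ch p)) x * (area_density (ch p) b x * local_rep (ch p) (w p) x) \<partial>lborel"
  \<comment> \<open>Charts and weights do not depend on the parameter, so one partition of unity
    expresses the volumes for all \<open>b\<close> in \<open>I\<close>, and the sum can be
    differentiated term by term.\<close>
  have vol: "induced_volume \<kappa> k M A (\<Phi> b) = (\<Sum>p\<in>P. ?V p b)" if b: "b \<in> I" for b
  proof -
    interpret b: atlas_metric k M A \<kappa> "\<Phi> b" by (rule metric[OF b])
    have "induced_volume \<kappa> k M A (\<Phi> b) = (\<Sum>p\<in>P. \<integral>x. indicator (snd (ch p) ` (fst (ch p) \<inter> M)) x *
        (sqrt (det (gram \<kappa> k (ch p) (\<Phi> b) x)) * local_rep (ch p) (w p) x) \<partial>lborel)"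
      unfolding induced_volume_def by (rule b.bulk.total_density_measure(2)[OF b.volume_measure P(1-5) P(7) P(8)])
    also have "\<dots> = (\<Sum>p\<in>P. ?V p b)"
      by (intro sum.cong refl) (simp add: bulk_image[OF P(2)] area_density_def)
    finally show ?thesis .
  qed
  have "(?V p has_real_derivative (\<integral>x. indicator (chart_image (ch p)) x *
      (local_rep (ch p) (w p) x * area_rate (ch p) a x) \<partial>lborel)) (at a within I)" if p: "p \<in> P" for p
  proof (rule weighted_integral_derivative[OF interval a chart(2)[OF P(2)[OF p]]])
    let ?c = "ch p"
    have c: "?c \<in> A" by (rule P(2)[OF p])
    show "compact (snd ?c ` K p)"
      by (rule compact_continuous_image[OF continuous_on_subset[OF homeomorphism_cont1[OF chart(3)[OF c]] P(4)[OF p]] P(3)[OF p]])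
    show "snd ?c ` K p \<subseteq> chart_image ?c" using P(4)[OF p] by auto
    show "continuous_on (chart_image ?c) (local_rep ?c (w p))"
      by (rule C1_continuous_on[OF C1_mapD[OF P(5)[OF p] c]])
    show "local_rep ?c (w p) x = 0" if "x \<in> chart_image ?c" "x \<notin> snd ?c ` K p" for x
      using that P(7)[OF p, of "chart_inv ?c x"] c by (auto simp: local_rep_def image_iff)
  qed (use continuous_area_density area_density_derivative P(2)[OF p] in auto)
  then have "((\<lambda>b. \<Sum>p\<in>P. ?V p b) has_real_derivative (\<Sum>p\<in>P. \<integral>x. indicator (chart_image (ch p)) x *
      (local_rep (ch p) (w p) x * area_rate (ch p) a x) \<partial>lborel)) (at a within I)"
    by (rule DERIV_sum)
  also have "(\<Sum>p\<in>P. \<integral>x. indicator (chart_image (ch p)) x *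
      (local_rep (ch p) (w p) x * area_rate (ch p) a x) \<partial>lborel) =
    (\<Sum>p\<in>P. \<integral>x. indicator (chart_image (ch p)) x *
      (local_rep (ch p) (w p) x * (\<Sum>i\<in>UNIV. partial k i (flux (ch p) i) x)) \<partial>lborel)"
    using area_rate_eq_divergence[OF P(2)]
    by (intro sum.cong refl Bochner_Integration.integral_cong) (auto split: split_indicator)
  also have "\<dots> = vector_derivative r (at a within I) * induced_boundary_volume \<kappa> k A (\<Phi> a)"
    by (rule variation_integral[OF P(1-5) P(7) P(8) boundary_flux])
  finally have D: "((\<lambda>b. \<Sum>p\<in>P. ?V p b) has_real_derivative
      vector_derivative r (at a within I) * induced_boundary_volume \<kappa> k A (\<Phi> a)) (at a within I)" .
  show ?thesis
    by (rule has_field_derivative_transform_within[OF D zero_less_one a]) (erule vol[symmetric])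
qed

end

lemma critical_points_volume:
  "critical_points I (\<lambda>a. induced_volume \<kappa> k M A (\<Phi> a)) = critical_points I r"
proof -
  have "((\<lambda>a. induced_volume \<kappa> k M A (\<Phi> a)) has_real_derivative 0) (at a within I) \<longleftrightarrow>
      (r has_real_derivative 0) (at a within I)" if a: "a \<in> I" for a
  proof (cases "at a within I = bot")
    case True
    then show ?thesis by (simp add: has_field_derivative_iff)
  next
    case False
    let ?r' = "vector_derivative r (at a within I)"
    \<comment> \<open>Derivatives within \<open>I\<close> are unique here, so the two conditions say
      that \<open>?r'\<close> times the boundary volume is 0 and that \<open>?r'\<close> is 0; the
      boundary volume is positive.\<close>
    have unique: "(f has_real_derivative d) (at a within I) \<Longrightarrow> (f has_real_derivative e) (at a within I) \<longleftrightarrow> d = e"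
      for f d e
      using vector_derivative_unique_within[OF False] by (auto simp: has_real_derivative_iff_has_vector_derivative)
    show ?thesis
      using volume_pos[OF a] unique[OF volume_derivative[OF a False]] unique[OF radius_derivative[OF a]] by simp
  qed
  then show ?thesis by (auto simp: critical_points_def)
qed

end

theorem proposition4p4:
  fixes \<kappa> :: real
    and k :: "'n::finite"
    and M :: "'m::t2_space set"
    and A :: "('m, 'n) chart set"
    and p\<^sub>0 :: "real \<times> 'v::euclidean_space"
    and I :: "real set"
    and r :: "real \<Rightarrow> real"
    and \<Phi> :: "real \<Rightarrow> 'm \<Rightarrow> real \<times> 'v"
  assumes "\<kappa> \<in> {-1, 0, 1}"
    and "DIM('v) = CARD('n) + 1"
    and "p\<^sub>0 \<in> space_form \<kappa>"
    and "variable_radius_family \<kappa> k M A p\<^sub>0 I r \<Phi>"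
  shows "(\<forall>a\<in>I. ((\<lambda>a. induced_volume \<kappa> k M A (\<Phi> a)) has_real_derivative
             vector_derivative r (at a within I) * induced_boundary_volume \<kappa> k A (\<Phi> a)) (at a within I)) \<and>
         (\<forall>a\<in>I. 0 < induced_boundary_volume \<kappa> k A (\<Phi> a)) \<and>
         critical_points I (\<lambda>a. induced_volume \<kappa> k M A (\<Phi> a)) = critical_points I r"
proof -
  interpret radius_family \<kappa> k M A p\<^sub>0 I r \<Phi>
    by unfold_locales (rule assms)+
  have "((\<lambda>a. induced_volume \<kappa> k M A (\<Phi> a)) has_real_derivative
      vector_derivative r (at a within I) * induced_boundary_volume \<kappa> k A (\<Phi> a)) (at a within I)" if "a \<in> I" for a
  proof (cases "at a within I = bot")
    case True
    then show ?thesis by (simp add: has_field_derivative_iff)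
  next
    case False
    then show ?thesis by (rule volume_derivative[OF that])
  qed
  then show ?thesis using volume_pos critical_points_volume by blast
qed

end
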